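(* Let $n\ge 1$ and let $P\subset\mathbb{R}^2$ be a convex $(n+3)$-gon with no two vertices on the same vertical line. The following two subsets of $\mathbb{R}^{n+1}$ are equal, and the resulting polytope $\mathsf{Asso}(P)$ is an $n$-dimensional associahedron: (i) the convex hull of the points $\mathbf{x}(T)$ for all triangulations $T$ of $P$; (ii) the intersection of the hyperplane $H$ with the half-spaces $H^{\ge}(\delta)$ for all diagonals $\delta$ of $P$.
   Context: Vertices of $P$: label the vertices of $P$ by $0,1,\dots,n+2$ in order of increasing $x$-coordinate. Write $[n+1]=\{1,\dots,n+1\}$. Let $U\subseteq[n+1]$ (up labels) and $D\subseteq[n+1]$ (down labels) be the sets of labels of the vertices among $1,\dots,n+1$ lying on the upper hull and on the lower hull of $P$, respectively (so $[n+1]=U\sqcup D$; the vertices $0$ and $n+2$ are neither up nor down). Diagonals: a diagonal of $P$ is a segment joining two vertices of $P$; it may be internal or a boundary edge. A dissection of $P$ is a set of pairwise non-crossing internal diagonals; a triangulation is an inclusion-maximal dissection. For a diagonal $\delta$ (internal or not), $\mathsf{B}(\delta)\subseteq[n+1]$ is the set of labels $j\in[n+1]$ of the vertices lying strictly below the line supporting $\delta$, together with the labels of those endpoints of $\delta$ that are up vertices (endpoints that are down vertices are excluded, and $0,n+2$ are never included). Spine: the spine $T^*$ of a triangulation $T$ is its dual tree, oriented and labeled as follows. It has an internal node $j^*$ for each triangle with vertices $i<j<k$ of $T$ (this gives exactly one node for each $j\in[n+1]$); an arc $\delta^*$ for each internal diagonal $\delta\in T$, oriented from the triangle below $\delta$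 to the triangle above $\delta$; and an outgoing (resp. incoming) blossom (pendant half-edge) $\delta^*$ for each top (resp. bottom) boundary edge $\delta$ of $P$, attached to the node of the triangle containing $\delta$. Up nodes (labels in $U$) have indegree one and outdegree two, down nodes (labels in $D$) have indegree two and outdegree one, blossoms being counted. The point $\mathbf{x}(T)\in\mathbb{R}^{n+1}$: let $\Pi$ be the set of undirected paths in $T^*$ connecting two distinct blossoms. For $j\in[n+1]$, let $\mathsf{R}(j)\subseteq\Pi$ be the set of such paths that pass through $j^*$ using its two incoming arcs if $j\in D$, or its two outgoing arcs if $j\in U$ (arcs here include blossoms). Then $x_j(T)=|\mathsf{R}(j)|$ if $j\in D$ and $x_j(T)=n+2-|\mathsf{R}(j)|$ if $j\in U$. Hyperplanes and half-spaces: for $J\subseteq[n+1]$, let $H^{=}(J)=\{\mathbf{x}\in\mathbb{R}^{n+1}:\sum_{j\in J}x_j=\binom{|J|+1}{2}\}$ and $H^{\ge}(J)=\{\mathbf{x}\in\mathbb{R}^{n+1}:\sum_{j\in J}x_j\ge\binom{|J|+1}{2}\}$. Set $H=H^{=}([n+1])$ and $H^{\ge}(\delta)=H^{\ge}(\mathsf{B}(\delta))$ for a diagonal $\delta$. An $n$-dimensional associahedron is a simple $n$-dimensional polytope whose inclusion poset of non-empty faces is isomorphic to the reverse inclusion poset of the dissections of a convex $(n+3)$-gon. *)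

theory Defs
  imports "HOL-Analysis.Analysis"
begin

section \<open>Convex polygons, labels, diagonals\<close>

definition verts :: "'a::real_vector set \<Rightarrow> 'a set" where
  "verts S = {v. v extreme_point_of S}"

definition convex_polygon :: "nat \<Rightarrow> (real^2) set \<Rightarrow> bool" where
  "convex_polygon k P \<longleftrightarrow> polytope P \<and> aff_dim P = 2 \<and> card (verts P) = k"

text \<open>The \<open>x\<close>-coordinate is \<open>v $ 1\<close>. When the vertices have distinct \<open>x\<close>-coordinates, the following
  numbers them \<open>0, 1, 2, \<dots>\<close> from left to right.\<close>

definition vlabel :: "(real^2) set \<Rightarrow> real^2 \<Rightarrow> nat" where
  "vlabel P v = card {w \<in> verts P. w $ 1 < v $ 1}"

definition upper_hull :: "(real^2) set \<Rightarrow> (real^2) set" where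
  "upper_hull P = {z \<in> P. \<forall>y\<in>P. y $ 1 = z $ 1 \<longrightarrow> y $ 2 \<le> z $ 2}"

definition lower_hull :: "(real^2) set \<Rightarrow> (real^2) set" where
  "lower_hull P = {z \<in> P. \<forall>y\<in>P. y $ 1 = z $ 1 \<longrightarrow> z $ 2 \<le> y $ 2}"

definition up_labels :: "nat \<Rightarrow> (real^2) set \<Rightarrow> nat set" where
  "up_labels n P = {1..n+1} \<inter> vlabel P ` (verts P \<inter> upper_hull P)"

definition down_labels :: "nat \<Rightarrow> (real^2) set \<Rightarrow> nat set" where
  "down_labels n P = {1..n+1} \<inter> vlabel P ` (verts P \<inter> lower_hull P)"

text \<open>A diagonal is a segment, as a set of points; the boundary diagonals of \<open>P\<close> are its edges.\<close>

definition diagonals :: "(real^2) set \<Rightarrow> (real^2) set set" where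
  "diagonals P = {closed_segment a b | a b. a \<in> verts P \<and> b \<in> verts P \<and> a \<noteq> b}"

definition internal_diagonals :: "(real^2) set \<Rightarrow> (real^2) set set" where
  "internal_diagonals P = {\<delta> \<in> diagonals P. \<not> \<delta> edge_of P}"

definition crossing :: "(real^2) set \<Rightarrow> (real^2) set \<Rightarrow> bool" where
  "crossing \<delta> \<epsilon> \<longleftrightarrow> \<delta> \<noteq> \<epsilon> \<and> rel_interior \<delta> \<inter> rel_interior \<epsilon> \<noteq> {}"

definition dissection :: "(real^2) set \<Rightarrow> (real^2) set set \<Rightarrow> bool" where
  "dissection P S \<longleftrightarrow> S \<subseteq> internal_diagonals P \<and> (\<forall>\<delta>\<in>S. \<forall>\<epsilon>\<in>S. \<not> crossing \<delta> \<epsilon>)"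

definition triangulation :: "(real^2) set \<Rightarrow> (real^2) set set \<Rightarrow> bool" where
  "triangulation P T \<longleftrightarrow> dissection P T \<and> (\<forall>S. dissection P S \<and> T \<subseteq> S \<longrightarrow> S = T)"

definition strictly_below :: "real^2 \<Rightarrow> (real^2) set \<Rightarrow> bool" where
  "strictly_below z L \<longleftrightarrow> (\<exists>q\<in>L. q $ 1 = z $ 1 \<and> z $ 2 < q $ 2)"

definition strictly_above :: "real^2 \<Rightarrow> (real^2) set \<Rightarrow> bool" where
  "strictly_above z L \<longleftrightarrow> (\<exists>q\<in>L. q $ 1 = z $ 1 \<and> q $ 2 < z $ 2)"

text \<open>\<open>affine hull \<delta>\<close> is the line supporting \<open>\<delta>\<close>; a vertex of \<open>P\<close> lying in \<open>\<delta>\<close> is an endpoint of \<open>\<delta>\<close>.\<close>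

definition B_labels :: "nat \<Rightarrow> (real^2) set \<Rightarrow> (real^2) set \<Rightarrow> nat set" where
  "B_labels n P \<delta> =
     {j \<in> {1..n+1}. \<exists>v\<in>verts P. vlabel P v = j \<and>
        (strictly_below v (affine hull \<delta>) \<or> v \<in> \<delta> \<and> j \<in> up_labels n P)}"


section \<open>The spine of a triangulation\<close>

text \<open>A triangle of \<open>T\<close> is recorded as the triple of its corners from left to right. Because the
  vertices of \<open>P\<close> are in convex position, three vertices span a triangle of \<open>T\<close> as soon as the three
  segments joining them belong to \<open>T\<close> or are edges of \<open>P\<close>. The triangle \<open>(a, b, c)\<close> is the spine node
  labelled \<open>vlabel P b\<close>.\<close>

type_synonym triangle = "(real^2) \<times> (real^2) \<times> (real^2)"

fun corners :: "triangle \<Rightarrow> (real^2) set" where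
  "corners (a, b, c) = {a, b, c}"

fun sides :: "triangle \<Rightarrow> (real^2) set set" where
  "sides (a, b, c) = {closed_segment a b, closed_segment b c, closed_segment a c}"

fun node_label :: "(real^2) set \<Rightarrow> triangle \<Rightarrow> nat" where
  "node_label P (a, b, c) = vlabel P b"

definition triangles :: "(real^2) set \<Rightarrow> (real^2) set set \<Rightarrow> triangle set" where
  "triangles P T = {(a, b, c). {a, b, c} \<subseteq> verts P \<and> a $ 1 < b $ 1 \<and> b $ 1 < c $ 1 \<and>
     sides (a, b, c) \<subseteq> T \<union> {\<delta>. \<delta> edge_of P}}"

text \<open>For a side \<open>\<delta>\<close> of \<open>t\<close>, only the corner opposite to \<open>\<delta>\<close> can be off the supporting line of \<open>\<delta>\<close>.\<close>

definition triangle_below :: "triangle \<Rightarrow> (real^2) set \<Rightarrow> bool" where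
  "triangle_below t \<delta> \<longleftrightarrow> (\<exists>v\<in>corners t. strictly_below v (affine hull \<delta>))"

definition triangle_above :: "triangle \<Rightarrow> (real^2) set \<Rightarrow> bool" where
  "triangle_above t \<delta> \<longleftrightarrow> (\<exists>v\<in>corners t. strictly_above v (affine hull \<delta>))"

definition top_edges :: "(real^2) set \<Rightarrow> (real^2) set set" where
  "top_edges P = {\<delta>. \<delta> edge_of P \<and> \<delta> \<subseteq> upper_hull P}"

definition bottom_edges :: "(real^2) set \<Rightarrow> (real^2) set set" where
  "bottom_edges P = {\<delta>. \<delta> edge_of P \<and> \<delta> \<subseteq> lower_hull P}"

text \<open>The arc or blossom dual to \<open>\<delta>\<close> is represented by \<open>\<delta>\<close> itself. The spine is given by the arcs
  (blossoms included) entering and leaving each node: the dual arc of an internal diagonal leaves the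
  triangle below it and enters the triangle above it.\<close>

definition incoming :: "(real^2) set \<Rightarrow> (real^2) set set \<Rightarrow> triangle \<Rightarrow> (real^2) set set" where
  "incoming P T t = {\<delta> \<in> T. \<delta> \<in> sides t \<and> triangle_above t \<delta>} \<union> (bottom_edges P \<inter> sides t)"

definition outgoing :: "(real^2) set \<Rightarrow> (real^2) set set \<Rightarrow> triangle \<Rightarrow> (real^2) set set" where
  "outgoing P T t = {\<delta> \<in> T. \<delta> \<in> sides t \<and> triangle_below t \<delta>} \<union> (top_edges P \<inter> sides t)"

definition incident :: "(real^2) set \<Rightarrow> (real^2) set set \<Rightarrow> triangle \<Rightarrow> (real^2) set set" where
  "incident P T t = incoming P T t \<union> outgoing P T t"

definition blossoms :: "(real^2) set \<Rightarrow> (real^2) set set" where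
  "blossoms P = top_edges P \<union> bottom_edges P"

text \<open>A path \<open>d\<^sub>0 t\<^sub>1 d\<^sub>1 \<dots> t\<^sub>m d\<^sub>m\<close> in the spine, ignoring orientations, from the blossom \<open>d\<^sub>0\<close> to a
  different blossom \<open>d\<^sub>m\<close>; \<open>ts\<close> lists its nodes and \<open>ds\<close> its arcs.\<close>

definition blossom_path ::
    "(real^2) set \<Rightarrow> (real^2) set set \<Rightarrow> triangle list \<Rightarrow> (real^2) set list \<Rightarrow> bool" where
  "blossom_path P T ts ds \<longleftrightarrow>
     length ds = Suc (length ts) \<and> distinct ts \<and> distinct ds \<and> set ts \<subseteq> triangles P T \<and>
     (\<forall>i<length ts. ds ! i \<in> incident P T (ts ! i) \<and> ds ! Suc i \<in> incident P T (ts ! i)) \<and>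
     hd ds \<in> blossoms P \<and> last ds \<in> blossoms P \<and> hd ds \<noteq> last ds"

text \<open>An undirected path is identified with its set of arcs, so that a path and its reversal are
  counted only once.\<close>

definition blossom_paths :: "(real^2) set \<Rightarrow> (real^2) set set \<Rightarrow> (real^2) set set set" where
  "blossom_paths P T = {set ds | ts ds. blossom_path P T ts ds}"

definition R_paths :: "nat \<Rightarrow> (real^2) set \<Rightarrow> (real^2) set set \<Rightarrow> nat \<Rightarrow> (real^2) set set set" where
  "R_paths n P T j =
     {\<pi> \<in> blossom_paths P T. \<exists>t\<in>triangles P T. node_label P t = j \<and>
        (if j \<in> down_labels n P then incoming P T t \<subseteq> \<pi> else outgoing P T t \<subseteq> \<pi>)}"


section \<open>The realization space\<close>

text \<open>\<open>\<real>\<^sup>n\<^sup>+\<^sup>1\<close> is \<open>real^'m\<close>, where a bijection \<open>lab\<close> from \<open>'m\<close> to \<open>{1..n+1}\<close> names the coordinates: the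
  coordinate \<open>x\<^sub>j\<close> is \<open>x $ m\<close> for the index \<open>m\<close> with \<open>lab m = j\<close>.\<close>

definition x_point ::
    "nat \<Rightarrow> (real^2) set \<Rightarrow> ('m::finite \<Rightarrow> nat) \<Rightarrow> (real^2) set set \<Rightarrow> real^'m" where
  "x_point n P lab T =
     (\<chi> m. if lab m \<in> down_labels n P then real (card (R_paths n P T (lab m)))
           else real (n + 2) - real (card (R_paths n P T (lab m))))"

definition H_eq :: "('m::finite \<Rightarrow> nat) \<Rightarrow> nat set \<Rightarrow> (real^'m) set" where
  "H_eq lab J = {x. (\<Sum>m | lab m \<in> J. x $ m) = real ((card J + 1) choose 2)}"

definition H_ge :: "('m::finite \<Rightarrow> nat) \<Rightarrow> nat set \<Rightarrow> (real^'m) set" where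
  "H_ge lab J = {x. (\<Sum>m | lab m \<in> J. x $ m) \<ge> real ((card J + 1) choose 2)}"

definition Asso :: "nat \<Rightarrow> (real^2) set \<Rightarrow> ('m::finite \<Rightarrow> nat) \<Rightarrow> (real^'m) set" where
  "Asso n P lab = convex hull {x_point n P lab T | T. triangulation P T}"


section \<open>Associahedra\<close>

text \<open>A polytope is simple if each of its vertices lies in exactly as many facets as the dimension.\<close>

definition simple_polytope :: "'a::euclidean_space set \<Rightarrow> bool" where
  "simple_polytope S \<longleftrightarrow>
     polytope S \<and> (\<forall>v\<in>verts S. int (card {F. F facet_of S \<and> v \<in> F}) = aff_dim S)"

text \<open>The isomorphism type of the dissection poset does not depend on the polygon \<open>Q\<close>.\<close>

definition associahedron :: "nat \<Rightarrow> 'a::euclidean_space set \<Rightarrow> bool" where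
  "associahedron n S \<longleftrightarrow>
     simple_polytope S \<and> aff_dim S = int n \<and>
     (\<exists>Q f. convex_polygon (n + 3) Q \<and>
        bij_betw f {F. F face_of S \<and> F \<noteq> {}} {X. dissection Q X} \<and>
        (\<forall>F G. F face_of S \<and> F \<noteq> {} \<and> G face_of S \<and> G \<noteq> {} \<longrightarrow> (F \<subseteq> G \<longleftrightarrow> f G \<subseteq> f F)))"

end

theory Submission
  imports Defs
begin

text \<open>
  The sets \<open>B(\<delta>)\<close> of two crossing diagonals can be uncrossed: their intersection and union are the sets
  of two opposite sides of the quadrilateral spanned by the endpoints. As \<open>m \<mapsto> m (m + 1) / 2\<close> is strictly
  convex, two inequalities given by crossing diagonals are never tight together on the polytope, so
  the tight sets are dissections. Conversely, the system given by a triangulation \<open>T\<close> is uniquely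
  solvable: the triangle relation between the sets of the three sides recovers every coordinate, and
  for \<open>\<delta> \<in> T\<close> the difference of the basis vectors of the triangles below and above \<open>\<delta>\<close> is dual to \<open>\<delta>\<close>. The
  triangle relation identifies the solution with \<open>\<^bold>x(T)\<close>, as the number of paths through a node is a
  product of two numbers of blossoms. Uncrossing along a diagonal of \<open>T\<close>, by induction on the number
  of diagonals of \<open>T\<close> crossed by \<open>\<epsilon>\<close>, gives all inequalities at \<open>\<^bold>x(T)\<close>, strictly off \<open>T\<close>. Faces are
  therefore indexed by dissections, through the set of inequalities that are tight on them.
\<close>

text \<open>The geometry enters only through the cyclic order of the vertices: once
  \<open>ccw\<close> on labels agrees with orientation in the plane, diagonals, crossings and the
  sets B(\<delta>) depend only on which labels are up. Counting the up endpoints in B(\<delta>)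
  makes the sets compatible with triangles: the median of a triangle of \<open>T\<close> lies in
  B(\<delta>) iff the triangle lies below \<delta>. This gives the dual vectors and also the
  uniqueness of the node labelled \<open>j\<close>. Two standard facts are obtained indirectly. That
  the spine is a tree is expressed by the way each arc splits the blossoms into two sets. That a
  triangulation has n diagonals comes from comparing two computations of the dimension of the
  polytope. The description by half-spaces does not show boundedness; for this, each coordinate is
  squeezed between two bounds given by suitable triangles. A boundary edge has B empty or full, so
  its inequality follows from the equation of \<open>H\<close>, and the facets are indexed by the
  internal diagonals.\<close>

section \<open>Paths between blossoms of a tree\<close>

text \<open>\<open>far t d\<close> is the set of blossoms that the arc \<open>d\<close> separates from the node \<open>t\<close>. It strictly decreases along
  a walk that does not turn back, so such walks are paths, and the last blossom determines each step.\<close>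

locale spine =
  fixes N :: "'n set" and sd :: "'n \<Rightarrow> 'a set" and Bl :: "'a set" and far :: "'n \<Rightarrow> 'a \<Rightarrow> 'a set"
  assumes finite_Bl: "finite Bl"
    and far_disjoint: "\<lbrakk>t \<in> N; d \<in> sd t; d' \<in> sd t; d \<noteq> d'\<rbrakk> \<Longrightarrow> far t d \<inter> far t d' = {}"
    and far_cover: "t \<in> N \<Longrightarrow> (\<Union>d\<in>sd t. far t d) = Bl"
    and far_nonempty: "\<lbrakk>t \<in> N; d \<in> sd t\<rbrakk> \<Longrightarrow> far t d \<noteq> {}"
    and far_opposite: "\<lbrakk>t \<in> N; t' \<in> N; t \<noteq> t'; d \<in> sd t; d \<in> sd t'\<rbrakk> \<Longrightarrow> far t' d = Bl - far t d"
    and far_blossom: "\<lbrakk>t \<in> N; d \<in> sd t; d \<in> Bl\<rbrakk> \<Longrightarrow> far t d = {d}"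
    and other_node: "\<lbrakk>t \<in> N; d \<in> sd t; d \<notin> Bl\<rbrakk> \<Longrightarrow> \<exists>t'\<in>N. t' \<noteq> t \<and> d \<in> sd t'"
    and third_side: "t \<in> N \<Longrightarrow> \<exists>d''\<in>sd t. d'' \<noteq> d \<and> d'' \<noteq> d'"
begin

text \<open>Only local conditions: neither an arc nor a node is repeated at once. This form is
  stable under prepending and reversal, and the distinctness demanded of a path follows from
  it.\<close>

definition walk :: "'n list \<Rightarrow> 'a list \<Rightarrow> bool" where
  "walk ts ds \<longleftrightarrow> length ds = Suc (length ts) \<and> set ts \<subseteq> N \<and>
     (\<forall>i<length ts. ds ! i \<in> sd (ts ! i) \<and> ds ! Suc i \<in> sd (ts ! i) \<and> ds ! i \<noteq> ds ! Suc i) \<and>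
     (\<forall>i. Suc i < length ts \<longrightarrow> ts ! i \<noteq> ts ! Suc i)"

definition tree_path :: "'n list \<Rightarrow> 'a list \<Rightarrow> bool" where
  "tree_path ts ds \<longleftrightarrow> length ds = Suc (length ts) \<and> distinct ts \<and> distinct ds \<and> set ts \<subseteq> N \<and>
     (\<forall>i<length ts. ds ! i \<in> sd (ts ! i) \<and> ds ! Suc i \<in> sd (ts ! i)) \<and>
     hd ds \<in> Bl \<and> last ds \<in> Bl \<and> hd ds \<noteq> last ds"

lemma far_subset: "t \<in> N \<Longrightarrow> d \<in> sd t \<Longrightarrow> far t d \<subseteq> Bl"
  using far_cover by blast

lemma finite_far: "t \<in> N \<Longrightarrow> d \<in> sd t \<Longrightarrow> finite (far t d)"
  using far_subset finite_Bl finite_subset by metis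

lemma blossom_one_node:
  assumes "t \<in> N" "t' \<in> N" "d \<in> sd t" "d \<in> sd t'" "d \<in> Bl"
  shows "t = t'"
proof (rule ccontr)
  assume "t \<noteq> t'"
  then have "far t' d = Bl - far t d" using assms far_opposite by blast
  then show False using far_blossom assms by blast
qed

text \<open>With three distinct nodes on one arc, the far sets at two of them would be equal and
  complementary at once.\<close>

lemma two_nodes:
  assumes "t \<in> N" "t' \<in> N" "t'' \<in> N" "d \<in> sd t" "d \<in> sd t'" "d \<in> sd t''" "t' \<noteq> t" "t'' \<noteq> t"
  shows "t' = t''"
proof (rule ccontr)
  assume n: "t' \<noteq> t''"
  have "far t' d = Bl - far t d" using far_opposite[of t t' d] assms by auto
  moreover have "far t'' d = Bl - far t d" using far_opposite[of t t'' d] assms by auto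
  moreover have "far t'' d = Bl - far t' d" using far_opposite[of t' t'' d] assms n by auto
  ultimately show False
    using far_subset[of t d] far_subset[of t' d] far_nonempty[of t d] far_nonempty[of t' d] assms by blast
qed

section \<open>Far sets along a walk\<close>

lemma path_imp_walk: "tree_path ts ds \<Longrightarrow> walk ts ds"
  unfolding tree_path_def walk_def by (auto simp: nth_eq_iff_index_eq)

text \<open>The far sets of \<open>d'\<close> and of a third arc at \<open>t'\<close> are disjoint
  nonempty parts of \<open>far t d\<close>; the third arc makes the inclusion strict.\<close>

lemma far_step:
  assumes "t \<in> N" "t' \<in> N" "t \<noteq> t'" "d \<in> sd t" "d \<in> sd t'" "d' \<in> sd t'" "d \<noteq> d'"
  shows "far t' d' \<subset> far t d"
proof -
  have o: "far t' d = Bl - far t d" using far_opposite[of t t' d] assms by auto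
  have "far t' d' \<inter> far t' d = {}" using far_disjoint assms by metis
  then have sub: "far t' d' \<subseteq> far t d" using o far_subset[of t' d'] assms by blast
  obtain d3 where d3: "d3 \<in> sd t'" "d3 \<noteq> d" "d3 \<noteq> d'" using third_side assms(2) by metis
  have "far t' d3 \<inter> far t' d = {}" "far t' d3 \<inter> far t' d' = {}" using far_disjoint assms d3 by metis+
  then have "far t' d3 \<subseteq> far t d" "far t' d3 \<inter> far t' d' = {}" "far t' d3 \<noteq> {}"
    using o far_subset[of t' d3] far_nonempty assms d3 by blast+
  then show ?thesis using sub by blast
qed

lemma far_decreasing:
  assumes w: "walk ts ds" and "i < k" "k < length ts"
  shows "far (ts ! k) (ds ! Suc k) \<subset> far (ts ! i) (ds ! Suc i)"
  using assms(2,3)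
proof (induction k)
  case (Suc k)
  have N: "ts ! j \<in> N" if "j < length ts" for j using w that by (auto simp: walk_def)
  have s: "far (ts ! Suc k) (ds ! Suc (Suc k)) \<subset> far (ts ! k) (ds ! Suc k)"
    by (rule far_step) (use w Suc.prems N in \<open>auto simp: walk_def\<close>)
  show ?case
  proof (cases "i = k")
    case False
    then show ?thesis using Suc s by force
  qed (use s in auto)
qed simp

text \<open>At one node two far sets are equal or disjoint, and never empty; this excludes the
  strict inclusion given by \<open>far_decreasing\<close>.\<close>

lemma walk_distinct_nodes:
  assumes w: "walk ts ds"
  shows "distinct ts"
proof -
  have "ts ! i \<noteq> ts ! k" if ik: "i < k" "k < length ts" for i k
  proof
    assume e: "ts ! i = ts ! k"
    have "ts ! k \<in> N" "ds ! Suc k \<in> sd (ts ! k)" "ts ! i \<in> N" "ds ! Suc i \<in> sd (ts ! i)"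
      using w ik by (auto simp: walk_def)
    then have N: "ts ! i \<in> N" "ds ! Suc k \<in> sd (ts ! i)" "ds ! Suc i \<in> sd (ts ! i)"
      using e by simp_all
    show False
      using far_decreasing[OF w ik] far_disjoint[OF N] far_nonempty[OF N(1,2)] e
      by (cases "ds ! Suc k = ds ! Suc i") auto
  qed
  then show ?thesis unfolding distinct_conv_nth by (metis linorder_neqE_nat)
qed

lemma walk_distinct_arcs:
  assumes w: "walk ts ds"
  shows "distinct ds"
proof -
  have "ds ! i \<noteq> ds ! Suc k" if ik: "i \<le> k" "k < length ts" for i k
  proof (cases "i = k")
    case True
    then show ?thesis using w ik by (auto simp: walk_def)
  next
    case False
    then have l: "i < k" using ik by auto
    have N: "ts ! i \<in> N" "ts ! k \<in> N" "ds ! i \<in> sd (ts ! i)" "ds ! Suc i \<in> sd (ts ! i)" "ds ! i \<noteq> ds ! Suc i"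
      "ds ! Suc k \<in> sd (ts ! k)"
      using w ik l by (auto simp: walk_def)
    have ne: "ts ! i \<noteq> ts ! k" using walk_distinct_nodes[OF w] l ik by (auto simp: nth_eq_iff_index_eq)
    show ?thesis
    proof
      \<comment> \<open>The far set of this arc at node \<open>k\<close> is the complement of the
        one at node \<open>i\<close>, so it contains the far set ahead of node \<open>i\<close>,
        which strictly contains it.\<close>
      assume e: "ds ! i = ds ! Suc k"
      have "far (ts ! k) (ds ! i) = Bl - far (ts ! i) (ds ! i)" using far_opposite N ne e by metis
      then show False using far_decreasing[OF w l ik(2)] far_disjoint[OF N(1,3,4,5)] e
          far_subset[OF N(1,4)] by auto
    qed
  qed
  then have "ds ! i \<noteq> ds ! k" if "i < k" "k < length ds" for i k
    using that w by (cases k) (auto simp: walk_def)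
  then show ?thesis unfolding distinct_conv_nth by (metis linorder_neqE_nat)
qed

lemma walk_imp_path:
  assumes "walk ts ds" "ts \<noteq> []" "hd ds \<in> Bl" "last ds \<in> Bl"
  shows "tree_path ts ds"
proof -
  have d: "distinct ds" "distinct ts" using assms walk_distinct_arcs walk_distinct_nodes by blast+
  moreover have "hd ds \<noteq> last ds"
    using d assms(1,2) by (cases ds) (auto simp: walk_def)
  ultimately show ?thesis using assms by (auto simp: tree_path_def walk_def)
qed

text \<open>The far sets shrink to that of the last arc, which consists of the last blossom
  alone.\<close>

lemma last_in_far:
  assumes w: "walk ts ds" and l: "last ds \<in> Bl" and i: "i < length ts"
  shows "last ds \<in> far (ts ! i) (ds ! Suc i)"
proof -
  let ?m = "length ts - 1"
  have "Suc ?m = length ts" using i by auto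
  then have "last ds = ds ! Suc ?m"
    using w last_conv_nth[of ds] by (force simp: walk_def)
  moreover have "ts ! ?m \<in> N" "ds ! Suc ?m \<in> sd (ts ! ?m)" using w i by (auto simp: walk_def)
  ultimately have f: "far (ts ! ?m) (ds ! Suc ?m) = {last ds}" using far_blossom l by metis
  show ?thesis
  proof (cases "i = ?m")
    case False
    then have "i < ?m" "?m < length ts" using i by auto
    from far_decreasing[OF w this] f show ?thesis by blast
  qed (use f in simp)
qed

lemma walk_rev:
  assumes "walk ts ds" shows "walk (rev ts) (rev ds)"
proof -
  have 1: "length ds = Suc (length ts)" "set ts \<subseteq> N" using assms by (auto simp: walk_def)
  have a: "ds ! i \<in> sd (ts ! i)" "ds ! Suc i \<in> sd (ts ! i)" "ds ! i \<noteq> ds ! Suc i" if "i < length ts" for i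
    using assms that by (auto simp: walk_def)
  have b: "ts ! i \<noteq> ts ! Suc i" if "Suc i < length ts" for i using assms that by (auto simp: walk_def)
  have c: "rev ds ! i = ds ! Suc (length ts - Suc i)" "rev ds ! Suc i = ds ! (length ts - Suc i)"
    if "i < length ts" for i using that 1 by (simp_all add: rev_nth Suc_diff_Suc)
  show ?thesis unfolding walk_def
  proof (intro conjI allI impI)
    fix i assume i: "i < length (rev ts)"
    then have j: "length ts - Suc i < length ts" by auto
    show "rev ds ! i \<in> sd (rev ts ! i)" "rev ds ! Suc i \<in> sd (rev ts ! i)" "rev ds ! i \<noteq> rev ds ! Suc i"
      using a[OF j] c[of i] i by (auto simp: rev_nth)
  next
    fix i assume i: "Suc i < length (rev ts)"
    then have "ts ! (length ts - Suc (Suc i)) \<noteq> ts ! Suc (length ts - Suc (Suc i))"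
      by (intro b) auto
    then show "rev ts ! i \<noteq> rev ts ! Suc i" using i by (simp add: rev_nth Suc_diff_Suc)
  qed (use 1 in auto)
qed

lemma first_in_far:
  assumes w: "walk ts ds" and l: "hd ds \<in> Bl" and i: "i < length ts"
  shows "hd ds \<in> far (ts ! i) (ds ! i)"
proof -
  have "last (rev ds) \<in> far (rev ts ! (length ts - Suc i)) (rev ds ! Suc (length ts - Suc i))"
    by (rule last_in_far[OF walk_rev[OF w]]) (use l i w in \<open>auto simp: walk_def last_rev\<close>)
  moreover have "length ds = Suc (length ts)" using w by (auto simp: walk_def)
  ultimately show ?thesis using i by (simp add: rev_nth last_rev Suc_diff_Suc)
qed

text \<open>The first blossom has only one node; at each node the last blossom selects the next arc,
  as the far sets there are disjoint; and an arc has at most one further node.\<close>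

lemma path_unique:
  assumes p: "tree_path ts ds" and p': "tree_path ts' ds'" and e: "hd ds = hd ds'" "last ds = last ds'"
  shows "ds = ds'"
proof -
  note w = path_imp_walk[OF p] and w' = path_imp_walk[OF p']
  have len: "length ds = Suc (length ts)" "length ds' = Suc (length ts')" using w w' by (auto simp: walk_def)
  have B: "hd ds \<in> Bl" "last ds \<in> Bl" using p by (auto simp: tree_path_def)
  have h: "hd ds = ds ! 0" "hd ds' = ds' ! 0" 
    using len by (cases ds; cases ds'; simp)+
  have N: "ts ! i \<in> N" "ds ! i \<in> sd (ts ! i)" "ds ! Suc i \<in> sd (ts ! i)" "ds ! i \<noteq> ds ! Suc i"
    "last ds \<in> far (ts ! i) (ds ! Suc i)" if "i < length ts" for i
    using w that last_in_far[OF w] B by (auto simp: walk_def)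
  have N': "ts' ! i \<in> N" "ds' ! i \<in> sd (ts' ! i)" "ds' ! Suc i \<in> sd (ts' ! i)" "ds' ! i \<noteq> ds' ! Suc i"
    "last ds \<in> far (ts' ! i) (ds' ! Suc i)" if "i < length ts'" for i
    using w' that last_in_far[OF w'] B e by (auto simp: walk_def)
  have eq: "ts ! i = ts' ! i \<and> ds ! i = ds' ! i \<and> ds ! Suc i = ds' ! Suc i"
    if "i < length ts" "i < length ts'" for i
    using that
  proof (induction i)
    case 0
    have t: "ts ! 0 = ts' ! 0"
      using blossom_one_node[of "ts ! 0" "ts' ! 0" "ds ! 0"] 0 N(1,2)[of 0] N'(1,2)[of 0] B h e by auto
    have "ds ! Suc 0 = ds' ! Suc 0"
      using far_disjoint[of "ts ! 0" "ds ! Suc 0" "ds' ! Suc 0"] 0 N[of 0] N'[of 0] t by auto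
    then show ?case using t h e by simp
  next
    case (Suc i)
    then have IH: "ts ! i = ts' ! i" "ds ! Suc i = ds' ! Suc i" by auto
    have "ts ! i \<noteq> ts ! Suc i" "ts' ! i \<noteq> ts' ! Suc i" using w w' Suc.prems by (auto simp: walk_def)
    then have t: "ts ! Suc i = ts' ! Suc i"
      using two_nodes[of "ts ! i" "ts ! Suc i" "ts' ! Suc i" "ds ! Suc i"] Suc.prems IH
        N(1-3)[of i] N(1,2)[of "Suc i"] N'(1,2)[of "Suc i"] by auto
    have "ds ! Suc (Suc i) = ds' ! Suc (Suc i)"
      using far_disjoint[of "ts ! Suc i" "ds ! Suc (Suc i)" "ds' ! Suc (Suc i)"] Suc.prems
        N[of "Suc i"] N'[of "Suc i"] t by auto
    then show ?case using t IH by simp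
  qed
  have ne: "ts \<noteq> []" "ts' \<noteq> []" using p p' len by (auto simp: tree_path_def length_Suc_conv)
  have eqd: "ds ! i = ds' ! i" if "i \<le> length ts" "i \<le> length ts'" for i
    using that eq[of "i - 1"] h e ne by (cases i) auto
  have ld: "last ds = ds ! length ts" "last ds' = ds' ! length ts'" 
    using len last_conv_nth[of ds] last_conv_nth[of ds'] by (cases ds; cases ds'; simp)+
  \<comment> \<open>Otherwise the longer list reaches the common last blossom early and meets it
    again at its end.\<close>
  have "length ts = length ts'"
  proof (rule ccontr)
    assume a: "length ts \<noteq> length ts'"
    have dd: "distinct ds" "distinct ds'" using p p' by (auto simp: tree_path_def)
    show False
    proof (cases "length ts < length ts'")
      case True
      then have "ds' ! length ts = ds' ! length ts'" using eqd[of "length ts"] ld e by auto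
      then show False using dd(2) True len by (auto simp: nth_eq_iff_index_eq)
    next
      case False
      then have "ds ! length ts' = ds ! length ts" using eqd[of "length ts'"] ld e a by auto
      then show False using dd(1) False len a by (auto simp: nth_eq_iff_index_eq)
    qed
  qed
  then show ?thesis using eqd len by (intro nth_equalityI) auto
qed

section \<open>Existence of a path through two arcs at a node\<close>

lemma walk_Cons:
  assumes "walk (t # ts) (d # ds)" "t' \<in> N" "t' \<noteq> t" "d \<in> sd t'" "d' \<in> sd t'" "d' \<noteq> d"
  shows "walk (t' # t # ts) (d' # d # ds)"
  using assms by (auto simp: walk_def nth_Cons split: nat.splits)

text \<open>At the other node of the first arc, the arc beyond which \<open>e\<close> lies is
  prepended, and the far set shrinks until a blossom is reached. The data kept about the last node
  and the last arc permit a second use at the other end.\<close>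

lemma walk_extend:
  assumes "walk (t # ts) (d # ds)" "e \<in> far t d"
  shows "\<exists>ts' ds'. walk ts' (e # ds') \<and> ts' \<noteq> [] \<and> last ts' = last (t # ts) \<and> e \<in> Bl \<and>
           set (d # ds) \<subseteq> set (e # ds') \<and> last (e # ds') = last (d # ds)"
  using assms
proof (induction "card (far t d)" arbitrary: t d ts ds rule: less_induct)
  case less
  have t: "t \<in> N" "d \<in> sd t" using less.prems(1) by (auto simp: walk_def)
  show ?case
  proof (cases "d \<in> Bl")
    case True
    then have "e = d" using far_blossom t less.prems by auto
    then show ?thesis using less.prems True by blast
  next
    case False
    then obtain t' where t': "t' \<in> N" "t' \<noteq> t" "d \<in> sd t'" using other_node t by metis
    have o: "far t' d = Bl - far t d" using far_opposite t t' by metis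
    have "e \<in> Bl" using far_subset t less.prems by blast
    then obtain d' where d': "d' \<in> sd t'" "e \<in> far t' d'" using far_cover[OF t'(1)] by blast
    have ne: "d' \<noteq> d" using d' o less.prems by blast
    have w: "walk (t' # t # ts) (d' # d # ds)"
      using walk_Cons less.prems(1) t' d' ne by metis
    have "far t' d' \<subset> far t d" using far_step[of t t' d d'] t t' d' ne by auto
    then have "card (far t' d') < card (far t d)" using psubset_card_mono finite_far t by metis
    from less.hyps[OF this w d'(2)] show ?thesis by (elim exE conjE, intro exI conjI) auto
  qed
qed

lemma path_through:
  assumes t: "t \<in> N" and d: "d1 \<in> sd t" "d2 \<in> sd t" "d1 \<noteq> d2"
    and e: "e1 \<in> far t d1" "e2 \<in> far t d2"
  shows "\<exists>ts ds. tree_path ts ds \<and> hd ds = e2 \<and> last ds = e1 \<and> {d1, d2} \<subseteq> set ds"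
proof -
  have "walk [t] [d1, d2]" using t d by (auto simp: walk_def)
  from walk_extend[OF this e(1)] obtain ts ds where
    1: "walk ts (e1 # ds)" "ts \<noteq> []" "last ts = t" "e1 \<in> Bl" "{d1, d2} \<subseteq> set (e1 # ds)"
      "last (e1 # ds) = d2" by auto
  \<comment> \<open>Reversal exposes \<open>d2\<close> at the front, so that the same lemma extends
    the other end.\<close>
  obtain ss where s: "rev ts = t # ss" using 1(2,3) by (metis hd_rev list.exhaust_sel rev_is_Nil_conv)
  obtain xs where x: "rev (e1 # ds) = d2 # xs"
    using 1(6) by (metis hd_rev list.exhaust_sel rev_is_Nil_conv list.distinct(1))
  have "walk (t # ss) (d2 # xs)" using walk_rev[OF 1(1)] s x by simp
  from walk_extend[OF this e(2)] obtain ts' ds' where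
    2: "walk ts' (e2 # ds')" "ts' \<noteq> []" "e2 \<in> Bl" "set (d2 # xs) \<subseteq> set (e2 # ds')"
      "last (e2 # ds') = last (d2 # xs)" by auto
  have "last (d2 # xs) = e1" using x by (metis last_rev list.sel(1) list.distinct(1))
  moreover have "{d1, d2} \<subseteq> set (e2 # ds')" using 1(5) 2(4) x by (metis set_rev subset_trans)
  moreover have "tree_path ts' (e2 # ds')" using walk_imp_path[OF 2(1,2)] 2 1(4) calculation by auto
  ultimately show ?thesis using 2(5) by (intro exI[of _ ts'] exI[of _ "e2 # ds'"]) auto
qed

text \<open>Compare far sets: if \<open>t\<close> is neither of the two nodes of the walk, the far
  sets of the two arcs at \<open>t\<close> cover all blossoms and leave none for a third arc; if
  \<open>t\<close> is just one of them, two disjoint far sets at \<open>t\<close> would be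
  nested.\<close>

lemma path_through_consecutive:
  assumes w: "walk ts ds" and t: "t \<in> N" and d: "ds ! i \<in> sd t" "ds ! Suc k \<in> sd t"
    and ik: "i \<le> k" "k < length ts"
  shows "k = i \<and> ts ! i = t"
proof -
  let ?s = "ts ! i" and ?s' = "ts ! k" and ?a = "ds ! i" and ?b = "ds ! Suc k"
  have N: "?s \<in> N" "?s' \<in> N" "?a \<in> sd ?s" "ds ! Suc i \<in> sd ?s" "?b \<in> sd ?s'" "?a \<noteq> ds ! Suc i"
    using w ik by (auto simp: walk_def)
  have ne: "?a \<noteq> ?b" using walk_distinct_arcs[OF w] ik w by (auto simp: walk_def nth_eq_iff_index_eq)
  have sub: "far ?s' ?b \<subseteq> far ?s (ds ! Suc i)"
    using far_decreasing[OF w, of i k] ik by (cases "i = k") auto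
  have dis: "far ?s ?a \<inter> far ?s (ds ! Suc i) = {}" using far_disjoint N by metis
  have dt: "far t ?a \<inter> far t ?b = {}" using far_disjoint t d ne by metis
  obtain d3 where d3: "d3 \<in> sd t" "d3 \<noteq> ?a" "d3 \<noteq> ?b" using third_side t by metis
  have d3': "far t d3 \<inter> far t ?a = {}" "far t d3 \<inter> far t ?b = {}" "far t d3 \<noteq> {}" "far t d3 \<subseteq> Bl"
    by (rule far_disjoint far_nonempty far_subset t d d3)+
  have nz: "far t ?a \<noteq> {}" "far t ?b \<noteq> {}" "far ?s' ?b \<noteq> {}" "far ?s' ?b \<subseteq> Bl" "far t ?a \<subseteq> Bl"
    by (rule far_nonempty far_subset t d N)+
  have A: "t = ?s \<or> far t ?a = Bl - far ?s ?a" using far_opposite[of ?s t ?a] N t d by auto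
  have B: "t = ?s' \<or> far t ?b = Bl - far ?s' ?b" using far_opposite[of ?s' t ?b] N t d by auto
  have 1: "X \<subseteq> W" if "X \<subseteq> Y" "Z \<inter> Y = {}" "W = Bl - Z" "X \<subseteq> Bl" for X Y Z W
    using that by blast
  have 2: "False" if "X \<subseteq> Y" "W = Bl - X" "Z \<inter> Y = {}" "Z \<inter> W = {}" "Z \<noteq> {}" "Z \<subseteq> Bl" for X Y Z W
    using that by blast
  have 3: "X \<subseteq> Z" if "X \<inter> Y = {}" "Y = Bl - Z" "X \<subseteq> Bl" for X Y Z
    using that by blast
  have "t = ?s"
  proof (rule ccontr)
    assume "t \<noteq> ?s"
    then have "far t ?a = Bl - far ?s ?a" using A by simp
    then have a: "far ?s' ?b \<subseteq> far t ?a" using 1[OF sub dis _ nz(4)] by simp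
    show False
    proof (cases "t = ?s'")
      case True
      then show False using a dt nz(2) by simp blast
    next
      case False
      then have "far t ?b = Bl - far ?s' ?b" using B by simp
      then show False using 2[OF a _ d3'] by simp
    qed
  qed
  moreover have "t = ?s'"
  proof (rule ccontr)
    assume "t \<noteq> ?s'"
    then have "far t ?b = Bl - far ?s' ?b" using B by auto
    then have "far ?s ?a \<subseteq> far ?s' ?b" using 3[OF dt _ nz(5)] \<open>t = ?s\<close> by simp
    then have "far ?s ?a \<subseteq> far ?s (ds ! Suc i)" using sub by (rule subset_trans)
    then show False using dis nz(1) \<open>t = ?s\<close> by (simp add: Int_absorb2)
  qed
  ultimately have "?s = ?s'" by simp
  then have "i = k" using walk_distinct_nodes[OF w] ik by (simp add: nth_eq_iff_index_eq)
  then show ?thesis using \<open>t = ?s\<close> by simp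
qed

section \<open>Ends of a path and the number of paths\<close>

lemma ends_of_path_through:
  assumes p: "tree_path ts ds" and t: "t \<in> N" and d: "d1 \<in> sd t" "d2 \<in> sd t" "d1 \<noteq> d2" "{d1, d2} \<subseteq> set ds"
  shows "hd ds \<in> far t d1 \<and> last ds \<in> far t d2 \<or> hd ds \<in> far t d2 \<and> last ds \<in> far t d1"
proof -
  note w = path_imp_walk[OF p]
  have B: "hd ds \<in> Bl" "last ds \<in> Bl" "length ds = Suc (length ts)" using p by (auto simp: tree_path_def)
  have *: "hd ds \<in> far t (ds ! i) \<and> last ds \<in> far t (ds ! k)"
    if h: "i < k" "k \<le> length ts" "ds ! i \<in> sd t" "ds ! k \<in> sd t" for i k
  proof -
    obtain k' where k': "k = Suc k'" using h(1) by (cases k) auto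
    have "k' = i" "ts ! i = t" using path_through_consecutive[OF w t, of i k'] h k' by auto
    then show ?thesis using first_in_far[OF w B(1), of i] last_in_far[OF w B(2), of i] h k' by auto
  qed
  obtain i k where "d1 = ds ! i" "d2 = ds ! k" "i \<le> length ts" "k \<le> length ts" "i \<noteq> k"
    using d(3,4) B(3) by (metis insert_subset in_set_conv_nth less_Suc_eq_le)
  then show ?thesis using *[of i k] *[of k i] d(1,2) by (cases "i < k") auto
qed

text \<open>An inner arc lies on two different nodes, a blossom on one. Hence the arc set of a path
  determines the unordered pair of its ends, which gives injectivity in the count below.\<close>

lemma blossoms_of_path:
  assumes p: "tree_path ts ds"
  shows "set ds \<inter> Bl = {hd ds, last ds}"
proof -
  note w = path_imp_walk[OF p]
  have B: "hd ds \<in> Bl" "last ds \<in> Bl" "length ds = Suc (length ts)" using p by (auto simp: tree_path_def)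
  have ne: "ds \<noteq> []" using B(3) by auto
  have "ds ! i = hd ds \<or> ds ! i = last ds" if i: "i \<le> length ts" and b: "ds ! i \<in> Bl" for i
  proof (rule ccontr)
    assume n: "\<not> (ds ! i = hd ds \<or> ds ! i = last ds)"
    have "i \<noteq> 0" using n ne by (metis hd_conv_nth)
    moreover have "i \<noteq> length ts" using n ne B(3) by (metis last_conv_nth diff_Suc_1)
    ultimately obtain j where j: "i = Suc j" "Suc j < length ts" using i by (cases i) auto
    have "ts ! j = ts ! Suc j"
      by (rule blossom_one_node[of _ _ "ds ! i"]) (use w j b in \<open>auto simp: walk_def\<close>)
    then show False using w j by (auto simp: walk_def)
  qed
  then have "x = hd ds \<or> x = last ds" if "x \<in> set ds" "x \<in> Bl" for x
    using that B(3) by (metis in_set_conv_nth less_Suc_eq_le)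
  moreover have "hd ds \<in> set ds" "last ds \<in> set ds" using ne by auto
  ultimately show ?thesis using B(1,2) by blast
qed

text \<open>A path through both arcs has one end beyond each of them and is determined by its ends;
  since the two far sets are disjoint, an arc set belongs to only one pair of ends.\<close>

lemma card_paths_through:
  assumes t: "t \<in> N" and d: "d1 \<in> sd t" "d2 \<in> sd t" "d1 \<noteq> d2"
  shows "card {set ds | ts ds. tree_path ts ds \<and> {d1, d2} \<subseteq> set ds} = card (far t d1) * card (far t d2)"
proof -
  let ?S = "{set ds | ts ds. tree_path ts ds \<and> {d1, d2} \<subseteq> set ds}"
  define Pg where "Pg e1 e2 ds \<longleftrightarrow> (\<exists>ts. tree_path ts ds) \<and> hd ds = e2 \<and> last ds = e1 \<and> {d1, d2} \<subseteq> set ds" for e1 e2 ds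
  define g where "g e1 e2 = (SOME ds. Pg e1 e2 ds)" for e1 e2
  have "Pg e1 e2 (g e1 e2)" if "e1 \<in> far t d1" "e2 \<in> far t d2" for e1 e2
  proof -
    have "\<exists>ds. Pg e1 e2 ds" unfolding Pg_def using path_through[OF t d that] by blast
    then show ?thesis unfolding g_def by (rule someI_ex)
  qed
  then have g: "\<exists>ts. tree_path ts (g e1 e2)" "hd (g e1 e2) = e2" "last (g e1 e2) = e1" "{d1, d2} \<subseteq> set (g e1 e2)"
    if "e1 \<in> far t d1" "e2 \<in> far t d2" for e1 e2
    using that unfolding Pg_def by blast+
  have gB: "set (g e1 e2) \<inter> Bl = {e2, e1}" if e: "e1 \<in> far t d1" "e2 \<in> far t d2" for e1 e2
  proof -
    obtain ts where "tree_path ts (g e1 e2)" using g(1)[OF e] by blast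
    from blossoms_of_path[OF this] g(2,3)[OF e] show ?thesis by simp
  qed
  have dis: "far t d1 \<inter> far t d2 = {}" using far_disjoint t d by metis
  have "bij_betw (\<lambda>(e1, e2). set (g e1 e2)) (far t d1 \<times> far t d2) ?S"
    unfolding bij_betw_def
  proof
    show "inj_on (\<lambda>(e1, e2). set (g e1 e2)) (far t d1 \<times> far t d2)"
    proof (rule inj_onI, clarsimp)
      fix a b a' b'
      assume h: "a \<in> far t d1" "b \<in> far t d2" "a' \<in> far t d1" "b' \<in> far t d2" "set (g a b) = set (g a' b')"
      then have "{b, a} = {b', a'}" using gB[OF h(1,2)] gB[OF h(3,4)] by simp
      then show "a = a' \<and> b = b'" using h dis by (auto simp: doubleton_eq_iff)
    qed
    show "(\<lambda>(e1, e2). set (g e1 e2)) ` (far t d1 \<times> far t d2) = ?S"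
    proof (intro equalityI subsetI)
      fix x assume "x \<in> (\<lambda>(e1, e2). set (g e1 e2)) ` (far t d1 \<times> far t d2)"
      then obtain e1 e2 where e: "e1 \<in> far t d1" "e2 \<in> far t d2" "x = set (g e1 e2)" by auto
      obtain ts where "tree_path ts (g e1 e2)" using g(1)[OF e(1,2)] by blast
      then show "x \<in> ?S" using g(4)[OF e(1,2)] e(3) by (intro CollectI exI conjI)
    next
      fix x assume "x \<in> ?S"
      then obtain ts ds where p: "tree_path ts ds" "{d1, d2} \<subseteq> set ds" "x = set ds" by blast
      have "ts \<noteq> []" "hd (rev ds) \<in> Bl" "last (rev ds) \<in> Bl"
        using p(1) by (auto simp: tree_path_def hd_rev last_rev length_Suc_conv)
      \<comment> \<open>The given path may start beyond \<open>d1\<close>; its reversal then has the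
        direction of \<open>g\<close>.\<close>
      then have p': "tree_path (rev ts) (rev ds)"
        using walk_imp_path[OF walk_rev[OF path_imp_walk[OF p(1)]]] by simp
      consider "last ds \<in> far t d1" "hd ds \<in> far t d2" | "hd ds \<in> far t d1" "last ds \<in> far t d2"
        using ends_of_path_through[OF p(1) t d p(2)] by auto
      then show "x \<in> (\<lambda>(e1, e2). set (g e1 e2)) ` (far t d1 \<times> far t d2)"
      proof cases
        case 1
        obtain ts' where "tree_path ts' (g (last ds) (hd ds))" using g(1)[OF 1] by blast
        then have "ds = g (last ds) (hd ds)" by (rule path_unique[OF p(1)]) (simp_all add: g(2,3)[OF 1])
        then have "x = set (g (last ds) (hd ds))" unfolding p(3) by (rule arg_cong)
        then show ?thesis using 1 by (intro image_eqI[of _ _ "(last ds, hd ds)"]) auto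
      next
        case 2
        obtain ts' where "tree_path ts' (g (hd ds) (last ds))" using g(1)[OF 2] by blast
        then have "rev ds = g (hd ds) (last ds)"
          by (rule path_unique[OF p']) (simp_all add: g(2,3)[OF 2] hd_rev last_rev)
        then have "set (rev ds) = set (g (hd ds) (last ds))" by (rule arg_cong)
        then have "x = set (g (hd ds) (last ds))" unfolding p(3) by simp
        then show ?thesis using 2 by (intro image_eqI[of _ _ "(hd ds, last ds)"]) auto
      qed
    qed
  qed
  from bij_betw_same_card[OF this] show ?thesis by (simp only: card_cartesian_product)
qed

end

section \<open>Labels and their cyclic order\<close>

definition cyclic :: "nat \<Rightarrow> nat \<Rightarrow> nat \<Rightarrow> bool" where
  "cyclic x y z \<longleftrightarrow> x < y \<and> y < z \<or> y < z \<and> z < x \<or> z < x \<and> x < y"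

text \<open>The right-hand side of the constraint for \<open>J\<close>.\<close>

definition wt :: "nat set \<Rightarrow> real" where
  "wt J = real ((card J + 1) choose 2)"

lemma wt_eq: "wt J = real (card J) * (real (card J) + 1) / 2"
proof -
  have "2 dvd (card J + 1) * card J" by simp
  then show ?thesis unfolding wt_def choose_two by (simp add: real_of_nat_div algebra_simps)
qed

text \<open>The difference of the two sides is exactly \<open>a * b\<close>, and \<open>x\<close>,
  \<open>y\<close> witness that both factors are positive.\<close>

lemma wt_supermodular:
  assumes "finite A" "finite B" "x \<in> A - B" "y \<in> B - A"
  shows "wt A + wt B < wt (A \<union> B) + wt (A \<inter> B)"
proof -
  define a b c where "a = card (A - B)" and "b = card (B - A)" and "c = card (A \<inter> B)"
  have A: "card A = a + c" unfolding a_def c_def using assms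
    by (metis card_Int_Diff add.commute)
  have B: "card B = b + c" unfolding b_def c_def using assms
    by (metis card_Int_Diff add.commute Int_commute)
  have "card (A \<union> B) + card (A \<inter> B) = card A + card B" using assms card_Un_Int by metis
  then have AB: "card (A \<union> B) = a + b + c" using A B c_def by simp
  have "a > 0" "b > 0" unfolding a_def b_def using assms by (auto simp: card_gt_0_iff)
  then have "real a * real b > 0" by simp
  then show ?thesis unfolding wt_eq A B AB c_def[symmetric] by (simp add: field_simps)
qed

text \<open>Vertices are represented by their labels \<open>0, \<dots>, M\<close> with \<open>M = n + 2\<close>, and \<open>U\<close> is the set of up labels.
  Counterclockwise from the leftmost vertex, the down label \<open>i\<close> is put at position \<open>i\<close> and the up
  label \<open>i\<close> at position \<open>2 M - i\<close>; \<open>key a x\<close> is the position of \<open>x\<close> counted from \<open>a\<close>. For \<open>i < k\<close>, a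
  vertex \<open>j\<close> lies strictly below the diagonal \<open>i k\<close> iff \<open>ccw i j k\<close>, and \<open>BB i k\<close> is \<open>B(i k)\<close>; \<open>BS\<close> takes
  the endpoints in any order.\<close>

locale labels =
  fixes M :: nat and U :: "nat set"
  assumes M2: "2 \<le> M" and U_sub: "U \<subseteq> {1..<M}"
begin

definition pos :: "nat \<Rightarrow> nat" where
  "pos i = (if i \<in> U then 2 * M - i else i)"

definition ccw :: "nat \<Rightarrow> nat \<Rightarrow> nat \<Rightarrow> bool" where
  "ccw a b c \<longleftrightarrow> cyclic (pos a) (pos b) (pos c)"

definition crosses :: "nat \<Rightarrow> nat \<Rightarrow> nat \<Rightarrow> nat \<Rightarrow> bool" where
  "crosses a b c d \<longleftrightarrow> ccw a c b \<and> ccw b d a \<or> ccw a d b \<and> ccw b c a"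

definition key :: "nat \<Rightarrow> nat \<Rightarrow> nat" where
  "key a x = (if pos a \<le> pos x then pos x - pos a else pos x + 2 * M - pos a)"

definition BB :: "nat \<Rightarrow> nat \<Rightarrow> nat set" where
  "BB i k = {j \<in> {1..<M}. j \<le> i \<and> i \<in> U \<or> i < j \<and> j < k \<and> j \<notin> U \<or> k \<le> j \<and> k \<in> U}"

definition BS :: "nat \<Rightarrow> nat \<Rightarrow> nat set" where
  "BS a b = BB (min a b) (max a b)"

section \<open>Positions, keys and the cyclic order\<close>

lemma UM: "i \<in> U \<Longrightarrow> 0 < i \<and> i < M"
  using U_sub by auto

lemma pos_lt: "i \<le> M \<Longrightarrow> pos i < 2 * M"
  using M2 UM[of i] by (auto simp: pos_def)

lemma pos_inj: "\<lbrakk>i \<le> M; k \<le> M; pos i = pos k\<rbrakk> \<Longrightarrow> i = k"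
  using UM[of i] UM[of k] by (auto simp: pos_def split: if_splits)

lemma pos_cmp: "\<lbrakk>i \<le> M; k \<le> M; i < k\<rbrakk> \<Longrightarrow> pos i < pos k \<longleftrightarrow> i \<notin> U"
  using UM[of i] UM[of k] by (auto simp: pos_def split: if_splits)

lemma key_lt: "a \<le> M \<Longrightarrow> x \<le> M \<Longrightarrow> key a x < 2 * M"
  using pos_lt[of a] pos_lt[of x] by (auto simp: key_def)

lemma key_self: "key a a = 0"
  by (simp add: key_def)

lemma key_inj: "\<lbrakk>a \<le> M; x \<le> M; y \<le> M; key a x = key a y\<rbrakk> \<Longrightarrow> x = y"
  using pos_inj[of x y] pos_lt[of a] pos_lt[of x] pos_lt[of y] by (auto simp: key_def split: if_splits)

lemma key_eq: "\<lbrakk>a \<le> M; x \<le> M; y \<le> M\<rbrakk> \<Longrightarrow> key a x = key a y \<longleftrightarrow> x = y"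
  using key_inj by blast

lemma key_0: "\<lbrakk>a \<le> M; x \<le> M\<rbrakk> \<Longrightarrow> key a x = 0 \<longleftrightarrow> x = a"
  using key_inj[of a x a] key_self by auto

text \<open>Cyclic order is invariant under rotation, so all positions may be counted from a common
  start \<open>a\<close>; statements about chords then become linear inequalities between
  keys.\<close>

lemma ccw_key:
  assumes "a \<le> M" "x \<le> M" "y \<le> M" "z \<le> M"
  shows "ccw x y z \<longleftrightarrow> cyclic (key a x) (key a y) (key a z)"
proof -
  have "p < m \<Longrightarrow> u < m \<Longrightarrow> v < m \<Longrightarrow> w < m \<Longrightarrow>
     cyclic u v w = cyclic (if p \<le> u then u - p else u + m - p) (if p \<le> v then v - p else v + m - p)
        (if p \<le> w then w - p else w + m - p)" for p u v w m :: nat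
    unfolding cyclic_def by (cases "p \<le> u"; cases "p \<le> v"; cases "p \<le> w"; simp; arith)
  from this[OF pos_lt pos_lt pos_lt pos_lt] show ?thesis unfolding ccw_def key_def using assms by blast
qed

lemma ccw_key': "\<lbrakk>a \<le> M; x \<le> M; y \<le> M\<rbrakk> \<Longrightarrow> ccw a x y \<longleftrightarrow> 0 < key a x \<and> key a x < key a y"
  using ccw_key[of a a x y] by (auto simp: cyclic_def key_self)

lemma ccw_rot: "ccw a b c \<longleftrightarrow> ccw b c a"
  unfolding ccw_def cyclic_def by auto

lemma ccw_distinct: "ccw a b c \<Longrightarrow> a \<noteq> b \<and> b \<noteq> c \<and> a \<noteq> c"
  unfolding ccw_def cyclic_def by auto

lemma ccw_asym: "ccw a b c \<Longrightarrow> \<not> ccw a c b"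
  unfolding ccw_def cyclic_def by auto

lemma ccw_total: "\<lbrakk>a \<le> M; b \<le> M; c \<le> M; a \<noteq> b; b \<noteq> c; a \<noteq> c\<rbrakk> \<Longrightarrow> ccw a b c \<or> ccw a c b"
  using pos_inj[of a b] pos_inj[of b c] pos_inj[of a c] unfolding ccw_def cyclic_def
  by (metis linorder_neqE_nat)

text \<open>Only the middle label decides: a down vertex lies below the chord from any vertex on its
  left to any vertex on its right.\<close>

lemma ccw_sorted:
  assumes "i < j" "j < k" "k \<le> M"
  shows "ccw i j k \<longleftrightarrow> j \<notin> U" "ccw i k j \<longleftrightarrow> j \<in> U"
proof -
  have "pos i < pos j \<longleftrightarrow> i \<notin> U" "pos j < pos k \<longleftrightarrow> j \<notin> U" "pos i < pos k \<longleftrightarrow> i \<notin> U"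
    using pos_cmp assms by auto
  moreover have "pos k < pos i \<longleftrightarrow> i \<in> U" "pos j < pos i \<longleftrightarrow> i \<in> U" "pos k < pos j \<longleftrightarrow> j \<in> U"
    using calculation pos_inj[of i j] pos_inj[of j k] pos_inj[of i k] assms
    by (metis less_imp_le order.strict_trans less_irrefl linorder_neqE_nat order_trans less_asym)+
  ultimately show "ccw i j k \<longleftrightarrow> j \<notin> U" "ccw i k j \<longleftrightarrow> j \<in> U"
    unfolding ccw_def cyclic_def by blast+
qed

lemma crosses_sym: "crosses a b c d \<longleftrightarrow> crosses c d a b"
proof -
  have "crosses a b c d \<Longrightarrow> crosses c d a b" for a b c d
    unfolding crosses_def ccw_def cyclic_def by (elim disjE conjE) auto
  then show ?thesis by blast
qed

lemma crosses_swap: "crosses a b c d \<longleftrightarrow> crosses b a c d" "crosses a b c d \<longleftrightarrow> crosses a b d c"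
  unfolding crosses_def by auto

section \<open>The sets B, the triangle relation and uncrossing\<close>

lemma BS_sym: "BS a b = BS b a"
  by (simp add: BS_def min.commute max.commute)

lemma BS_sorted: "a < b \<Longrightarrow> BS a b = BB a b"
  by (simp add: BS_def)

lemma BB_sub: "BB i k \<subseteq> {1..<M}"
  by (auto simp: BB_def)

lemma finite_BB [simp]: "finite (BB i k)" "finite (BS i k)"
  by (auto simp: BB_def BS_def)

text \<open>The triangle relation is stated for arbitrary weights: applied to coordinates it
  recovers \<open>y j\<close> from three sums, applied to the constant 1 it relates the sizes of the
  three sets.\<close>

lemma sum_BB_down:
  assumes "i < j" "j < k" "k \<le> M" "j \<notin> U"
  shows "sum y (BB i k) = sum y (BB i j) + sum y (BB j k) + (y j :: real)"
proof -
  have "BB i k = insert j (BB i j \<union> BB j k)" "j \<notin> BB i j \<union> BB j k" "BB i j \<inter> BB j k = {}"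
    using assms UM[of i] UM[of k] by (auto simp: BB_def)
  then show ?thesis by (simp add: sum.union_disjoint)
qed

text \<open>Here the sets of the two sides at \<open>j\<close> together cover all labels and overlap
  in that of the third side and \<open>j\<close>. This is how the total, fixed by \<open>H\<close>,
  enters the relation.\<close>

lemma sum_BB_up:
  assumes "i < j" "j < k" "k \<le> M" "j \<in> U"
  shows "sum y (BB i j) + sum y (BB j k) = sum y (BB i k) + sum y {1..<M} + (y j :: real)"
proof -
  have e: "BB i j \<union> BB j k = {1..<M}" "BB i j \<inter> BB j k = insert j (BB i k)" "j \<notin> BB i k"
    using assms UM[of i] UM[of k] UM[of j] by (auto simp: BB_def)
  have "sum y (BB i j) + sum y (BB j k) = sum y (BB i j \<union> BB j k) + sum y (BB i j \<inter> BB j k)"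
    by (simp add: sum.union_inter)
  then show ?thesis using e by simp
qed

lemma card_BB_down:
  assumes "i < j" "j < k" "k \<le> M" "j \<notin> U"
  shows "card (BB i k) = card (BB i j) + card (BB j k) + 1"
  using sum_BB_down[OF assms, of "\<lambda>_. 1"] by (simp flip: of_nat_eq_iff[where 'a=real])

lemma card_BB_up:
  assumes "i < j" "j < k" "k \<le> M" "j \<in> U"
  shows "card (BB i j) + card (BB j k) = card (BB i k) + M"
proof -
  have "real (card (BB i j)) + real (card (BB j k)) = real (card (BB i k)) + real (M - 1) + 1"
    using sum_BB_up[OF assms, of "\<lambda>_. 1"] by simp
  then show ?thesis using M2 by (simp flip: of_nat_eq_iff[where 'a=real])
qed

text \<open>If the two inner labels are on the same hull, the crossing pair is \<open>p r\<close>,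
  \<open>q s\<close>; otherwise it is \<open>p s\<close>, \<open>q r\<close>. The element
  memberships are the witnesses that \<open>wt_supermodular\<close> asks for.\<close>

lemma BB_uncross:
  assumes "p < q" "q < r" "r < s" "s \<le> M"
  shows "q \<notin> U \<Longrightarrow> r \<notin> U \<Longrightarrow> BB q r = BB p r \<inter> BB q s \<and> BB p s = BB p r \<union> BB q s \<and> q \<in> BB p r - BB q s \<and> r \<in> BB q s - BB p r"
    and "q \<in> U \<Longrightarrow> r \<in> U \<Longrightarrow> BB p s = BB p r \<inter> BB q s \<and> BB q r = BB p r \<union> BB q s \<and> r \<in> BB p r - BB q s \<and> q \<in> BB q s - BB p r"
    and "q \<notin> U \<Longrightarrow> r \<in> U \<Longrightarrow> BB q s = BB p s \<inter> BB q r \<and> BB p r = BB p s \<union> BB q r \<and> q \<in> BB p s - BB q r \<and> r \<in> BB q r - BB p s"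
    and "q \<in> U \<Longrightarrow> r \<notin> U \<Longrightarrow> BB p r = BB p s \<inter> BB q r \<and> BB q s = BB p s \<union> BB q r \<and> r \<in> BB p s - BB q r \<and> q \<in> BB q r - BB p s"
  using assms UM[of p] UM[of s] by (auto simp: BB_def)

text \<open>After sorting each pair, and the two pairs by their left ends, the diagonals have
  disjoint, overlapping or nested ranges of labels. Disjoint ranges never cross, and the other two
  positions are the cases of \<open>BB_uncross\<close>.\<close>

lemma BS_uncross:
  assumes b: "a \<le> M" "b \<le> M" "c \<le> M" "d \<le> M" and x: "crosses a b c d"
  shows "\<exists>u u' w w'. {u, u'} = {a, b} \<and> {w, w'} = {c, d} \<and>
           BS u w = BS a b \<inter> BS c d \<and> BS u' w' = BS a b \<union> BS c d \<and>
           BS a b - BS c d \<noteq> {} \<and> BS c d - BS a b \<noteq> {}"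
proof -
  \<comment> \<open>Named so that the reductions by symmetry apply to the conclusion as a
    whole.\<close>
  define Q where "Q a b c d \<longleftrightarrow> (\<exists>u u' w w'. {u, u'} = {a, b} \<and> {w, w'} = {c, d} \<and>
           BS u w = BS a b \<inter> BS c d \<and> BS u' w' = BS a b \<union> BS c d \<and>
           BS a b - BS c d \<noteq> {} \<and> BS c d - BS a b \<noteq> {})" for a b c d
  have Q: "Q a b c d" if "{u, u'} = {a, b}" "{w, w'} = {c, d}" "BS u w = BS a b \<inter> BS c d"
      "BS u' w' = BS a b \<union> BS c d" "BS a b - BS c d \<noteq> {}" "BS c d - BS a b \<noteq> {}" for a b c d u u' w w'
    unfolding Q_def by (intro exI conjI) (fact that)+
  have core: "Q a b c d" if h: "a < b" "c < d" "a < c" "crosses a b c d" "b \<le> M" "d \<le> M" for a b c d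
  proof -
    have neq: "b \<noteq> c" "b \<noteq> d" using h(4) ccw_distinct unfolding crosses_def by blast+
    consider "b < c" | "c < b" "b < d" | "d < b" using neq by linarith
    then show ?thesis
    proof cases
      case 1
      then show ?thesis
        using h ccw_sorted[of a b c] ccw_sorted[of a b d] ccw_rot unfolding crosses_def by auto
    next
      case 2
      have "c \<notin> U \<and> b \<notin> U \<or> c \<in> U \<and> b \<in> U"
        using h 2 ccw_sorted[of a c b] ccw_sorted[of a b d] ccw_rot unfolding crosses_def by auto
      then show ?thesis
      proof
        assume u: "c \<notin> U \<and> b \<notin> U"
        show ?thesis
          by (rule Q[where u = b and u' = a and w = c and w' = d]) (use BB_uncross(1)[of a c b d] h 2 u in \<open>auto simp: BS_def min_def max_def insert_commute\<close>)
      next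
        assume u: "c \<in> U \<and> b \<in> U"
        show ?thesis
          by (rule Q[where u = a and u' = b and w = d and w' = c]) (use BB_uncross(2)[of a c b d] h 2 u in \<open>auto simp: BS_def min_def max_def insert_commute\<close>)
      qed
    next
      case 3
      have "c \<notin> U \<and> d \<in> U \<or> c \<in> U \<and> d \<notin> U"
        using h 3 ccw_sorted[of a c b] ccw_sorted[of a d b] ccw_rot unfolding crosses_def by auto
      then show ?thesis
      proof
        assume u: "c \<notin> U \<and> d \<in> U"
        show ?thesis
          by (rule Q[where u = b and u' = a and w = c and w' = d]) (use BB_uncross(3)[of a c d b] h 3 u in \<open>auto simp: BS_def min_def max_def insert_commute\<close>)
      next
        assume u: "c \<in> U \<and> d \<notin> U"
        show ?thesis
          by (rule Q[where u = a and u' = b and w = d and w' = c]) (use BB_uncross(4)[of a c d b] h 3 u in \<open>auto simp: BS_def min_def max_def insert_commute\<close>)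
      qed
    qed
  qed
  have sym: "Q a b c d" if q: "Q c d a b" for a b c d
  proof -
    obtain u u' w w' where o: "{u, u'} = {c, d}" "{w, w'} = {a, b}" "BS u w = BS c d \<inter> BS a b"
      "BS u' w' = BS c d \<union> BS a b" "BS c d - BS a b \<noteq> {}" "BS a b - BS c d \<noteq> {}"
      using q unfolding Q_def by (elim exE conjE)
    show ?thesis
      by (rule Q[OF o(2,1)]) (use o BS_sym[of w u] BS_sym[of w' u'] in \<open>simp_all add: Int_commute Un_commute\<close>)
  qed
  have core2: "Q a b c d" if h: "a < b" "c < d" "crosses a b c d" "b \<le> M" "d \<le> M" for a b c d
  proof (cases "a < c")
    case False
    have "a \<noteq> c" using h(3) ccw_distinct unfolding crosses_def by blast
    then have "Q c d a b" using h crosses_sym False by (intro core) auto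
    then show ?thesis by (rule sym)
  qed (use core h in blast)
  have ne: "a \<noteq> b" "c \<noteq> d"
    using x unfolding crosses_def ccw_def cyclic_def by (elim disjE conjE; force)+
  have "Q (min a b) (max a b) (min c d) (max c d)"
    using ne x b crosses_swap by (intro core2) (auto simp: min_def max_def)
  moreover have "{min a b, max a b} = {a, b}" "{min c d, max c d} = {c, d}"
    "BS (min a b) (max a b) = BS a b" "BS (min c d) (max c d) = BS c d"
    by (auto simp: min_def max_def BS_sym)
  ultimately show ?thesis unfolding Q_def by simp
qed

text \<open>Convexity settles the vertices outside the span of the diagonal: those left of
  \<open>i\<close> are below its line iff \<open>i\<close> is up, those right of \<open>k\<close>
  iff \<open>k\<close> is up. Allowing \<open>j = i\<close> and \<open>j = k\<close> in these
  clauses of \<open>BB\<close> adds exactly the up endpoints.\<close>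

lemma BB_iff:
  assumes "i < k" "k \<le> M" "0 < j" "j < M"
  shows "j \<in> BB i k \<longleftrightarrow> ccw i j k \<or> j \<in> {i, k} \<and> j \<in> U"
proof -
  consider "j < i" | "j = i" | "i < j" "j < k" | "j = k" | "k < j" by linarith
  then show ?thesis
    using ccw_sorted[of j i k] ccw_sorted[of i j k] ccw_sorted[of i k j] assms ccw_rot[of i j k]
      ccw_distinct[of i j k] by cases (auto simp: BB_def)
qed

text \<open>The vertices \<open>0\<close> and \<open>M\<close> are extreme on the left and on the
  right, so their side of the diagonal is decided by \<open>i\<close> and by \<open>k\<close>
  respectively. They serve as test vertices below.\<close>

lemma ends_below:
  assumes "i < k" "k \<le> M"
  shows "ccw i 0 k \<longleftrightarrow> i \<in> U" "ccw i M k \<longleftrightarrow> k \<in> U" "ccw k 0 i \<longleftrightarrow> i \<notin> U \<and> i \<noteq> 0" "ccw k M i \<longleftrightarrow> k \<notin> U \<and> k \<noteq> M"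
proof -
  have "i = 0 \<or> (ccw 0 i k \<longleftrightarrow> i \<notin> U) \<and> (ccw 0 k i \<longleftrightarrow> i \<in> U)" using ccw_sorted[of 0 i k] assms by blast
  moreover have "k = M \<or> (ccw i k M \<longleftrightarrow> k \<notin> U) \<and> (ccw i M k \<longleftrightarrow> k \<in> U)" using ccw_sorted[of i k M] assms by auto
  ultimately show "ccw i 0 k \<longleftrightarrow> i \<in> U" "ccw i M k \<longleftrightarrow> k \<in> U" "ccw k 0 i \<longleftrightarrow> i \<notin> U \<and> i \<noteq> 0" "ccw k M i \<longleftrightarrow> k \<notin> U \<and> k \<noteq> M"
    using ccw_rot[of k 0 i] ccw_rot[of k M i] ccw_rot[of i 0 k] ccw_rot[of 0 k i] ccw_rot[of M i k] ccw_distinct[of i 0 k]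
      ccw_distinct[of i M k] ccw_distinct[of k 0 i] ccw_distinct[of k M i] UM[of 0] UM[of M] by auto
qed

text \<open>By the tests at \<open>0\<close> and \<open>M\<close>, an edge with nothing below has no
  up endpoint, and one with nothing above has no down endpoint. The constraint of an edge thus
  follows from the equation of \<open>H\<close>.\<close>

lemma BB_boundary:
  assumes "i < k" "k \<le> M"
  shows "(\<And>x. x \<le> M \<Longrightarrow> \<not> ccw i x k) \<Longrightarrow> BB i k = {}"
    and "(\<And>x. x \<le> M \<Longrightarrow> \<not> ccw k x i) \<Longrightarrow> BB i k = {1..<M}"
proof -
  assume h: "\<And>x. x \<le> M \<Longrightarrow> \<not> ccw i x k"
  then have "i \<notin> U" "k \<notin> U" using h[of 0] h[of M] ends_below[OF assms] by auto
  then have "j \<notin> BB i k" if "0 < j" "j < M" for j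
    using BB_iff[OF assms that] h[of j] that by auto
  then show "BB i k = {}" using BB_sub[of i k] by (intro equals0I) (auto dest: subsetD)
next
  assume h: "\<And>x. x \<le> M \<Longrightarrow> \<not> ccw k x i"
  then have e: "i \<in> U \<or> i = 0" "k \<in> U \<or> k = M" using h[of 0] h[of M] ends_below[OF assms] by auto
  have "j \<in> BB i k" if "0 < j" "j < M" for j
    using BB_iff[OF assms that] h[of j] that e ccw_total[of i j k] ccw_rot[of k j i] ccw_rot[of j i k] assms by auto
  then have "{1..<M} \<subseteq> BB i k" by auto
  then show "BB i k = {1..<M}" using BB_sub[of i k] by (rule equalityI[rotated])
qed

text \<open>The endpoint convention of B is used when the median is an end of the diagonal, say
  \<open>j = a\<close>: then \<open>i\<close> lies left of \<open>a\<close> and below the line,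
  which forces \<open>a\<close> to be up and hence to be counted.\<close>

lemma median_below:
  assumes "i < j" "j < k" "k \<le> M" "a < b" "b \<le> M"
    and "\<And>s. s \<in> {i, j, k} \<Longrightarrow> s = a \<or> s = b \<or> ccw a s b"
  shows "j \<in> BB a b"
proof -
  have "j \<in> U" if "j = a" using that assms(6)[of i] assms ccw_sorted[of i a b] ccw_rot[of a i b] ccw_rot[of i b a] by auto
  moreover have "j \<in> U" if "j = b" using that assms(6)[of k] assms ccw_sorted[of a b k] by auto
  ultimately show ?thesis using BB_iff[of a b j] assms(6)[of j] assms by auto
qed

lemma median_above:
  assumes "i < j" "j < k" "k \<le> M" "a < b" "b \<le> M"
    and "\<And>s. s \<in> {i, j, k} \<Longrightarrow> s = a \<or> s = b \<or> ccw b s a"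
  shows "j \<notin> BB a b"
proof -
  have "j \<notin> U" if "j = a" using that assms(6)[of i] assms ccw_sorted[of i a b] ccw_rot[of b i a] by auto
  moreover have "j \<notin> U" if "j = b" using that assms(6)[of k] assms ccw_sorted[of a b k] ccw_rot[of a b k] by auto
  ultimately show ?thesis
    using BB_iff[of a b j] assms(6)[of j] assms ccw_asym[of a j b] ccw_rot[of b j a] ccw_rot[of j a b] by auto
qed

section \<open>Quadrilaterals, sizes of arcs and the solution at a median\<close>

lemma crosses_key:
  assumes "a \<le> M" "b \<le> M" "c \<le> M" "d \<le> M"
  shows "crosses a b c d \<longleftrightarrow> 0 < key a c \<and> key a c < key a b \<and> key a b < key a d \<or>
                       0 < key a d \<and> key a d < key a b \<and> key a b < key a c"
  using ccw_key'[OF assms(1), of _ b] ccw_key'[OF assms(1), of b] ccw_rot[of b _ a] ccw_rot[of _ a b] assms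
  unfolding crosses_def by auto

lemma crosses_side:
  assumes b: "a \<le> M" "b \<le> M" "c \<le> M" "d \<le> M" "x \<le> M" "y \<le> M"
    and "crosses a b c d" "u \<in> {a, b}" "w \<in> {c, d}" "crosses x y u w" "\<not> crosses x y a b"
  shows "crosses x y c d"
proof -
  have core: "crosses x y c d" if h: "crosses a b c d" "crosses x y a c" "\<not> crosses x y a b" "a \<le> M" "b \<le> M" "c \<le> M" "d \<le> M" for a b c d
  proof -
    have "0 < key a c \<and> key a c < key a b \<and> key a b < key a d \<or>
          0 < key a d \<and> key a d < key a b \<and> key a b < key a c" using h crosses_key[of a b c d] by simp
    moreover have "0 < key a x \<and> key a x < key a c \<and> key a c < key a y \<or>
          0 < key a y \<and> key a y < key a c \<and> key a c < key a x" using crosses_key[of a c x y] crosses_sym[of a c x y] h b by simp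
    moreover have "\<not> (0 < key a x \<and> key a x < key a b \<and> key a b < key a y \<or>
          0 < key a y \<and> key a y < key a b \<and> key a b < key a x)" using crosses_key[of a b x y] crosses_sym[of a b x y] h b by simp
    ultimately have "cyclic (key a x) (key a c) (key a y) \<and> cyclic (key a y) (key a d) (key a x) \<or>
       cyclic (key a x) (key a d) (key a y) \<and> cyclic (key a y) (key a c) (key a x)"
      unfolding cyclic_def by (elim disjE conjE) auto
    then show ?thesis unfolding crosses_def using ccw_key[OF h(4)] h b by simp
  qed
  show ?thesis using core[of a b c d] core[of a b d c] core[of b a c d] core[of b a d c] assms crosses_swap by blast
qed

text \<open>\<open>BB a b\<close> leaves out \<open>0\<close>, which is below the diagonal iff
  \<open>a\<close> is up, and then it contains \<open>a\<close> instead; likewise for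
  \<open>M\<close> and \<open>b\<close>. By these exchanges it has as many elements as the open arc
  below; the added 1 is the first vertex of the arc.\<close>

lemma card_arc:
  assumes "a < b" "b \<le> M"
  shows "card {s. s \<le> M \<and> (s = a \<or> ccw a s b)} = card (BB a b) + 1"
    and "card {s. s \<le> M \<and> (s = b \<or> ccw b s a)} = M - card (BB a b)"
proof -
  define A where "A = {s. s \<le> M \<and> ccw a s b}"
  have fin: "finite A" unfolding A_def by (rule finite_subset[of _ "{..M}"]) auto
  have ab: "a \<notin> A" "b \<notin> A" unfolding A_def using ccw_distinct by blast+
  have z: "0 \<in> A \<longleftrightarrow> a \<in> U" "M \<in> A \<longleftrightarrow> b \<in> U" unfolding A_def using ends_below[OF assms] by auto
  have AM: "s \<le> M" if "s \<in> A" for s using that by (simp add: A_def)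
  have B: "j \<in> BB a b \<longleftrightarrow> 0 < j \<and> j < M \<and> (j \<in> A \<or> j \<in> {a, b} \<and> j \<in> U)" for j
  proof (cases "0 < j \<and> j < M")
    case True
    then show ?thesis using BB_iff[OF assms, of j] by (simp add: A_def)
  qed (use BB_sub[of a b] in auto)
  define A1 where "A1 = (if a \<in> U then insert a (A - {0}) else A)"
  define A2 where "A2 = (if b \<in> U then insert b (A1 - {M}) else A1)"
  have swap: "card (insert x (S - {y})) = card S" if "finite S" "y \<in> S" "x \<notin> S" for S and x y :: nat
  proof -
    have "x \<notin> S - {y}" "finite (S - {y})" using that by auto
    then have "card (insert x (S - {y})) = Suc (card (S - {y}))" by (rule card_insert_disjoint[rotated])
    then show ?thesis using card_Suc_Diff1[OF that(1,2)] by simp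
  qed
  have c1: "card A1 = card A" "finite A1"
    using swap[OF fin _ ab(1), of 0] z(1) fin by (simp_all add: A1_def)
  have Mb: "M \<in> A1 \<longleftrightarrow> b \<in> U" "b \<notin> A1"
    using z UM[of a] ab assms M2 by (auto simp: A1_def)
  have "card A2 = card A1" using swap[OF c1(2), of M b] Mb by (simp add: A2_def)
  moreover have "j \<in> BB a b \<longleftrightarrow> j \<in> A2" for j
  proof -
    consider "j = 0" | "j = M" | "0 < j" "j < M" | "M < j" by linarith
    then show ?thesis
    proof cases
      case 3
      then show ?thesis unfolding B A1_def A2_def by auto
    qed (use z UM[of a] UM[of b] assms M2 AM[of j] in \<open>auto simp: B A1_def A2_def\<close>)
  qed
  then have "BB a b = A2" by blast
  ultimately have c2: "card (BB a b) = card A" using c1 by simp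
  have "{s. s \<le> M \<and> (s = a \<or> ccw a s b)} = insert a A" using assms by (auto simp: A_def)
  then show 1: "card {s. s \<le> M \<and> (s = a \<or> ccw a s b)} = card (BB a b) + 1"
    using fin ab c2 by simp
  have "{s. s \<le> M \<and> (s = b \<or> ccw b s a)} = {..M} - {s. s \<le> M \<and> (s = a \<or> ccw a s b)}"
    using ccw_total[of a _ b] ccw_asym[of a _ b] ccw_rot[of b _ a] ccw_rot[of _ a b] ccw_distinct assms by auto
  then show "card {s. s \<le> M \<and> (s = b \<or> ccw b s a)} = M - card (BB a b)"
    using 1 card_Diff_subset[of "{s. s \<le> M \<and> (s = a \<or> ccw a s b)}" "{..M}"]
    by (auto simp: subset_eq intro: finite_subset[of _ "{..M}"])
qed

text \<open>An identity of triangular numbers: with \<open>p\<close>, \<open>q\<close> the sizes for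
  \<open>i j\<close> and \<open>j k\<close>, one has (p+q+1)(p+q+2)/2 - p(p+1)/2 - q(q+1)/2 =
  (p+1)(q+1), and the up case is analogous. The factors will be recognized as numbers of
  blossoms.\<close>

lemma wt_formula:
  assumes "i < j" "j < k" "k \<le> M"
    and "sum y (BB i j) = wt (BB i j)" "sum y (BB j k) = wt (BB j k)" "sum y (BB i k) = wt (BB i k)"
    and "sum y {1..<M} = wt {1..<M}"
  shows "y j = (if j \<in> U then real M - real (M - card (BB i j)) * real (M - card (BB j k))
                else real (card (BB i j) + 1) * real (card (BB j k) + 1))"
proof (cases "j \<in> U")
  case True
  \<comment> \<open>Guards the truncated subtractions in the statement.\<close>
  have le: "card (BB i' k') \<le> M - 1" for i' k' using card_mono[OF _ BB_sub[of i' k']] by simp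
  define p q r where "p = real (card (BB i j))" and "q = real (card (BB j k))" and "r = real (card (BB i k))"
  have "p + q = r + real M" using card_BB_up[OF assms(1-3) True]
    unfolding p_def q_def r_def by (simp flip: of_nat_add)
  then have r: "r = p + q - real M" by simp
  have "wt (BB i j) + wt (BB j k) = wt (BB i k) + wt {1..<M} + y j"
    using sum_BB_up[OF assms(1-3) True, of y] assms by simp
  then have "y j = p * (p + 1) / 2 + q * (q + 1) / 2 - r * (r + 1) / 2 - (real M - 1) * real M / 2"
    unfolding wt_eq p_def q_def r_def using M2 by (simp add: of_nat_diff)
  also have "\<dots> = real M - (real M - p) * (real M - q)" unfolding r by (simp add: field_simps)
  finally show ?thesis using True le[of i j] le[of j k] unfolding p_def q_def by (simp add: of_nat_diff)
next
  case False
  have "wt (BB i k) = wt (BB i j) + wt (BB j k) + y j"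
    using sum_BB_down[OF assms(1-3) False, of y] assms by simp
  then show ?thesis using False card_BB_down[OF assms(1-3) False] unfolding wt_eq by (simp add: field_simps)
qed

end

text \<open>\<open>E\<close> holds for the edges of the polygon too, by \<open>E_max\<close>, as they cross nothing.\<close>

locale label_triangulation = labels +
  fixes E :: "nat \<Rightarrow> nat \<Rightarrow> bool"
  assumes E_sym: "E a b \<Longrightarrow> E b a"
    and E_bd: "E a b \<Longrightarrow> a \<le> M \<and> b \<le> M \<and> a \<noteq> b"
    and E_nc: "E a b \<Longrightarrow> E c d \<Longrightarrow> \<not> crosses a b c d"
    and E_max: "\<lbrakk>a \<le> M; b \<le> M; a \<noteq> b; \<And>c d. E c d \<Longrightarrow> \<not> crosses a b c d\<rbrakk> \<Longrightarrow> E a b"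
begin

section \<open>Triangles of a triangulation in terms of labels\<close>

lemma succ_E:
  assumes "a \<le> M" "c \<le> M" "a \<noteq> c" "\<And>x. x \<le> M \<Longrightarrow> \<not> ccw a x c"
  shows "E a c"
  by (rule E_max) (use assms E_bd in \<open>auto simp: crosses_def\<close>)

lemma ex_succ:
  assumes "a \<le> M"
  shows "\<exists>c\<le>M. c \<noteq> a \<and> (\<forall>x\<le>M. \<not> ccw a x c)"
proof -
  have "\<exists>c. c \<le> M \<and> c \<noteq> a" using M2 by (intro exI[of _ "if a = 0 then 1 else 0"]) auto
  then obtain c where c: "c \<le> M \<and> c \<noteq> a" "\<And>y. y \<le> M \<and> y \<noteq> a \<Longrightarrow> key a c \<le> key a y"
    using ex_has_least_nat[of "\<lambda>c. c \<le> M \<and> c \<noteq> a" _ "key a"] by blast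
  then show ?thesis using ccw_key'[OF assms] by (intro exI[of _ c]) (force simp: key_self)
qed

lemma ex_pred:
  assumes "a \<le> M"
  shows "\<exists>c\<le>M. c \<noteq> a \<and> (\<forall>x\<le>M. \<not> ccw c x a)"
proof -
  have "\<exists>c. c \<le> M \<and> c \<noteq> a" using M2 by (intro exI[of _ "if a = 0 then 1 else 0"]) auto
  then obtain c where c: "c \<le> M \<and> c \<noteq> a" "\<And>y. y \<le> M \<and> y \<noteq> a \<Longrightarrow> key a y \<le> key a c"
    using ex_has_greatest_nat[of "\<lambda>c. c \<le> M \<and> c \<noteq> a" _ "key a" "2 * M"] key_lt[OF assms] by (metis less_imp_le)
  have "\<not> ccw c x a" if "x \<le> M" for x
  proof
    assume h: "ccw c x a"
    then have "x \<noteq> a" using ccw_distinct by blast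
    then show False using h c(2)[of x] that ccw_key'[of a c x] ccw_rot[of a c x] assms c(1) by auto
  qed
  then show ?thesis using c(1) by blast
qed

text \<open>Among the neighbours of \<open>a\<close> on the given side of \<open>a b\<close>, the one next to \<open>b\<close> is the third vertex.\<close>

lemma third:
  assumes ab: "E a b" and v: "v \<le> M" "ccw a v b"
  shows "\<exists>c\<le>M. ccw a c b \<and> E a c \<and> E c b"
proof -
  have bd: "a \<le> M" "b \<le> M" "a \<noteq> b" using E_bd ab by auto
  let ?P = "\<lambda>c. c \<le> M \<and> ccw a c b \<and> E a c"
  obtain s where s: "s \<le> M" "s \<noteq> a" "\<And>x. x \<le> M \<Longrightarrow> \<not> ccw a x s" using ex_succ[OF bd(1)] by blast
  have "E a s" using succ_E bd s by metis
  moreover have "ccw a s b"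
    using s(3)[OF v(1)] v ccw_key'[OF bd(1) v(1)] ccw_key'[OF bd(1) s(1) bd(2)] bd s(1,2) key_0[of a s] by auto
  ultimately have "?P s" using s by blast
  then obtain c where c: "?P c" and cmax: "\<And>y. ?P y \<Longrightarrow> key a y \<le> key a c"
    using ex_has_greatest_nat[of ?P s "key a" "2 * M"] key_lt[OF bd(1)] by (metis less_imp_le)
  \<comment> \<open>A segment of \<open>E\<close> crossing \<open>c b\<close> crosses neither
    \<open>a b\<close> nor \<open>a c\<close>; so it starts at \<open>a\<close> and ends strictly
    between \<open>c\<close> and \<open>b\<close>, contrary to the choice of
    \<open>c\<close>.\<close>
  have *: "\<not> (ccw c x b \<and> ccw b y c)" if xy: "E x y" for x y
  proof
    assume h: "ccw c x b \<and> ccw b y c"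
    have b': "x \<le> M" "y \<le> M" using E_bd xy by auto
    have c': "c \<le> M" using c by auto
    have kc: "0 < key a c" "key a c < key a b" using c ccw_key'[OF bd(1) c' bd(2)] by auto
    have h': "cyclic (key a c) (key a x) (key a b)" "cyclic (key a b) (key a y) (key a c)"
      using h ccw_key[OF bd(1) c' b'(1) bd(2)] ccw_key[OF bd(1) bd(2) b'(2) c'] by auto
    have "\<not> crosses a b x y" and "\<not> crosses a c x y" using E_nc ab c xy by auto
    then have n: "\<not> (cyclic 0 (key a x) (key a b) \<and> cyclic (key a b) (key a y) 0)"
      "\<not> (cyclic 0 (key a y) (key a c) \<and> cyclic (key a c) (key a x) 0)"
      unfolding crosses_def using ccw_key[OF bd(1)] key_self bd b' c' by metis+
    have "key a y = 0 \<and> 0 < key a x \<and> key a x < key a b \<and> key a c < key a x"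
      using kc h' n unfolding cyclic_def by linarith
    then have "y = a" "ccw a x b" "key a c < key a x"
      using key_0 b' bd ccw_key'[OF bd(1) b'(1) bd(2)] by auto
    then show False using cmax[of x] b' xy E_sym by auto
  qed
  have "c \<noteq> b" using c ccw_distinct by blast
  have "E c b"
    by (rule E_max) (use * c bd \<open>c \<noteq> b\<close> E_sym in \<open>unfold crosses_def, blast+\<close>)
  then show ?thesis using c by blast
qed

text \<open>Of two apexes on one side of \<open>a b\<close>, a side of one triangle would cross a
  side of the other.\<close>

lemma third_unique:
  assumes "E a c" "E c b" "E a c'" "E c' b" "ccw a c b" "ccw a c' b"
  shows "c = c'"
proof (rule ccontr)
  assume n: "c \<noteq> c'"
  have bd: "a \<le> M" "b \<le> M" "c \<le> M" "c' \<le> M" using E_bd assms by auto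
  have n1: "\<not> crosses a c c' b" "\<not> crosses a c' c b" using E_nc assms by auto
  have "key a c \<noteq> key a c'" using key_eq bd n by auto
  then show False using n1 assms(5,6) unfolding crosses_def
    by (simp add: ccw_key[OF bd(1)] bd key_self) (auto simp: cyclic_def)
qed

text \<open>Among the neighbours to the right of \<open>j\<close>, take the last one
  counterclockwise from \<open>j\<close> if \<open>j\<close> is down, the first one if
  \<open>j\<close> is up. The triangle at \<open>j k\<close> on the side of the vertex
  \<open>0\<close> has its apex left of \<open>j\<close>, since an apex to the right would
  contradict this choice.\<close>

lemma median_exists:
  assumes j: "0 < j" "j < M"
  shows "\<exists>i k. i < j \<and> j < k \<and> k \<le> M \<and> E i j \<and> E j k \<and> E i k"
proof (cases "j \<in> U")
  case False
  let ?P = "\<lambda>k. j < k \<and> E j k"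
  obtain s where s: "s \<le> M" "s \<noteq> j" "\<And>x. x \<le> M \<Longrightarrow> \<not> ccw j x s" using ex_succ[of j] j by auto
  have "s > j"
  proof (rule ccontr)
    assume "\<not> s > j"
    then have "ccw s j M" "s < j" using ccw_sorted[of s j M] s(2) j False by auto
    then show False using s(3)[of M] ccw_rot by auto
  qed
  then have "?P s" using succ_E[of j s] s j by auto
  then obtain k where k: "?P k" and kmax: "\<And>y. ?P y \<Longrightarrow> key j y \<le> key j k"
    using ex_has_greatest_nat[of ?P s "key j" "2 * M"] key_lt[of j] j E_bd by (metis less_imp_le)
  have kM: "k \<le> M" using k E_bd by auto
  have "ccw k 0 j" using ccw_sorted[of 0 j k] kM k j False ccw_rot by auto
  then obtain c where c: "c \<le> M" "ccw k c j" "E k c" "E c j" using third[of k j 0] k E_sym by auto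
  have "c < j"
  proof (rule ccontr)
    assume "\<not> c < j"
    then have "?P c" using c E_bd E_sym by (metis linorder_neqE_nat)
    then show False using kmax[of c] c ccw_key'[of j k c] ccw_rot kM j by auto
  qed
  then show ?thesis using c k kM E_sym by blast
next
  case True
  let ?P = "\<lambda>k. j < k \<and> E j k"
  obtain s where s: "s \<le> M" "s \<noteq> j" "\<And>x. x \<le> M \<Longrightarrow> \<not> ccw s x j" using ex_pred[of j] j by auto
  have "s > j"
  proof (rule ccontr)
    assume "\<not> s > j"
    then have "ccw s M j" "s < j" using ccw_sorted[of s j M] s(2) j True by auto
    then show False using s(3)[of M] by auto
  qed
  then have "?P s" using succ_E[of s j] s j E_sym by auto
  then obtain k where k: "?P k" and kmin: "\<And>y. ?P y \<Longrightarrow> key j k \<le> key j y"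
    using ex_has_least_nat[of ?P s "key j"] by blast
  have kM: "k \<le> M" using k E_bd by auto
  have "ccw j 0 k" using ccw_sorted[of 0 j k] kM k j True ccw_rot by auto
  then obtain c where c: "c \<le> M" "ccw j c k" "E j c" "E c k" using third[of j k 0] k by auto
  have "c < j"
  proof (rule ccontr)
    assume "\<not> c < j"
    then have "?P c" using c E_bd by (metis linorder_neqE_nat)
    then show False using kmin[of c] c ccw_key'[of j c k] kM j by auto
  qed
  then show ?thesis using c k kM E_sym by blast
qed

end

lemma sort_three:
  fixes p q r :: nat
  assumes "p \<noteq> q" "q \<noteq> r" "p \<noteq> r"
  obtains i j k where "i < j" "j < k" "{i, j, k} = {p, q, r}"
proof -
  consider "p < q" "q < r" | "p < r" "r < q" | "q < p" "p < r" | "q < r" "r < p" | "r < p" "p < q" | "r < q" "q < p"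
    using assms by linarith
  then show thesis by cases (use that in \<open>blast+\<close>)
qed

context label_triangulation
begin

lemma triangle_on_one_side:
  assumes "\<And>s s'. s \<in> S \<Longrightarrow> s' \<in> S \<Longrightarrow> s \<noteq> s' \<Longrightarrow> E s s'" "\<And>s. s \<in> S \<Longrightarrow> s \<le> M" and ab: "E a b"
  shows "(\<forall>s\<in>S. s = a \<or> s = b \<or> ccw a s b) \<or> (\<forall>s\<in>S. s = a \<or> s = b \<or> ccw b s a)"
proof (rule ccontr)
  assume n: "\<not> ?thesis"
  then obtain s s' where s: "s \<in> S" "s' \<in> S" "s \<noteq> a" "s \<noteq> b" "\<not> ccw a s b" "s' \<noteq> a" "s' \<noteq> b" "\<not> ccw b s' a"
    by blast
  have bd: "a \<le> M" "b \<le> M" "a \<noteq> b" using E_bd ab by auto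
  have "ccw a b s" "ccw b a s'" using ccw_total[of a b s] ccw_total[of a b s'] s bd assms(2)
      ccw_rot[of a s b] ccw_rot[of b s' a] ccw_rot[of s b a] ccw_rot[of s' a b] ccw_rot[of b s a] ccw_rot[of a s' b]
      ccw_rot[of a b s] ccw_rot[of b a s'] by auto
  then have c: "ccw b s a" "ccw a s' b" using ccw_rot by blast+
  then have "s \<noteq> s'" using s by blast
  then have "E s s'" using assms(1) s by blast
  moreover have "crosses a b s s'" using c unfolding crosses_def by blast
  ultimately show False using E_nc ab by blast
qed

text \<open>The side of \<open>a b\<close> on which a triangle lies can be read off its median
  alone, so it is the same for all triangles with that median.\<close>

lemma median_side:
  assumes t: "i < j" "j < k" "E i j" "E j k" "E i k" and ab: "a < b" "E a b"
  shows "(\<forall>s\<in>{i, j, k}. s = a \<or> s = b \<or> ccw a s b) \<and> j \<in> BB a b \<or>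
         (\<forall>s\<in>{i, j, k}. s = a \<or> s = b \<or> ccw b s a) \<and> j \<notin> BB a b"
proof -
  have M: "i \<le> M" "j \<le> M" "k \<le> M" "b \<le> M" using E_bd t ab by blast+
  have "(\<forall>s\<in>{i, j, k}. s = a \<or> s = b \<or> ccw a s b) \<or> (\<forall>s\<in>{i, j, k}. s = a \<or> s = b \<or> ccw b s a)"
    by (rule triangle_on_one_side) (use t ab M E_sym in auto)
  then show ?thesis
    using median_below[OF t(1,2) M(3) ab(1) M(4)] median_above[OF t(1,2) M(3) ab(1) M(4)] by blast
qed

text \<open>A corner \<open>s\<close> of the second triangle that is not one of the first would lie,
  with respect to each side of the first, where its opposite corner lies, because the medians agree.
  It would be inside that triangle, against convex position.\<close>

lemma median_unique:
  assumes t: "i < j" "j < k" "E i j" "E j k" "E i k" and t': "i' < j" "j < k'" "E i' j" "E j k'" "E i' k'"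
  shows "i = i' \<and> k = k'"
proof -
  have M: "i \<le> M" "j \<le> M" "k \<le> M" "i' \<le> M" "k' \<le> M" using E_bd t t' by blast+
  have in_t: "s \<in> {i, j, k}" if s: "s \<in> {i', j, k'}" for s
  proof (rule ccontr)
    assume n: "s \<notin> {i, j, k}"
    have sM: "s \<le> M" using s M by auto
    have same: "ccw a s b \<longleftrightarrow> ccw a x b"
      if h: "a < b" "E a b" "a \<in> {i, j, k}" "b \<in> {i, j, k}" "x \<in> {i, j, k}" "x \<noteq> a" "x \<noteq> b" for a b x
    proof -
      have "(ccw a x b \<and> j \<in> BB a b) \<or> (ccw b x a \<and> j \<notin> BB a b)"
        using median_side[OF t h(1,2)] h by blast
      moreover have "(ccw a s b \<and> j \<in> BB a b) \<or> (ccw b s a \<and> j \<notin> BB a b)"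
        using median_side[OF t' h(1,2)] h s n by blast
      ultimately show ?thesis using ccw_asym[of a x b] ccw_asym[of a s b] ccw_rot[of b x a] ccw_rot[of b s a]
          ccw_rot[of x a b] ccw_rot[of s a b] by blast
    qed
    have 1: "ccw i s j \<longleftrightarrow> ccw i k j" by (rule same) (use t in auto)
    have 2: "ccw j s k \<longleftrightarrow> ccw j i k" by (rule same) (use t in auto)
    have 3: "ccw i s k \<longleftrightarrow> ccw i j k" by (rule same) (use t in auto)
    have "key i s \<noteq> 0" "key i s \<noteq> key i j" "key i s \<noteq> key i k" "key i j \<noteq> key i k" "key i j \<noteq> 0" "key i k \<noteq> 0"
      using n sM M t key_eq[OF M(1)] key_0[OF M(1)] by auto
    moreover have "ccw j s k \<longleftrightarrow> cyclic (key i j) (key i s) (key i k)" "ccw j i k \<longleftrightarrow> cyclic (key i j) 0 (key i k)"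
      using ccw_key[OF M(1)] M sM key_self by auto
    ultimately show False using 1 2 3 ccw_key'[OF M(1)] M sM unfolding cyclic_def by force
  qed
  show ?thesis using in_t[of i'] in_t[of k'] t t' by auto
qed

lemma sum_zero_imp_zero:
  fixes y :: "nat \<Rightarrow> real"
  assumes "\<And>a b. a < b \<Longrightarrow> E a b \<Longrightarrow> sum y (BB a b) = 0" "sum y {1..<M} = 0" "0 < j" "j < M"
  shows "y j = 0"
proof -
  obtain i k where t: "i < j" "j < k" "k \<le> M" "E i j" "E j k" "E i k" using median_exists assms by blast
  have "sum y (BB i j) = 0" "sum y (BB j k) = 0" "sum y (BB i k) = 0" using assms(1) t by auto
  then show ?thesis using sum_BB_down[OF t(1-3), of y] sum_BB_up[OF t(1-3), of y] assms(2) by (cases "j \<in> U") auto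
qed

section \<open>The linear system of a triangulation\<close>

lemma triangle_at:
  assumes "E a b" "x \<le> M" "ccw a x b"
  obtains i j k where "i < j" "j < k" "E i j" "E j k" "E i k" "a \<in> {i, j, k}" "b \<in> {i, j, k}"
    "\<And>s. s \<in> {i, j, k} \<Longrightarrow> s = a \<or> s = b \<or> ccw a s b"
proof -
  obtain c where c: "c \<le> M" "ccw a c b" "E a c" "E c b" using third[OF assms] by blast
  obtain i j k where t: "i < j" "j < k" "{i, j, k} = {a, c, b}"
    using sort_three[of a c b] ccw_distinct[OF c(2)] by metis
  have e: "E s s'" if h: "s \<in> {i, j, k}" "s' \<in> {i, j, k}" "s \<noteq> s'" for s s'
    using h c assms(1) E_sym unfolding t(3) by blast
  have "a \<in> {i, j, k}" "b \<in> {i, j, k}" "\<And>s. s \<in> {i, j, k} \<Longrightarrow> s = a \<or> s = b \<or> ccw a s b"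
    using c unfolding t(3) by blast+
  moreover have "E i j" "E j k" "E i k" using e t(1,2) by simp_all
  ultimately show thesis using that[of i j k] t(1,2) by blast
qed

text \<open>The difference of the basis vectors of the medians of the triangles below and above \<open>a b\<close>.\<close>

lemma dual_vector:
  assumes ab: "a < b" "E a b" and x: "x \<le> M" "ccw a x b" and x': "x' \<le> M" "ccw b x' a"
  shows "\<exists>y :: nat \<Rightarrow> real. sum y {1..<M} = 0 \<and> sum y (BB a b) = 1 \<and>
          (\<forall>c d. c < d \<and> E c d \<and> (c, d) \<noteq> (a, b) \<longrightarrow> sum y (BB c d) = 0)"
proof -
  obtain i j k where t: "i < j" "j < k" "E i j" "E j k" "E i k" "a \<in> {i, j, k}" "b \<in> {i, j, k}"
    "\<And>s. s \<in> {i, j, k} \<Longrightarrow> s = a \<or> s = b \<or> ccw a s b" using triangle_at[OF ab(2) x] by blast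
  obtain i' j' k' where t': "i' < j'" "j' < k'" "E i' j'" "E j' k'" "E i' k'" "b \<in> {i', j', k'}" "a \<in> {i', j', k'}"
    "\<And>s. s \<in> {i', j', k'} \<Longrightarrow> s = b \<or> s = a \<or> ccw b s a" using triangle_at[OF E_sym[OF ab(2)] x'] by blast
  have M: "k \<le> M" "k' \<le> M" "b \<le> M" using E_bd t(4) t'(4) ab by blast+
  have jM: "j \<in> {1..<M}" "j' \<in> {1..<M}" using M t t' by auto
  define y :: "nat \<Rightarrow> real" where "y m = (if m = j then 1 else 0) - (if m = j' then 1 else 0)" for m
  have sy: "sum y S = (if j \<in> S then 1 else 0) - (if j' \<in> S then 1 else 0)" if "finite S" for S
    using that unfolding y_def by (simp add: sum_subtractf)
  have "j \<in> BB a b" by (rule median_below) (use t M ab in auto)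
  moreover have "j' \<notin> BB a b" by (rule median_above) (use t' M ab in blast)+
  ultimately have 1: "sum y (BB a b) = 1" by (simp add: sy)
  have "sum y (BB c d) = 0" if cd: "c < d" "E c d" "(c, d) \<noteq> (a, b)" for c d
  proof -
    \<comment> \<open>Both triangles contain \<open>a\<close> and \<open>b\<close>, and these are
      both ends of \<open>c d\<close> only if the diagonals coincide. Hence the triangles are on the
      same side of \<open>c d\<close>, and the two entries of \<open>y\<close> cancel in its
      sum.\<close>
    have no: "\<not> (\<forall>s\<in>{a, b}. (s = c \<or> s = d \<or> ccw c s d) \<and> (s = c \<or> s = d \<or> ccw d s c))"
    proof
      assume "\<forall>s\<in>{a, b}. (s = c \<or> s = d \<or> ccw c s d) \<and> (s = c \<or> s = d \<or> ccw d s c)"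
      then have "a = c \<or> a = d" "b = c \<or> b = d"
        using ccw_asym[of c _ d] ccw_rot[of d _ c] ccw_rot[of _ c d] by blast+
      then show False using ab(1) cd by auto
    qed
    have "j \<in> BB c d \<longleftrightarrow> j' \<in> BB c d"
      using median_side[OF t(1-5) cd(1,2)] median_side[OF t'(1-5) cd(1,2)] no t(6,7) t'(6,7) by blast
    then show ?thesis by (simp add: sy)
  qed
  moreover have "sum y {1..<M} = 0" using jM by (simp add: sy)
  ultimately show ?thesis using 1 by blast
qed

lemma E_boundary:
  assumes "a < b" "b \<le> M" "(\<forall>x\<le>M. \<not> ccw a x b) \<or> (\<forall>x\<le>M. \<not> ccw b x a)"
  shows "BB a b = {} \<or> BB a b = {1..<M}"
  using BB_boundary[OF assms(1,2)] assms(3) by blast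

text \<open>Starting from any point of the hyperplane, each dual vector corrects the sum of its own
  diagonal without disturbing the others or the total.\<close>

lemma ex_point:
  "\<exists>y :: nat \<Rightarrow> real. sum y {1..<M} = wt {1..<M} \<and> (\<forall>a b. a < b \<longrightarrow> E a b \<longrightarrow> sum y (BB a b) = wt (BB a b))"
proof -
  define I where "I = {(a, b). a < b \<and> E a b \<and> (\<exists>x\<le>M. ccw a x b) \<and> (\<exists>x\<le>M. ccw b x a)}"
  have "I \<subseteq> {..M} \<times> {..M}" using E_bd by (auto simp: I_def)
  then have fI: "finite I" by (rule finite_subset) auto
  have "\<exists>y :: nat \<Rightarrow> real. sum y {1..<M} = 0 \<and> sum y (BB (fst e) (snd e)) = 1 \<and>
          (\<forall>c d. c < d \<and> E c d \<and> (c, d) \<noteq> e \<longrightarrow> sum y (BB c d) = 0)" if e: "e \<in> I" for e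
    using dual_vector[of "fst e" "snd e"] e by (auto simp: I_def)
  then obtain Y :: "nat \<times> nat \<Rightarrow> nat \<Rightarrow> real" where
    Y: "\<And>e. e \<in> I \<Longrightarrow> sum (Y e) {1..<M} = 0" "\<And>e. e \<in> I \<Longrightarrow> sum (Y e) (BB (fst e) (snd e)) = 1"
      "\<And>e c d. e \<in> I \<Longrightarrow> c < d \<Longrightarrow> E c d \<Longrightarrow> (c, d) \<noteq> e \<Longrightarrow> sum (Y e) (BB c d) = 0"
    by metis
  \<comment> \<open>The constant point of \<open>H\<close>: (M - 1) * (M / 2) is the prescribed
    total.\<close>
  define y0 :: "nat \<Rightarrow> real" where "y0 = (\<lambda>_. real M / 2)"
  define co where "co e = wt (BB (fst e) (snd e)) - sum y0 (BB (fst e) (snd e))" for e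
  define y where "y j = y0 j + (\<Sum>e\<in>I. co e * Y e j)" for j
  have s: "sum y S = sum y0 S + (\<Sum>e\<in>I. co e * sum (Y e) S)" for S
    unfolding y_def sum.distrib sum_distrib_left by (subst sum.swap) simp
  have "sum y0 {1..<M} = wt {1..<M}" using M2 unfolding y0_def wt_eq by (simp add: field_simps of_nat_diff)
  then have tot: "sum y {1..<M} = wt {1..<M}" unfolding s using Y(1) by simp
  moreover have "sum y (BB a b) = wt (BB a b)" if ab: "a < b" "E a b" for a b
  proof (cases "(a, b) \<in> I")
    case True
    have "(\<Sum>e\<in>I. co e * sum (Y e) (BB a b)) = (\<Sum>e\<in>I. if e = (a, b) then co e else 0)"
      by (rule sum.cong) (use Y(2,3) ab in auto)
    also have "\<dots> = co (a, b)" using fI True by simp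
    finally show ?thesis unfolding s by (simp add: co_def)
  next
    case False
    then have "BB a b = {} \<or> BB a b = {1..<M}" using E_boundary[of a b] ab E_bd by (auto simp: I_def)
    then show ?thesis using tot by (auto simp: wt_eq)
  qed
  ultimately show ?thesis by blast
qed

lemma sum_ge_wt:
  fixes y :: "nat \<Rightarrow> real"
  assumes y: "\<And>a b. a < b \<Longrightarrow> E a b \<Longrightarrow> sum y (BB a b) = wt (BB a b)"
    and cd: "c \<le> M" "d \<le> M" "c \<noteq> d"
  shows "sum y (BS c d) \<ge> wt (BS c d) \<and> (\<not> E c d \<longrightarrow> sum y (BS c d) > wt (BS c d))"
  using cd
proof (induction "card {(x, y). E x y \<and> crosses x y c d}" arbitrary: c d rule: less_induct)
  case less
  have yE: "sum y (BS a b) = wt (BS a b)" if "E a b" for a b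
    using y[of "min a b" "max a b"] that E_sym E_bd[OF that] by (auto simp: BS_def min_def max_def)
  have fin: "finite {(x, y). E x y \<and> crosses x y c d}"
    by (rule finite_subset[of _ "{..M} \<times> {..M}"]) (use E_bd in auto)
  show ?case
  proof (cases "E c d")
    case False
    then obtain a b where ab: "E a b" "crosses c d a b" using E_max less.prems by blast
    have bd: "a \<le> M" "b \<le> M" "a \<noteq> b" using E_bd ab by auto
    have x: "crosses a b c d" using ab crosses_sym by blast
    obtain u u' w w' where q: "{u, u'} = {a, b}" "{w, w'} = {c, d}" "BS u w = BS a b \<inter> BS c d"
      "BS u' w' = BS a b \<union> BS c d" and ne: "BS a b - BS c d \<noteq> {}" "BS c d - BS a b \<noteq> {}"
      using BS_uncross[OF bd(1,2) less.prems(1,2) x] by (elim exE conjE)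
    have IH: "sum y (BS p r) \<ge> wt (BS p r)" if p: "p \<in> {a, b}" and r: "r \<in> {c, d}" for p r
    proof -
      have pr: "p \<le> M" "r \<le> M" using p r bd less.prems by auto
      have "p \<noteq> r" using p r x ccw_distinct unfolding crosses_def by blast
      have na: "\<not> crosses a b p r" using p ccw_distinct[of a p b] ccw_distinct[of b p a] unfolding crosses_def by auto
      have "crosses x z c d" if "E x z" "crosses x z p r" for x z
        using crosses_side[OF bd(1,2) less.prems(1,2) _ _ x p r that(2)] E_bd[OF that(1)] E_nc that(1) ab(1) by blast
      \<comment> \<open>The inclusion is strict because \<open>a b\<close> crosses
        \<open>c d\<close> but no segment issuing from \<open>a\<close> or \<open>b\<close>.\<close>
      then have "{(x, y). E x y \<and> crosses x y p r} \<subset> {(x, y). E x y \<and> crosses x y c d}" using na ab(1) x by blast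
      then have "card {(x, y). E x y \<and> crosses x y p r} < card {(x, y). E x y \<and> crosses x y c d}"
        by (rule psubset_card_mono[OF fin])
      from less.hyps[OF this pr \<open>p \<noteq> r\<close>] show ?thesis by blast
    qed
    have m: "u \<in> {a, b}" "u' \<in> {a, b}" "w \<in> {c, d}" "w' \<in> {c, d}" using q by blast+
    obtain v v' where v: "v \<in> BS a b - BS c d" "v' \<in> BS c d - BS a b" using ne by blast
    \<comment> \<open>As \<open>a b\<close> is tight, the whole gap of supermodularity falls to
      \<open>c d\<close>, which makes its inequality strict.\<close>
    have "wt (BS a b) + wt (BS c d) < wt (BS a b \<union> BS c d) + wt (BS a b \<inter> BS c d)"
      by (rule wt_supermodular[OF _ _ v]) auto
    also have "\<dots> \<le> sum y (BS a b \<union> BS c d) + sum y (BS a b \<inter> BS c d)"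
      using IH[OF m(1,3)] IH[OF m(2,4)] q by simp
    also have "\<dots> = sum y (BS a b) + sum y (BS c d)" by (rule sum.union_inter) auto
    finally show ?thesis using yE[OF ab(1)] by simp
  qed (use yE in auto)
qed

end

section \<open>Simple polytopes from tight constraints\<close>

text \<open>Kept apart because the assumptions of the next locale already speak of \<open>Q\<close>
  and \<open>tight\<close>.\<close>

locale constraint_system =
  fixes c :: "'a::euclidean_space" and c0 :: real
    and D :: "'d set" and a :: "'d \<Rightarrow> 'a" and b :: "'d \<Rightarrow> real"
begin

definition Q :: "'a set" where
  "Q = {x. c \<bullet> x = c0 \<and> (\<forall>d\<in>D. b d \<le> a d \<bullet> x)}"

definition tight :: "'a \<Rightarrow> 'd set" where
  "tight x = {d \<in> D. a d \<bullet> x = b d}"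

end

text \<open>\<open>Dis\<close> stands for the sets that are tight at some point, \<open>Tri\<close>
  for the largest of them, which belong to the vertices. By \<open>dual\<close> and
  \<open>determined\<close>, the normals in a member of \<open>Tri\<close> form a basis of the
  functionals on the direction space of the hyperplane; this makes \<open>Q\<close> simple.\<close>

locale tight_polytope = constraint_system c c0 D a b
  for c :: "'a::euclidean_space" and c0 :: real
    and D :: "'d set" and a :: "'d \<Rightarrow> 'a" and b :: "'d \<Rightarrow> real" +
  fixes Dis :: "'d set set" and Tri :: "'d set set" and p :: "'d set \<Rightarrow> 'a"
  assumes finite_D: "finite D"
    and c_nonzero: "c \<noteq> 0"
    and tight_Dis: "x \<in> Q \<Longrightarrow> tight x \<in> Dis"
    and Dis_extend: "S \<in> Dis \<Longrightarrow> \<exists>T\<in>Tri. S \<subseteq> T"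
    and Dis_subset: "T \<in> Tri \<Longrightarrow> S \<subseteq> T \<Longrightarrow> S \<in> Dis"
    and Tri_D: "T \<in> Tri \<Longrightarrow> T \<subseteq> D"
    and Tri_nonempty: "Tri \<noteq> {}"
    and p_Q: "T \<in> Tri \<Longrightarrow> p T \<in> Q"
    and tight_p: "T \<in> Tri \<Longrightarrow> tight (p T) = T"
    and dual: "T \<in> Tri \<Longrightarrow> d \<in> T \<Longrightarrow> \<exists>y. c \<bullet> y = 0 \<and> a d \<bullet> y = 1 \<and> (\<forall>e\<in>T - {d}. a e \<bullet> y = 0)"
    and determined: "T \<in> Tri \<Longrightarrow> c \<bullet> y = 0 \<Longrightarrow> (\<And>d. d \<in> T \<Longrightarrow> a d \<bullet> y = 0) \<Longrightarrow> y = 0"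
    and bounded_Q: "bounded Q"
begin

definition face :: "'d set \<Rightarrow> 'a set" where
  "face S = {x \<in> Q. \<forall>d\<in>S. a d \<bullet> x = b d}"

section \<open>Perturbation and points with a prescribed tight set\<close>

lemma polyhedron_Q: "polyhedron Q"
proof -
  have "Q = {x. c \<bullet> x = c0} \<inter> \<Inter> ((\<lambda>d. {x. a d \<bullet> x \<ge> b d}) ` D)" by (auto simp: Q_def)
  also have "polyhedron \<dots>" using finite_D
    by (intro polyhedron_Int polyhedron_Inter polyhedron_hyperplane) (auto simp: polyhedron_halfspace_ge)
  finally show ?thesis .
qed

lemma polytope_Q: "polytope Q"
  using polyhedron_Q bounded_Q polytope_eq_bounded_polyhedron by blast

lemma convex_Q: "convex Q"
  using polytope_Q polytope_imp_convex by blast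

text \<open>For a small step the slack constraints remain slack by continuity and finiteness, so
  only the tight ones restrict the direction. All local arguments below use this lemma.\<close>

lemma perturb:
  assumes x: "x \<in> Q" and z: "c \<bullet> z = 0" "\<And>d. d \<in> tight x \<Longrightarrow> 0 \<le> a d \<bullet> z"
  shows "\<exists>e>0. x + e *\<^sub>R z \<in> Q \<and> tight (x + e *\<^sub>R z) = {d \<in> tight x. a d \<bullet> z = 0}"
proof -
  have "\<forall>\<^sub>F e in at_right (0::real). b d < a d \<bullet> (x + e *\<^sub>R z)" if d: "d \<in> D - tight x" for d
  proof -
    have "((\<lambda>e. a d \<bullet> (x + e *\<^sub>R z)) \<longlongrightarrow> a d \<bullet> (x + 0 *\<^sub>R z)) (at_right (0::real))"
      by (intro tendsto_intros)
    moreover have "b d < a d \<bullet> (x + 0 *\<^sub>R z)" using d x by (fastforce simp: Q_def tight_def)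
    ultimately show ?thesis by (rule order_tendstoD(1))
  qed
  then have "\<forall>\<^sub>F e in at_right (0::real). \<forall>d\<in>D - tight x. b d < a d \<bullet> (x + e *\<^sub>R z)"
    using finite_D by (intro eventually_ball_finite) auto
  then have "\<forall>\<^sub>F e in at_right (0::real). 0 < e \<and> (\<forall>d\<in>D - tight x. b d < a d \<bullet> (x + e *\<^sub>R z))"
    using eventually_at_right_less by (rule eventually_conj[rotated])
  then obtain e where e: "0 < e" "\<forall>d\<in>D - tight x. b d < a d \<bullet> (x + e *\<^sub>R z)"
    using eventually_happens[of _ "at_right (0::real)"] by (auto simp: trivial_limit_at_right_real)
  have t: "a d \<bullet> (x + e *\<^sub>R z) = b d + e * (a d \<bullet> z)" if "d \<in> tight x" for d
    using that by (simp add: tight_def inner_add_right)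
  have "x + e *\<^sub>R z \<in> Q"
  proof -
    have "b d \<le> a d \<bullet> (x + e *\<^sub>R z)" if "d \<in> D" for d
      using e t[of d] z(2)[of d] that by (cases "d \<in> tight x") (auto simp: less_imp_le)
    then show ?thesis using x z(1) by (simp add: Q_def inner_add_right)
  qed
  moreover have "d \<in> tight (x + e *\<^sub>R z) \<longleftrightarrow> d \<in> tight x \<and> a d \<bullet> z = 0" for d
  proof (cases "d \<in> tight x")
    case True
    then show ?thesis using t[OF True] e(1) by (simp add: tight_def)
  next
    case False
    then show ?thesis using bspec[OF e(2), of d] by (auto simp: tight_def)
  qed
  ultimately show ?thesis using e(1) by blast
qed

definition duals :: "'d set \<Rightarrow> 'd \<Rightarrow> 'a" where
  "duals T d = (SOME y. c \<bullet> y = 0 \<and> a d \<bullet> y = 1 \<and> (\<forall>e\<in>T - {d}. a e \<bullet> y = 0))"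

lemma duals:
  assumes "T \<in> Tri" "d \<in> T"
  shows "c \<bullet> duals T d = 0" "e \<in> T \<Longrightarrow> a e \<bullet> duals T d = (if e = d then 1 else 0)"
proof -
  have "c \<bullet> duals T d = 0 \<and> a d \<bullet> duals T d = 1 \<and> (\<forall>e\<in>T - {d}. a e \<bullet> duals T d = 0)"
    unfolding duals_def by (rule someI_ex) (use dual assms in blast)
  then show "c \<bullet> duals T d = 0" "e \<in> T \<Longrightarrow> a e \<bullet> duals T d = (if e = d then 1 else 0)" by auto
qed

lemma duals_sum:
  assumes "T \<in> Tri" "S \<subseteq> T"
  shows "c \<bullet> (\<Sum>d\<in>S. f d *\<^sub>R duals T d) = 0"
    and "e \<in> T \<Longrightarrow> a e \<bullet> (\<Sum>d\<in>S. f d *\<^sub>R duals T d) = (if e \<in> S then f e else 0)"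
proof -
  have fS: "finite S" using assms Tri_D finite_D finite_subset by metis
  show "c \<bullet> (\<Sum>d\<in>S. f d *\<^sub>R duals T d) = 0"
    using duals(1) assms by (auto simp: inner_sum_right subset_iff intro!: sum.neutral)
  assume e: "e \<in> T"
  have "a e \<bullet> (\<Sum>d\<in>S. f d *\<^sub>R duals T d) = (\<Sum>d\<in>S. if d = e then f d else 0)"
    unfolding inner_sum_right by (rule sum.cong) (use duals(2) assms e in auto)
  then show "a e \<bullet> (\<Sum>d\<in>S. f d *\<^sub>R duals T d) = (if e \<in> S then f e else 0)" using fS by simp
qed

text \<open>From the vertex \<open>p T\<close>, move along the sum of the dual vectors of
  \<open>T - S\<close>: this loosens exactly these constraints.\<close>

lemma ex_generic_point:
  assumes "S \<in> Dis"
  shows "\<exists>x\<in>Q. tight x = S"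
proof -
  obtain T where T: "T \<in> Tri" "S \<subseteq> T" using Dis_extend[OF assms] by blast
  let ?z = "\<Sum>d\<in>T - S. 1 *\<^sub>R duals T d"
  have z: "c \<bullet> ?z = 0" "\<And>d. d \<in> T \<Longrightarrow> a d \<bullet> ?z = (if d \<in> T - S then 1 else 0)"
    using duals_sum(1)[OF T(1), of "T - S" "\<lambda>_. 1"] duals_sum(2)[OF T(1), of "T - S" _ "\<lambda>_. 1"] by auto
  have "0 \<le> a d \<bullet> ?z" if "d \<in> tight (p T)" for d
    using z(2)[of d] that tight_p[OF T(1)] by auto
  from perturb[OF p_Q[OF T(1)] z(1) this]
  obtain e where "p T + e *\<^sub>R ?z \<in> Q" "tight (p T + e *\<^sub>R ?z) = {d \<in> tight (p T). a d \<bullet> ?z = 0}"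
    by blast
  moreover have "{d \<in> tight (p T). a d \<bullet> ?z = 0} = S" using tight_p[OF T(1)] z(2) T(2) by (auto split: if_splits)
  ultimately show ?thesis by auto
qed

section \<open>Faces and their tight sets\<close>

lemma Dis_D: "S \<in> Dis \<Longrightarrow> S \<subseteq> D"
  using Dis_extend Tri_D by blast

lemma in_face_iff: "S \<subseteq> D \<Longrightarrow> x \<in> face S \<longleftrightarrow> x \<in> Q \<and> S \<subseteq> tight x"
  by (auto simp: face_def tight_def)

text \<open>The constraints in \<open>S\<close> are added up: on \<open>Q\<close> the sum attains
  its bound only where each summand does, so a single supporting hyperplane cuts out the
  face.\<close>

lemma face_face_of:
  assumes "S \<subseteq> D"
  shows "face S face_of Q"
proof -
  have fS: "finite S" using assms finite_D finite_subset by blast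
  have le: "(\<Sum>d\<in>S. a d) \<bullet> x \<ge> (\<Sum>d\<in>S. b d)" if "x \<in> Q" for x
    using that assms by (auto simp: inner_sum_left Q_def intro!: sum_mono)
  have "x \<in> face S \<longleftrightarrow> x \<in> Q \<and> (\<Sum>d\<in>S. a d) \<bullet> x = (\<Sum>d\<in>S. b d)" for x
  proof (cases "x \<in> Q")
    case True
    have "(\<Sum>d\<in>S. a d \<bullet> x - b d) = 0 \<longleftrightarrow> (\<forall>d\<in>S. a d \<bullet> x - b d = 0)"
      by (rule sum_nonneg_eq_0_iff[OF fS]) (use True assms in \<open>auto simp: Q_def\<close>)
    then show ?thesis using True by (simp add: face_def inner_sum_left sum_subtractf)
  qed (simp add: face_def)
  then have "face S = Q \<inter> {x. (\<Sum>d\<in>S. a d) \<bullet> x = (\<Sum>d\<in>S. b d)}" by auto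
  then show ?thesis using face_of_Int_supporting_hyperplane_ge[OF convex_Q le] by simp
qed

text \<open>The tight set of a relative interior point \<open>x\<close> of \<open>F\<close> is the
  right one. From any \<open>y\<close> satisfying these equations, the segment to \<open>x\<close>
  can be prolonged inside \<open>Q\<close>, so \<open>x\<close> is an inner point of it and
  \<open>y\<close> must belong to \<open>F\<close>.\<close>

lemma face_of_imp_face:
  assumes F: "F face_of Q" "F \<noteq> {}"
  shows "\<exists>S\<in>Dis. F = face S"
proof -
  have "convex F" using F(1) face_of_imp_convex by blast
  then obtain x where x: "x \<in> rel_interior F" using F(2) rel_interior_eq_empty by blast
  then have xF: "x \<in> F" using rel_interior_subset by blast
  have xQ: "x \<in> Q" and FQ: "F \<subseteq> Q" using xF F(1) face_of_imp_subset by blast+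
  let ?S = "tight x"
  have SD: "?S \<subseteq> D" by (auto simp: tight_def)
  have "F \<subseteq> face ?S"
    by (rule subset_of_face_of[OF face_face_of[OF SD] FQ]) (use x xQ SD in \<open>auto simp: in_face_iff disjnt_def\<close>)
  moreover have "face ?S \<subseteq> F"
  proof
    fix y assume y: "y \<in> face ?S"
    show "y \<in> F"
    proof (cases "y = x")
      case False
      have yQ: "y \<in> Q" using y by (auto simp: face_def)
      have z: "c \<bullet> (x - y) = 0" "\<And>d. d \<in> ?S \<Longrightarrow> a d \<bullet> (x - y) = 0"
        using y xQ by (auto simp: face_def Q_def tight_def inner_diff_right)
      obtain e where e: "e > 0" "x + e *\<^sub>R (x - y) \<in> Q" using perturb[OF xQ z(1)] z(2) by fastforce
      have "x \<in> open_segment y (x + e *\<^sub>R (x - y))"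
      proof -
        \<comment> \<open>The prolonged segment has \<open>1 + e\<close> times the length of the one
          from \<open>y\<close> to \<open>x\<close>.\<close>
        define t where "t = 1 / (1 + e)"
        have t: "0 < t" "t < 1" "t * (1 + e) = 1" using e(1) by (auto simp: t_def)
        have "(1 - t) *\<^sub>R y + t *\<^sub>R (x + e *\<^sub>R (x - y)) = (t * (1 + e)) *\<^sub>R x + (1 - t * (1 + e)) *\<^sub>R y"
          by (simp add: algebra_simps)
        then have "x = (1 - t) *\<^sub>R y + t *\<^sub>R (x + e *\<^sub>R (x - y))" using t(3) by simp
        moreover have "y \<noteq> x + e *\<^sub>R (x - y)"
        proof
          assume "y = x + e *\<^sub>R (x - y)"
          then have "(1 + e) *\<^sub>R (x - y) = 0" by (simp add: algebra_simps)
          then show False using e(1) False by simp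
        qed
        ultimately show ?thesis using t(1,2) unfolding in_segment by blast
      qed
      then show ?thesis using F(1) yQ e(2) xF by (blast dest: face_ofD)
    qed (use xF in simp)
  qed
  ultimately show ?thesis using tight_Dis[OF xQ] by blast
qed

lemma generic_point_in_face:
  assumes "S \<in> Dis"
  obtains x where "x \<in> Q" "tight x = S" "x \<in> face S"
proof -
  obtain x where "x \<in> Q" "tight x = S" using ex_generic_point[OF assms] by blast
  then show thesis using that[of x] in_face_iff[OF Dis_D[OF assms], of x] by simp
qed

lemma face_nonempty: "S \<in> Dis \<Longrightarrow> face S \<noteq> {}"
  by (erule generic_point_in_face) blast

lemma face_subset_iff:
  assumes "S \<in> Dis" "S' \<in> Dis"
  shows "face S \<subseteq> face S' \<longleftrightarrow> S' \<subseteq> S"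
proof
  obtain x where x: "tight x = S" "x \<in> face S" using generic_point_in_face[OF assms(1)] by metis
  assume "face S \<subseteq> face S'"
  then show "S' \<subseteq> S" using x in_face_iff[OF Dis_D[OF assms(2)], of x] by auto
qed (auto simp: face_def)

text \<open>Inverse to \<open>face\<close>; it will be the anti-isomorphism required by
  \<open>associahedron\<close>.\<close>

definition face_label :: "'a set \<Rightarrow> 'd set" where
  "face_label F = {d \<in> D. \<forall>x\<in>F. a d \<bullet> x = b d}"

lemma face_label_face:
  assumes "S \<in> Dis"
  shows "face_label (face S) = S"
proof -
  obtain x where x: "x \<in> face S" "tight x = S" using generic_point_in_face[OF assms] by metis
  then have "face_label (face S) \<subseteq> S" using x by (auto simp: face_label_def tight_def)
  moreover have "S \<subseteq> face_label (face S)" using Dis_D[OF assms] by (auto simp: face_label_def face_def)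
  ultimately show ?thesis by blast
qed

lemma bij_face_label: "bij_betw face_label {F. F face_of Q \<and> F \<noteq> {}} Dis"
proof (rule bij_betw_byWitness[where f' = face])
  have F: "\<exists>S\<in>Dis. F = face S \<and> face_label F = S" if "F face_of Q" "F \<noteq> {}" for F
    using face_of_imp_face[OF that] face_label_face by blast
  then show "\<forall>F\<in>{F. F face_of Q \<and> F \<noteq> {}}. face (face_label F) = F" by force
  show "\<forall>S\<in>Dis. face_label (face S) = S" using face_label_face by blast
  show "face_label ` {F. F face_of Q \<and> F \<noteq> {}} \<subseteq> Dis" using F by force
  show "face ` Dis \<subseteq> {F. F face_of Q \<and> F \<noteq> {}}" using face_face_of Dis_D face_nonempty by blast
qed

lemma face_label_antimono:
  assumes "F face_of Q" "F \<noteq> {}" "G face_of Q" "G \<noteq> {}"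
  shows "F \<subseteq> G \<longleftrightarrow> face_label G \<subseteq> face_label F"
proof -
  obtain S S' where "S \<in> Dis" "F = face S" "S' \<in> Dis" "G = face S'"
    using face_of_imp_face[OF assms(1,2)] face_of_imp_face[OF assms(3,4)] by blast
  then show ?thesis using face_label_face[of S] face_label_face[of S'] face_subset_iff[of S S'] by simp
qed

text \<open>The direction space \<open>W\<close> of the face has the dual vectors of
  \<open>T - S\<close> as a basis. That the affine hull fills \<open>x + W\<close> follows by
  perturbing a point \<open>x\<close> with tight set \<open>S\<close> in every direction of
  \<open>W\<close>.\<close>

lemma aff_dim_face:
  assumes T: "T \<in> Tri" "S \<subseteq> T"
  shows "aff_dim (face S) = int (card T) - int (card S)"
proof -
  have SD: "S \<in> Dis" using Dis_subset T by blast
  have fT: "finite T" using Tri_D[OF T(1)] finite_D finite_subset by blast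
  obtain x where x: "x \<in> Q" "tight x = S" using ex_generic_point[OF SD] by blast
  define W where "W = {y. c \<bullet> y = 0 \<and> (\<forall>d\<in>S. a d \<bullet> y = 0)}"
  have sub: "subspace W" by (auto simp: W_def subspace_def inner_add_right)
  let ?Y = "duals T ` (T - S)"
  have inj: "inj_on (duals T) (T - S)"
  proof (rule inj_onI)
    fix d e assume h: "d \<in> T - S" "e \<in> T - S" "duals T d = duals T e"
    then show "d = e" using duals(2)[of T d d] duals(2)[of T e d] T(1) by (metis DiffD1 zero_neq_one)
  qed
  have dimW: "dim W = card (T - S)"
  proof -
    have "independent ?Y"
    proof (rule independent_if_scalars_zero)
      show "finite ?Y" using fT by simp
      fix f v assume h: "(\<Sum>y\<in>?Y. f y *\<^sub>R y) = 0" "v \<in> ?Y"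
      then obtain d where d: "d \<in> T - S" "v = duals T d" by blast
      have "(\<Sum>e\<in>T - S. f (duals T e) *\<^sub>R duals T e) = 0" using h(1) by (simp add: sum.reindex[OF inj])
      then have "a d \<bullet> 0 = f (duals T d)" using duals_sum(2)[OF T(1), of "T - S" d "\<lambda>e. f (duals T e)"] d by simp
      then show "f v = 0" using d by simp
    qed
    moreover have "?Y \<subseteq> W" using duals T by (auto simp: W_def subset_iff)
    moreover have "W \<subseteq> span ?Y"
    proof
      fix y assume y: "y \<in> W"
      let ?s = "\<Sum>d\<in>T - S. (a d \<bullet> y) *\<^sub>R duals T d"
      have "y - ?s = 0"
      proof (rule determined[OF T(1)])
        show "c \<bullet> (y - ?s) = 0" using y duals_sum(1)[OF T(1), of "T - S"] by (simp add: W_def inner_diff_right)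
        fix d assume "d \<in> T"
        then show "a d \<bullet> (y - ?s) = 0" using y duals_sum(2)[OF T(1), of "T - S" d "\<lambda>d. a d \<bullet> y"]
          by (auto simp: W_def inner_diff_right)
      qed
      moreover have "?s \<in> span ?Y" by (intro span_sum span_scale span_base) auto
      ultimately show "y \<in> span ?Y" by simp
    qed
    ultimately have "dim W = card ?Y" by (metis dim_unique)
    then show ?thesis using inj by (simp add: card_image)
  qed
  have "affine hull (face S) = (+) x ` W"
  proof
    have "face S \<subseteq> (+) x ` W"
    proof
      fix z assume z: "z \<in> face S"
      have "z - x \<in> W" using z x by (auto simp: W_def face_def Q_def tight_def inner_diff_right)
      then show "z \<in> (+) x ` W" by (intro image_eqI[of _ _ "z - x"]) auto
    qed
    moreover have "affine ((+) x ` W)" using sub subspace_imp_affine affine_translation by blast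
    ultimately show "affine hull (face S) \<subseteq> (+) x ` W" by (rule hull_minimal)
    show "(+) x ` W \<subseteq> affine hull (face S)"
    proof
      fix z assume "z \<in> (+) x ` W"
      then obtain w where w: "w \<in> W" "z = x + w" by blast
      obtain e where e: "e > 0" "x + e *\<^sub>R w \<in> Q" "tight (x + e *\<^sub>R w) = {d \<in> tight x. a d \<bullet> w = 0}"
        using perturb[OF x(1), of w] w x by (auto simp: W_def)
      then have "x + e *\<^sub>R w \<in> face S" "x \<in> face S"
        using w(1) x in_face_iff[OF Dis_D[OF SD]] by (auto simp: W_def)
      \<comment> \<open>The target lies on the line through \<open>x\<close> and the nearby point;
        for \<open>e < 1\<close> the first coefficient is negative, so only affine, not convex,
        combinations serve.\<close>
      then have "(1 - 1 / e) *\<^sub>R x + (1 / e) *\<^sub>R (x + e *\<^sub>R w) \<in> affine hull (face S)"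
        by (intro mem_affine[OF affine_affine_hull]) (auto intro: hull_inc)
      moreover have "(1 - 1 / e) *\<^sub>R x + (1 / e) *\<^sub>R (x + e *\<^sub>R w) = z"
        using e(1) w(2) by (simp add: algebra_simps)
      ultimately show "z \<in> affine hull (face S)" by simp
    qed
  qed
  then have "aff_dim (face S) = aff_dim ((+) x ` W)" by (metis aff_dim_affine_hull)
  also have "\<dots> = int (card (T - S))" using sub dimW by (simp add: aff_dim_translation_eq aff_dim_subspace)
  finally show ?thesis using T(2) fT card_mono[OF fT T(2)] by (simp add: card_Diff_subset finite_subset of_nat_diff)
qed

section \<open>Dimension, vertices and facets\<close>

lemma face_empty: "face {} = Q"
  by (simp add: face_def)

text \<open>A point without tight constraints can be moved in all directions of the hyperplane, so
  \<open>Q\<close> spans it. Comparison with \<open>aff_dim_face\<close> for the empty set gives the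
  number of diagonals without counting them in the polygon.\<close>

lemma card_Tri:
  assumes T: "T \<in> Tri"
  shows "card T = DIM('a) - 1"
proof -
  have fT: "finite T" using Tri_D[OF T] finite_D finite_subset by blast
  obtain x where x: "x \<in> Q" "tight x = {}" using ex_generic_point[OF Dis_subset[OF T]] by blast
  have "{x. c \<bullet> x = c0} \<subseteq> affine hull Q"
  proof
    fix z assume z: "z \<in> {x. c \<bullet> x = c0}"
    have "c \<bullet> (z - x) = 0" using z x by (auto simp: Q_def inner_diff_right)
    from perturb[OF x(1) this] x(2) obtain e where e: "e > 0" "x + e *\<^sub>R (z - x) \<in> Q" by blast
    then have "(1 - 1 / e) *\<^sub>R x + (1 / e) *\<^sub>R (x + e *\<^sub>R (z - x)) \<in> affine hull Q"
      using x(1) by (intro mem_affine[OF affine_affine_hull]) (auto intro: hull_inc)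
    moreover have "(1 - 1 / e) *\<^sub>R x + (1 / e) *\<^sub>R (x + e *\<^sub>R (z - x)) = z"
      using e(1) by (simp add: algebra_simps)
    ultimately show "z \<in> affine hull Q" by simp
  qed
  moreover have "affine hull Q \<subseteq> {x. c \<bullet> x = c0}"
    by (rule hull_minimal) (auto simp: Q_def affine_hyperplane)
  ultimately have "aff_dim Q = aff_dim {x. c \<bullet> x = c0}" by (metis aff_dim_affine_hull subset_antisym)
  also have "\<dots> = int DIM('a) - 1" using c_nonzero by (simp add: aff_dim_hyperplane)
  finally show ?thesis using aff_dim_face[OF T, of "{}"] face_empty by simp
qed

lemma aff_dim_Q: "aff_dim Q = int (DIM('a) - 1)"
  using Tri_nonempty aff_dim_face[of _ "{}"] card_Tri face_empty by fastforce

text \<open>A vertex is a face of dimension zero, so by the dimension formula its tight set is as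
  large as any member of \<open>Tri\<close> containing it.\<close>

lemma extreme_point:
  assumes "v extreme_point_of Q"
  shows "\<exists>T\<in>Tri. v = p T"
proof -
  have "{v} face_of Q" using assms face_of_singleton by blast
  then obtain S where S: "S \<in> Dis" "{v} = face S" using face_of_imp_face by blast
  obtain T where T: "T \<in> Tri" "S \<subseteq> T" using Dis_extend[OF S(1)] by blast
  have fT: "finite T" using Tri_D[OF T(1)] finite_D finite_subset by blast
  have "card T = card S" using aff_dim_face[OF T] S(2) by (metis aff_dim_sing diff_eq_eq add_0 of_nat_eq_iff)
  then have "S = T" using card_subset_eq[OF fT T(2)] by simp
  then have "p T \<in> face S" using in_face_iff[OF Tri_D[OF T(1)]] p_Q tight_p T(1) by auto
  then show ?thesis using S(2) T(1) by auto
qed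

lemma Q_eq_convex_hull: "Q = convex hull (p ` Tri)"
proof
  have "Q = convex hull {v. v extreme_point_of Q}"
    using Krein_Milman_Minkowski polytope_imp_compact[OF polytope_Q] convex_Q by blast
  also have "\<dots> \<subseteq> convex hull (p ` Tri)" using extreme_point by (intro hull_mono) blast
  finally show "Q \<subseteq> convex hull (p ` Tri)" .
  show "convex hull (p ` Tri) \<subseteq> Q" using p_Q convex_Q by (intro hull_minimal) auto
qed

text \<open>By the dimension formula a facet has a tight set with one element, so the facets through
  \<open>p T\<close> correspond to the elements of \<open>T\<close>.\<close>

lemma simple_polytope_Q: "simple_polytope Q"
  unfolding simple_polytope_def
proof (intro conjI ballI)
  fix v assume "v \<in> verts Q"
  then obtain T where T: "T \<in> Tri" "v = p T" using extreme_point by (auto simp: verts_def)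
  have v: "v \<in> Q" "tight v = T" using p_Q tight_p T by auto
  have "F facet_of Q \<and> v \<in> F \<longleftrightarrow> F \<in> (\<lambda>d. face {d}) ` T" for F
  proof
    assume F: "F facet_of Q \<and> v \<in> F"
    then obtain S where S: "S \<in> Dis" "F = face S"
      using face_of_imp_face unfolding facet_of_def by blast
    obtain T' where T': "T' \<in> Tri" "S \<subseteq> T'" using Dis_extend[OF S(1)] by blast
    have "aff_dim F = aff_dim Q - 1" using F by (simp add: facet_of_def)
    moreover have "aff_dim F = aff_dim Q - int (card S)"
      using aff_dim_face[OF T'] aff_dim_face[OF T'(1), of "{}"] S(2) face_empty by simp
    ultimately have "card S = 1" by simp
    then obtain d where d: "S = {d}" using card_1_singletonE by blast
    have "d \<in> T" using F S(2) d v in_face_iff[OF Dis_D[OF S(1)]] by auto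
    then show "F \<in> (\<lambda>d. face {d}) ` T" using S(2) d by blast
  next
    assume "F \<in> (\<lambda>d. face {d}) ` T"
    then obtain d where d: "d \<in> T" "F = face {d}" by blast
    have dis: "{d} \<in> Dis" using Dis_subset[OF T(1)] d(1) by blast
    have "aff_dim F = aff_dim Q - 1"
      using aff_dim_face[OF T(1), of "{d}"] aff_dim_face[OF T(1), of "{}"] d face_empty by simp
    then show "F facet_of Q \<and> v \<in> F"
      using d v face_face_of[OF Dis_D[OF dis]] face_nonempty[OF dis] in_face_iff[OF Dis_D[OF dis]]
      by (auto simp: facet_of_def)
  qed
  then have "{F. F facet_of Q \<and> v \<in> F} = (\<lambda>d. face {d}) ` T" by blast
  moreover have "inj_on (\<lambda>d. face {d}) T"
  proof (rule inj_onI)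
    fix d e assume "d \<in> T" "e \<in> T" "face {d} = face {e}"
    then have "{d} = {e}" using face_label_face Dis_subset[OF T(1)] by (metis empty_subsetI insert_subset)
    then show "d = e" by simp
  qed
  ultimately show "int (card {F. F facet_of Q \<and> v \<in> F}) = aff_dim Q"
    using aff_dim_Q card_Tri[OF T(1)] by (simp add: card_image)
qed (rule polytope_Q)

end

section \<open>Convex polygons with labelled vertices\<close>

text \<open>Twice the signed area of the triangle, positive if its corners run
  counterclockwise.\<close>

definition orient :: "real^2 \<Rightarrow> real^2 \<Rightarrow> real^2 \<Rightarrow> real" where
  "orient a b c = (b $ 1 - a $ 1) * (c $ 2 - a $ 2) - (b $ 2 - a $ 2) * (c $ 1 - a $ 1)"

lemma orient_rot: "orient a b c = orient b c a"
  by (simp add: orient_def algebra_simps)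

lemma orient_swap: "orient a b c = - orient b a c"
  by (simp add: orient_def algebra_simps)

lemma orient_same [simp]: "orient a b a = 0" "orient a b b = 0" "orient a a b = 0"
  by (simp_all add: orient_def)

lemma orient_convex: "orient a b ((1 - t) *\<^sub>R c + t *\<^sub>R d) = (1 - t) * orient a b c + t * orient a b d"
  by (simp add: orient_def algebra_simps)

lemma orient_inner: "orient a b z = vector [- (b $ 2 - a $ 2), b $ 1 - a $ 1] \<bullet> z - vector [- (b $ 2 - a $ 2), b $ 1 - a $ 1] \<bullet> a"
  by (simp add: orient_def inner_vec_def sum_2 algebra_simps)

lemma vec2_eqI: "x $ 1 = y $ 1 \<Longrightarrow> x $ 2 = y $ 2 \<Longrightarrow> x = (y :: real^2)"
  by (simp add: vec_eq_iff forall_2)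

lemma strictly_below_line:
  assumes "a $ 1 < b $ 1"
  shows "strictly_below z (affine hull closed_segment a b) \<longleftrightarrow> orient a b z < 0"
    and "strictly_above z (affine hull closed_segment a b) \<longleftrightarrow> orient a b z > 0"
proof -
  have 0: "affine hull closed_segment a b = range (\<lambda>u. a + u *\<^sub>R (b - a))"
    by (simp add: affine_hull_2_alt)
  define u where "u = (z $ 1 - a $ 1) / (b $ 1 - a $ 1)"
  have u: "a $ 1 + v * (b $ 1 - a $ 1) = z $ 1 \<longleftrightarrow> v = u" for v
    using assms by (auto simp: u_def field_simps)
  have e: "orient a b z = (b $ 1 - a $ 1) * (z $ 2 - (a $ 2 + u * (b $ 2 - a $ 2)))"
    using assms by (simp add: u_def orient_def field_simps)
  have *: "z $ 2 < a $ 2 + u * (b $ 2 - a $ 2) \<longleftrightarrow> orient a b z < 0"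
     "z $ 2 > a $ 2 + u * (b $ 2 - a $ 2) \<longleftrightarrow> orient a b z > 0"
    unfolding e using assms by (auto simp: mult_less_0_iff zero_less_mult_iff)
  show "strictly_below z (affine hull closed_segment a b) \<longleftrightarrow> orient a b z < 0"
    "strictly_above z (affine hull closed_segment a b) \<longleftrightarrow> orient a b z > 0"
    unfolding strictly_below_def strictly_above_def 0 using u * by auto
qed

lemma segments_meet:
  assumes "orient a b c < 0" "0 < orient a b d" "orient c d a < 0 \<and> 0 < orient c d b \<or> orient c d b < 0 \<and> 0 < orient c d a"
  shows "open_segment a b \<inter> open_segment c d \<noteq> {}"
proof -
  define A B C D where "A = orient c d a" and "B = orient c d b" and "C = orient a b c" and "D = orient a b d"
  have BA: "B - A = C - D" unfolding A_def B_def C_def D_def orient_def by (simp add: algebra_simps)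
  have s: "A < 0 \<and> 0 < B \<or> B < 0 \<and> 0 < A" "C < 0" "0 < D" using assms by (auto simp: A_def B_def C_def D_def)
  have ne: "a \<noteq> b" "c \<noteq> d" using assms by auto
  \<comment> \<open>The meeting point divides each segment in the ratio of the signed distances of
    its ends from the other line.\<close>
  define t u where "t = A / (A - B)" and "u = C / (C - D)"
  have "0 < t \<and> t < 1" using s(1) unfolding t_def
    by (elim disjE) (auto simp: zero_less_divide_iff divide_less_eq_1)
  moreover have "0 < u \<and> u < 1" using s(2,3) unfolding u_def
    by (auto simp: zero_less_divide_iff divide_less_eq_1)
  moreover have "(1 - t) *\<^sub>R a + t *\<^sub>R b = (1 - u) *\<^sub>R c + u *\<^sub>R d"
  proof -
    have e: "C - D \<noteq> 0" "A - B = - (C - D)" using s(2,3) BA by linarith+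
    \<comment> \<open>Multiplying by \<open>k\<close> clears both denominators at once, as
      \<open>A - B\<close> and \<open>C - D\<close> differ only in sign; a polynomial identity
      remains.\<close>
    define k where "k = C - D"
    have k: "k \<noteq> 0" "A - B = - k" "B = k + A" using e BA by (auto simp: k_def)
    have kt: "k * t = - A" unfolding t_def k(2) using k(1) by simp
    then have kt': "k * (1 - t) = B" using k(3) by (simp add: right_diff_distrib)
    have ku: "k * u = C" unfolding u_def k_def[symmetric] using k(1) by simp
    then have ku': "k * (1 - u) = - D" by (simp add: right_diff_distrib k_def)
    have "((1 - t) *\<^sub>R a + t *\<^sub>R b) $ i = ((1 - u) *\<^sub>R c + u *\<^sub>R d) $ i" for i
    proof -
      have "k * (((1 - t) *\<^sub>R a + t *\<^sub>R b) $ i) = (k * (1 - t)) * a $ i + (k * t) * b $ i"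
        by (simp add: distrib_left)
      also have "\<dots> = B * a $ i - A * b $ i" unfolding kt kt' by simp
      also have "\<dots> = C * d $ i - D * c $ i"
        using exhaust_2[of i] unfolding A_def B_def C_def D_def orient_def by (elim disjE) (simp_all add: algebra_simps)
      also have "\<dots> = (k * (1 - u)) * c $ i + (k * u) * d $ i" unfolding ku ku' by simp
      also have "\<dots> = k * (((1 - u) *\<^sub>R c + u *\<^sub>R d) $ i)" by (simp add: distrib_left)
      finally show ?thesis using k(1) by simp
    qed
    then show ?thesis by (simp add: vec_eq_iff)
  qed
  ultimately have "(1 - t) *\<^sub>R a + t *\<^sub>R b \<in> open_segment a b" "(1 - t) *\<^sub>R a + t *\<^sub>R b \<in> open_segment c d"
    using ne unfolding in_segment by blast+
  then show ?thesis by blast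
qed

locale polygon =
  fixes n :: nat and P :: "(real^2) set"
  assumes n1: "1 \<le> n" and polygon: "convex_polygon (n + 3) P" and generic: "inj_on (\<lambda>v. v $ 1) (verts P)"
begin

abbreviation V :: "(real^2) set" where "V \<equiv> verts P"

definition vx :: "nat \<Rightarrow> real^2" where "vx = inv_into V (vlabel P)"

section \<open>Vertices, labels and the two hulls\<close>

lemma finite_V: "finite V" and card_V: "card V = n + 3"
  using polygon by (auto simp: convex_polygon_def intro: card_ge_0_finite)

lemma polytope_P: "polytope P"
  using polygon by (simp add: convex_polygon_def)

lemma convex_P: "convex P" and compact_P: "compact P"
  using polytope_P polytope_imp_convex polytope_imp_compact by blast+

lemma P_hull: "P = convex hull V"
  using Krein_Milman_Minkowski[OF compact_P convex_P] by (simp add: verts_def)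

lemma V_P: "V \<subseteq> P"
  by (auto simp: verts_def extreme_point_of_def)

lemma vlabel_mono:
  assumes "v \<in> V" "w \<in> V" "v $ 1 < w $ 1"
  shows "vlabel P v < vlabel P w"
  unfolding vlabel_def by (rule psubset_card_mono) (use finite_V assms in auto)

lemma vlabel_less_iff: "v \<in> V \<Longrightarrow> w \<in> V \<Longrightarrow> vlabel P v < vlabel P w \<longleftrightarrow> v $ 1 < w $ 1"
  using vlabel_mono[of v w] vlabel_mono[of w v] generic
  by (metis inj_on_def less_asym less_irrefl linorder_neqE)

lemma vlabel_bij: "bij_betw (vlabel P) V {..n + 2}"
proof -
  have inj: "inj_on (vlabel P) V"
    using vlabel_less_iff generic unfolding inj_on_def by (metis less_irrefl linorder_neqE)
  have "vlabel P v \<le> n + 2" if "v \<in> V" for v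
  proof -
    have "vlabel P v < card V" unfolding vlabel_def by (rule psubset_card_mono) (use finite_V that in auto)
    then show ?thesis using card_V by simp
  qed
  then have "vlabel P ` V = {..n + 2}"
    using inj card_V by (intro card_subset_eq) (auto simp: card_image)
  then show ?thesis using inj by (simp add: bij_betw_def)
qed

lemma vx_V: "i \<le> n + 2 \<Longrightarrow> vx i \<in> V"
  using vlabel_bij inv_into_into[of i "vlabel P" V] by (simp add: vx_def bij_betw_def)

lemma vlabel_vx: "i \<le> n + 2 \<Longrightarrow> vlabel P (vx i) = i"
  using vlabel_bij by (simp add: vx_def bij_betw_inv_into_right)

lemma vx_vlabel: "v \<in> V \<Longrightarrow> vx (vlabel P v) = v" "v \<in> V \<Longrightarrow> vlabel P v \<le> n + 2"
  using vlabel_bij by (auto simp: vx_def bij_betw_inv_into_left bij_betw_def)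

lemma V_iff: "v \<in> V \<longleftrightarrow> (\<exists>i\<le>n + 2. v = vx i)"
  using vx_V vx_vlabel by metis

lemma vx_less_iff: "i \<le> n + 2 \<Longrightarrow> k \<le> n + 2 \<Longrightarrow> vx i $ 1 < vx k $ 1 \<longleftrightarrow> i < k"
  using vlabel_less_iff[OF vx_V vx_V] vlabel_vx by simp

lemma vx_eq_iff: "i \<le> n + 2 \<Longrightarrow> k \<le> n + 2 \<Longrightarrow> vx i = vx k \<longleftrightarrow> i = k"
  using vlabel_vx by metis

abbreviation O3 :: "nat \<Rightarrow> nat \<Rightarrow> nat \<Rightarrow> real" where "O3 a b c \<equiv> orient (vx a) (vx b) (vx c)"

lemma vertex_not_between:
  assumes "v \<in> V" "x \<in> P" "y \<in> P"
  shows "v \<notin> open_segment x y"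
  using assms by (auto simp: verts_def extreme_point_of_def)

text \<open>Compare \<open>vx j\<close> with the point \<open>q\<close> of the chord on the same
  vertical line. A point of \<open>P\<close> on the other side of \<open>vx j\<close> would place
  this vertex inside a segment ending at \<open>q\<close>, against extremality.\<close>

lemma hull_test:
  assumes "i < j" "j < k" "k \<le> n + 2"
  shows "O3 i j k > 0 \<and> vx j \<in> lower_hull P \<and> vx j \<notin> upper_hull P \<or>
         O3 i j k < 0 \<and> vx j \<notin> lower_hull P \<and> vx j \<in> upper_hull P"
proof -
  have x: "vx i $ 1 < vx j $ 1" "vx j $ 1 < vx k $ 1" using vx_less_iff assms by auto
  have PV: "vx i \<in> P" "vx j \<in> P" "vx k \<in> P" "vx j \<in> V" using vx_V V_P assms by auto
  define t where "t = (vx j $ 1 - vx i $ 1) / (vx k $ 1 - vx i $ 1)"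
  define q where "q = (1 - t) *\<^sub>R vx i + t *\<^sub>R vx k"
  have t: "0 < t" "t < 1" using x by (auto simp: t_def)
  have q1: "q $ 1 = vx j $ 1"
  proof -
    have "q $ 1 = vx i $ 1 + t * (vx k $ 1 - vx i $ 1)" by (simp add: q_def algebra_simps)
    then show ?thesis using x by (simp add: t_def)
  qed
  have qo: "q \<in> open_segment (vx i) (vx k)" using t x unfolding in_segment q_def by auto
  have qP: "q \<in> P" unfolding q_def using convex_P PV t by (simp add: convex_alt)
  have "q \<noteq> vx j" using vertex_not_between[OF PV(4,1,3)] qo by blast
  then have q2: "q $ 2 \<noteq> vx j $ 2" using q1 vec2_eqI by blast
  have "O3 i j k = (vx k $ 1 - vx i $ 1) * (q $ 2 - vx j $ 2)"
  proof -
    have "t * (vx k $ 1 - vx i $ 1) = vx j $ 1 - vx i $ 1" using x by (simp add: t_def)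
    moreover have "(vx k $ 1 - vx i $ 1) * (q $ 2 - vx j $ 2) =
      (vx k $ 1 - vx i $ 1) * (vx i $ 2 - vx j $ 2) + (t * (vx k $ 1 - vx i $ 1)) * (vx k $ 2 - vx i $ 2)"
      by (simp add: q_def algebra_simps)
    ultimately have w: "(vx k $ 1 - vx i $ 1) * (q $ 2 - vx j $ 2) =
      (vx k $ 1 - vx i $ 1) * (vx i $ 2 - vx j $ 2) + (vx j $ 1 - vx i $ 1) * (vx k $ 2 - vx i $ 2)" by simp
    show ?thesis unfolding w orient_def by (simp add: algebra_simps)
  qed
  then have o: "O3 i j k > 0 \<longleftrightarrow> vx j $ 2 < q $ 2" "O3 i j k < 0 \<longleftrightarrow> q $ 2 < vx j $ 2"
    using x by (auto simp: zero_less_mult_iff mult_less_0_iff)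
  have between: "vx j \<in> open_segment y z"
    if h: "y $ 1 = vx j $ 1" "z $ 1 = vx j $ 1" "y $ 2 < vx j $ 2" "vx j $ 2 < z $ 2" for y z
  proof -
    define s where "s = (vx j $ 2 - y $ 2) / (z $ 2 - y $ 2)"
    have s: "0 < s" "s < 1" using h by (auto simp: s_def)
    have "y $ 2 + s * (z $ 2 - y $ 2) = vx j $ 2" using h by (simp add: s_def)
    then have "vx j = (1 - s) *\<^sub>R y + s *\<^sub>R z"
      using h(1,2) by (intro vec2_eqI) (auto simp: algebra_simps)
    moreover have "y \<noteq> z" using h(3,4) by auto
    ultimately show ?thesis using s unfolding in_segment by blast
  qed
  have lo: "vx j \<in> lower_hull P" if "vx j $ 2 < q $ 2"
  proof (rule ccontr)
    assume "vx j \<notin> lower_hull P"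
    then obtain y where "y \<in> P" "y $ 1 = vx j $ 1" "y $ 2 < vx j $ 2" using PV(2) by (auto simp: lower_hull_def not_le)
    then show False using between[of y q] q1 that vertex_not_between[OF PV(4) _ qP] by blast
  qed
  have up: "vx j \<in> upper_hull P" if "q $ 2 < vx j $ 2"
  proof (rule ccontr)
    assume "vx j \<notin> upper_hull P"
    then obtain y where "y \<in> P" "y $ 1 = vx j $ 1" "vx j $ 2 < y $ 2" using PV(2) by (auto simp: upper_hull_def not_le)
    then show False using between[of q y] q1 that vertex_not_between[OF PV(4) qP] by blast
  qed
  have "vx j \<notin> upper_hull P" if "vx j $ 2 < q $ 2" using that qP q1 by (auto simp: upper_hull_def not_le)
  moreover have "vx j \<notin> lower_hull P" if "q $ 2 < vx j $ 2" using that qP q1 by (auto simp: lower_hull_def not_le)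
  ultimately show ?thesis using o q2 lo up by linarith
qed

abbreviation U :: "nat set" where "U \<equiv> up_labels n P"

lemma U_iff: "j \<in> {1..n+1} \<Longrightarrow> j \<in> U \<longleftrightarrow> vx j \<in> upper_hull P"
  using vx_V[of j] vlabel_vx[of j] vx_vlabel by (auto simp: up_labels_def image_iff intro!: bexI[of _ "vx j"])

lemma D_iff: "j \<in> down_labels n P \<longleftrightarrow> j \<in> {1..n+1} \<and> j \<notin> U"
proof (cases "j \<in> {1..n+1}")
  case True
  then have "j \<in> down_labels n P \<longleftrightarrow> vx j \<in> lower_hull P"
    using vx_V[of j] vlabel_vx[of j] vx_vlabel by (auto simp: down_labels_def image_iff intro!: bexI[of _ "vx j"])
  then show ?thesis using hull_test[of 0 j "n + 2"] U_iff True by auto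
qed (auto simp: down_labels_def)

sublocale labels "n + 2" U
  by unfold_locales (auto simp: up_labels_def)

text \<open>The bridge from geometry to labels. On increasing triples both sides are decided by the
  hull of the middle vertex; the other orders follow by rotation and antisymmetry.\<close>

lemma O3_ccw_pos: "\<lbrakk>a \<le> n + 2; b \<le> n + 2; c \<le> n + 2\<rbrakk> \<Longrightarrow> ccw a b c \<longleftrightarrow> O3 a b c > 0"
proof -
  have s: "O3 i j k \<noteq> 0 \<and> (ccw i j k \<longleftrightarrow> O3 i j k > 0) \<and> (ccw i k j \<longleftrightarrow> O3 i j k < 0)" if "i < j" "j < k" "k \<le> n + 2" for i j k
    using hull_test[OF that] ccw_sorted[OF that] U_iff[of j] that by auto
  assume b: "a \<le> n + 2" "b \<le> n + 2" "c \<le> n + 2"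
  have flip: "O3 x z y = - O3 x y z" for x y z by (simp add: orient_def algebra_simps)
  show ?thesis
  proof (cases "a = b \<or> b = c \<or> a = c")
    case True
    then show ?thesis using ccw_distinct[of a b c] by auto
  next
    case False
    then consider "a < b" "b < c" | "a < c" "c < b" | "b < a" "a < c" | "b < c" "c < a" | "c < a" "a < b" | "c < b" "b < a"
      by linarith
    then show ?thesis
    proof cases
      case 1 then show ?thesis using s[of a b c] b by auto
    next
      case 2 then show ?thesis using s[of a c b] flip[of a c b] b by auto
    next
      case 3 then show ?thesis using s[of b a c] flip[of b a c] orient_rot[of "vx a" "vx b" "vx c"] ccw_rot[of a b c] b by auto
    next
      case 4 then show ?thesis using s[of b c a] orient_rot[of "vx a" "vx b" "vx c"] ccw_rot[of a b c] b by auto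
    next
      case 5 then show ?thesis using s[of c a b] orient_rot[of "vx c" "vx a" "vx b"] ccw_rot[of c a b] b by auto
    next
      case 6 then show ?thesis using s[of c b a] flip[of c b a] orient_rot[of "vx c" "vx a" "vx b"] ccw_rot[of c a b] b by auto
    qed
  qed
qed

lemma O3_ccw:
  assumes "a \<le> n + 2" "b \<le> n + 2" "s \<le> n + 2"
  shows "ccw a s b \<longleftrightarrow> O3 a b s < 0" "ccw b s a \<longleftrightarrow> O3 a b s > 0"
proof -
  have "O3 a s b = - O3 a b s" "O3 b s a = O3 a b s" by (simp_all add: orient_def algebra_simps)
  then show "ccw a s b \<longleftrightarrow> O3 a b s < 0" "ccw b s a \<longleftrightarrow> O3 a b s > 0" using O3_ccw_pos assms by auto
qed

lemma O3_nonzero: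
  assumes "a \<le> n + 2" "b \<le> n + 2" "s \<le> n + 2" "a \<noteq> b" "s \<noteq> a" "s \<noteq> b"
  shows "O3 a b s \<noteq> 0"
  using O3_ccw[OF assms(1-3)] ccw_total[of a s b] ccw_rot[of b s a] ccw_rot[of s a b] assms by fastforce

section \<open>Diagonals as segments between labelled vertices\<close>

definition sg :: "nat \<Rightarrow> nat \<Rightarrow> (real^2) set" where
  "sg a b = closed_segment (vx a) (vx b)"

lemma sg_commute: "sg a b = sg b a"
  by (simp add: sg_def closed_segment_commute)

lemma sg_eq_iff:
  "\<lbrakk>a \<le> n + 2; b \<le> n + 2; c \<le> n + 2; d \<le> n + 2\<rbrakk> \<Longrightarrow> sg a b = sg c d \<longleftrightarrow> {a, b} = {c, d}"
  using vx_eq_iff by (auto simp: sg_def doubleton_eq_iff)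

lemma vx_in_sg:
  assumes "a \<le> n + 2" "b \<le> n + 2" "s \<le> n + 2"
  shows "vx s \<in> sg a b \<longleftrightarrow> s = a \<or> s = b"
proof
  assume "vx s \<in> sg a b"
  moreover have "vx s \<notin> open_segment (vx a) (vx b)" using vertex_not_between vx_V V_P assms by blast
  ultimately have "vx s = vx a \<or> vx s = vx b" by (auto simp: sg_def open_segment_def)
  then show "s = a \<or> s = b" using vx_eq_iff assms by blast
qed (auto simp: sg_def)

lemma below_sg:
  assumes "a < b" "b \<le> n + 2" "s \<le> n + 2"
  shows "strictly_below (vx s) (affine hull sg a b) \<longleftrightarrow> ccw a s b"
    and "strictly_above (vx s) (affine hull sg a b) \<longleftrightarrow> ccw b s a"
  using strictly_below_line[of "vx a" "vx b" "vx s"] vx_less_iff[of a b] O3_ccw[of a b s] assms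
  by (auto simp: sg_def)

lemma diagonals_eq: "diagonals P = {sg a b | a b. a < b \<and> b \<le> n + 2}"
proof -
  have "\<exists>a b. \<delta> = sg a b \<and> a < b \<and> b \<le> n + 2" if "\<delta> \<in> diagonals P" for \<delta>
  proof -
    from that obtain x y where "\<delta> = closed_segment x y" "x \<in> V" "y \<in> V" "x \<noteq> y" by (auto simp: diagonals_def)
    then obtain i k where ik: "i \<le> n + 2" "k \<le> n + 2" "\<delta> = sg i k" "i \<noteq> k" using V_iff by (auto simp: sg_def)
    then show ?thesis using sg_commute by (metis linorder_neqE_nat)
  qed
  moreover have "sg a b \<in> diagonals P" if "a < b" "b \<le> n + 2" for a b
    using that vx_V[of a] vx_V[of b] vx_eq_iff[of a b] by (auto simp: diagonals_def sg_def)
  ultimately show ?thesis by blast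
qed

lemma B_labels_sg:
  assumes "a < b" "b \<le> n + 2"
  shows "B_labels n P (sg a b) = BB a b"
proof -
  have "j \<in> B_labels n P (sg a b) \<longleftrightarrow> j \<in> BB a b" for j
  proof (cases "1 \<le> j \<and> j \<le> n + 1")
    case True
    have "(\<exists>v\<in>V. vlabel P v = j \<and> Q v) \<longleftrightarrow> Q (vx j)" for Q
      using True vx_V[of j] vlabel_vx[of j] vx_vlabel by auto
    then have "j \<in> B_labels n P (sg a b) \<longleftrightarrow>
      strictly_below (vx j) (affine hull sg a b) \<or> vx j \<in> sg a b \<and> j \<in> U"
      using True by (simp add: B_labels_def)
    moreover have "strictly_below (vx j) (affine hull sg a b) \<longleftrightarrow> ccw a j b"
      using below_sg(1)[OF assms, of j] True by simp
    moreover have "vx j \<in> sg a b \<longleftrightarrow> j = a \<or> j = b" using vx_in_sg[of a b j] True assms by simp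
    ultimately show ?thesis using BB_iff[OF assms, of j] True by simp
  next
    case False
    then show ?thesis using BB_sub[of a b] by (auto simp: B_labels_def)
  qed
  then show ?thesis by blast
qed

text \<open>A common point lies on the line of \<open>a b\<close>, where \<open>orient\<close>
  vanishes; being an inner point of \<open>c d\<close>, it forces opposite signs at \<open>c\<close>
  and \<open>d\<close>, unless both vanish and the two segments coincide. The converse is
  \<open>segments_meet\<close>.\<close>

lemma crossing_sg:
  assumes b: "a \<le> n + 2" "b \<le> n + 2" "c \<le> n + 2" "d \<le> n + 2" "a \<noteq> b" "c \<noteq> d"
  shows "crossing (sg a b) (sg c d) \<longleftrightarrow> crosses a b c d"
proof -
  have ri: "rel_interior (sg a b) = open_segment (vx a) (vx b)" "rel_interior (sg c d) = open_segment (vx c) (vx d)"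
    using b vx_eq_iff by (auto simp: sg_def rel_interior_closed_segment)
  have xO: "crosses a b c d \<longleftrightarrow> O3 a b c < 0 \<and> 0 < O3 a b d \<or> O3 a b d < 0 \<and> 0 < O3 a b c"
    unfolding crosses_def using O3_ccw[of a b] b by auto
  show ?thesis
  proof
    assume x: "crosses a b c d"
    then have "crosses c d a b" using crosses_sym by blast
    then have "O3 c d a < 0 \<and> 0 < O3 c d b \<or> O3 c d b < 0 \<and> 0 < O3 c d a"
      unfolding crosses_def using O3_ccw[of c d] b by auto
    moreover have "orient (vx d) (vx c) v = - O3 c d v'" if "v = vx v'" for v v' using that orient_swap by blast
    ultimately have "open_segment (vx a) (vx b) \<inter> open_segment (vx c) (vx d) \<noteq> {}"
      using segments_meet[of "vx a" "vx b" "vx c" "vx d"] segments_meet[of "vx a" "vx b" "vx d" "vx c"] x xO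
      by (auto simp: open_segment_commute)
    moreover have "sg a b \<noteq> sg c d"
      using sg_eq_iff[OF b(1-4)] x ccw_distinct unfolding crosses_def by (auto simp: doubleton_eq_iff)
    ultimately show "crossing (sg a b) (sg c d)" unfolding crossing_def ri by blast
  next
    assume "crossing (sg a b) (sg c d)"
    then obtain z where z: "z \<in> open_segment (vx a) (vx b)" "z \<in> open_segment (vx c) (vx d)" and ne: "sg a b \<noteq> sg c d"
      unfolding crossing_def ri by blast
    obtain s where "z = (1 - s) *\<^sub>R vx a + s *\<^sub>R vx b" using z(1) by (auto simp: in_segment)
    then have z0: "orient (vx a) (vx b) z = 0" by (simp add: orient_convex)
    obtain t where t: "0 < t" "t < 1" "z = (1 - t) *\<^sub>R vx c + t *\<^sub>R vx d" using z(2) by (auto simp: in_segment)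
    have e: "(1 - t) * O3 a b c + t * O3 a b d = 0" using z0 unfolding t(3) orient_convex .
    have "\<not> (O3 a b c = 0 \<and> O3 a b d = 0)"
    proof
      assume "O3 a b c = 0 \<and> O3 a b d = 0"
      then have "{c, d} = {a, b}" using O3_nonzero[of a b c] O3_nonzero[of a b d] b by auto
      then show False using ne sg_eq_iff[OF b(1-4)] by simp
    qed
    then show "crosses a b c d" unfolding xO using e t(1,2)
      by (smt (verit) mult_pos_pos mult_pos_neg mult_eq_0_iff)
  qed
qed

end

text \<open>Keeps the locale parameter \<open>n + 2\<close> of the constants from \<open>labels\<close> in this form under simplification.\<close>

declare add_2_eq_Suc [simp del] add_2_eq_Suc' [simp del]

context polygon
begin

section \<open>Edges of the polygon\<close>

lemma edge_ends:
  assumes "\<delta> edge_of P"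
  obtains a b where "\<delta> = sg a b" "a < b" "b \<le> n + 2"
proof -
  have f: "\<delta> face_of P" "aff_dim \<delta> = 1" using assms by (auto simp: edge_of_def)
  have "compact \<delta>" "convex \<delta>" using f(1) compact_P convex_P face_of_imp_compact face_of_imp_convex by blast+
  moreover have "\<delta> \<noteq> {}" using f(2) by auto
  moreover have "collinear \<delta>" using f(2) by (simp add: collinear_aff_dim)
  ultimately obtain x y where xy: "\<delta> = closed_segment x y" using compact_convex_collinear_segment by blast
  have ne: "x \<noteq> y" using f(2) xy by auto
  have "x extreme_point_of \<delta>" "y extreme_point_of \<delta>" using xy extreme_point_of_segment by auto
  then have "x \<in> V" "y \<in> V" using extreme_point_of_face[OF f(1)] by (auto simp: verts_def)
  then have "\<delta> \<in> diagonals P" using xy ne by (auto simp: diagonals_def)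
  then show thesis using that by (auto simp: diagonals_eq)
qed

text \<open>\<open>orient\<close> in its last argument is an affine functional, nonnegative on the
  vertices and hence on \<open>P\<close>. The face where it vanishes has just the two ends as
  vertices, so it is the segment.\<close>

lemma one_sided_edge:
  assumes ab: "a \<le> n + 2" "b \<le> n + 2" "a \<noteq> b" and s: "\<And>x. x \<le> n + 2 \<Longrightarrow> \<not> ccw a x b"
  shows "sg a b edge_of P"
    and "z \<in> P \<Longrightarrow> orient (vx a) (vx b) z \<ge> 0"
proof -
  define w :: "real^2" where "w = vector [- (vx b $ 2 - vx a $ 2), vx b $ 1 - vx a $ 1]"
  have o: "orient (vx a) (vx b) z = w \<bullet> z - w \<bullet> vx a" for z unfolding w_def by (rule orient_inner)
  have V0: "w \<bullet> vx a \<le> w \<bullet> v" if v: "v \<in> V" for v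
  proof -
    obtain x where x: "x \<le> n + 2" "v = vx x" using V_iff v by blast
    then have "O3 a b x \<ge> 0" using s[of x] O3_ccw[of a b x] ab by (simp add: not_less)
    then show ?thesis using o x by simp
  qed
  have P0: "w \<bullet> vx a \<le> w \<bullet> z" if z: "z \<in> P" for z
  proof -
    have "P \<subseteq> {z. w \<bullet> vx a \<le> w \<bullet> z}"
      by (subst P_hull, rule hull_minimal) (use V0 in \<open>auto simp: convex_halfspace_ge\<close>)
    then show ?thesis using z by blast
  qed
  then show "z \<in> P \<Longrightarrow> orient (vx a) (vx b) z \<ge> 0" using o by simp
  let ?F = "P \<inter> {z. w \<bullet> z = w \<bullet> vx a}"
  have F: "?F face_of P" by (rule face_of_Int_supporting_hyperplane_ge[OF convex_P P0])
  have "{v. v extreme_point_of ?F} = {vx a, vx b}"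
  proof -
    have "v extreme_point_of ?F \<longleftrightarrow> v \<in> V \<and> w \<bullet> v = w \<bullet> vx a" for v
      using extreme_point_of_face[OF F] V_P by (auto simp: verts_def)
    moreover have "v \<in> V \<and> w \<bullet> v = w \<bullet> vx a \<longleftrightarrow> v = vx a \<or> v = vx b" for v
    proof
      assume v: "v \<in> V \<and> w \<bullet> v = w \<bullet> vx a"
      then obtain x where x: "x \<le> n + 2" "v = vx x" using V_iff by blast
      then have "O3 a b x = 0" using o v by simp
      then show "v = vx a \<or> v = vx b" using O3_nonzero[of a b x] ab x by auto
    next
      assume "v = vx a \<or> v = vx b"
      moreover have "w \<bullet> vx b = w \<bullet> vx a" using o[of "vx b"] by simp
      ultimately show "v \<in> V \<and> w \<bullet> v = w \<bullet> vx a" using vx_V ab by auto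
    qed
    ultimately show ?thesis by blast
  qed
  moreover have "compact ?F" "convex ?F" using F compact_P convex_P face_of_imp_compact face_of_imp_convex by blast+
  ultimately have "?F = convex hull {vx a, vx b}" using Krein_Milman_Minkowski by metis
  then have "?F = sg a b" by (simp add: sg_def segment_convex_hull)
  moreover have "aff_dim (sg a b) = 1"
  proof -
    have "aff_dim (sg a b) = aff_dim {vx a, vx b}" unfolding sg_def segment_convex_hull by (rule aff_dim_convex_hull)
    then show ?thesis using ab vx_eq_iff by (simp add: aff_dim_2)
  qed
  ultimately show "sg a b edge_of P" using F by (simp add: edge_of_def)
qed

text \<open>With vertices on both sides, the segment joining two of them would cross the edge at an
  inner point; as the edge is a face, it would contain the ends of that segment.\<close>

lemma edge_iff:
  assumes ab: "a \<le> n + 2" "b \<le> n + 2" "a \<noteq> b"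
  shows "sg a b edge_of P \<longleftrightarrow> (\<forall>x\<le>n + 2. \<not> ccw a x b) \<or> (\<forall>x\<le>n + 2. \<not> ccw b x a)"
proof
  assume e: "sg a b edge_of P"
  show "(\<forall>x\<le>n + 2. \<not> ccw a x b) \<or> (\<forall>x\<le>n + 2. \<not> ccw b x a)"
  proof (rule ccontr)
    assume "\<not> ((\<forall>x\<le>n + 2. \<not> ccw a x b) \<or> (\<forall>x\<le>n + 2. \<not> ccw b x a))"
    then obtain x y where xy: "x \<le> n + 2" "ccw a x b" "y \<le> n + 2" "ccw b y a" by blast
    then have X: "crosses a b x y" by (auto simp: crosses_def)
    have "x \<noteq> y" using xy ccw_asym[of a x b] ccw_rot[of b y a] ccw_rot[of y a b] by auto
    then have "crossing (sg a b) (sg x y)" using crossing_sg X ab xy by blast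
    then obtain z where z: "z \<in> rel_interior (sg a b)" "z \<in> rel_interior (sg x y)" by (auto simp: crossing_def)
    have "vx x \<noteq> vx y" using \<open>x \<noteq> y\<close> vx_eq_iff xy by blast
    then have "z \<in> open_segment (vx x) (vx y)" using z(2) by (simp add: sg_def rel_interior_closed_segment)
    moreover have "z \<in> sg a b" using z(1) rel_interior_subset by blast
    moreover have "sg a b face_of P" using e by (simp add: edge_of_def)
    moreover have "vx x \<in> P" "vx y \<in> P" using vx_V V_P xy by auto
    ultimately have "vx x \<in> sg a b" using face_ofD by blast
    then have "x = a \<or> x = b" using vx_in_sg ab xy by blast
    then show False using xy(2) ccw_distinct by blast
  qed
next
  assume "(\<forall>x\<le>n + 2. \<not> ccw a x b) \<or> (\<forall>x\<le>n + 2. \<not> ccw b x a)"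
  then show "sg a b edge_of P"
    using one_sided_edge(1)[of a b] one_sided_edge(1)[of b a] ab sg_commute[of a b] by metis
qed

lemma internal_diagonals_eq:
  "internal_diagonals P = {sg a b | a b. a < b \<and> b \<le> n + 2 \<and> (\<exists>x\<le>n + 2. ccw a x b) \<and> (\<exists>x\<le>n + 2. ccw b x a)}"
  unfolding internal_diagonals_def diagonals_eq using edge_iff by fastforce

section \<open>Top and bottom edges\<close>

lemma not_upper:
  assumes ab: "a < b" "b \<le> n + 2" and x: "x \<le> n + 2" "ccw b x a"
  shows "\<not> sg a b \<subseteq> upper_hull P"
proof -
  have O: "O3 a b x > 0" using O3_ccw x ab by simp
  have ne: "x \<noteq> a" "x \<noteq> b" using ccw_distinct[OF x(2)] by auto
  have ends: "vx a \<in> sg a b" "vx b \<in> sg a b" by (auto simp: sg_def)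
  consider "x < a" | "b < x" | "a < x" "x < b" using ne ab by linarith
  then show ?thesis
  proof cases
    case 1
    have "O3 x a b > 0" using O orient_rot[of "vx x" "vx a" "vx b"] by simp
    then have "vx a \<notin> upper_hull P" using hull_test[of x a b] 1 ab by linarith
    then show ?thesis using ends by blast
  next
    case 2
    then have "vx b \<notin> upper_hull P" using hull_test[of a b x] O ab x by linarith
    then show ?thesis using ends by blast
  next
    case 3
    \<comment> \<open>Both ends of the diagonal may be on the upper hull here; its point
      \<open>q\<close> below \<open>vx x\<close> is not.\<close>
    let ?A = "vx a" and ?B = "vx b" and ?X = "vx x"
    have l: "?A $ 1 < ?X $ 1" "?X $ 1 < ?B $ 1" using vx_less_iff 3 ab x by auto
    define t where "t = (?X $ 1 - ?A $ 1) / (?B $ 1 - ?A $ 1)"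
    define q where "q = (1 - t) *\<^sub>R ?A + t *\<^sub>R ?B"
    have t: "0 \<le> t" "t \<le> 1" using l by (auto simp: t_def)
    have q: "q \<in> sg a b" unfolding sg_def q_def in_segment using t by blast
    have tw: "t * (?B $ 1 - ?A $ 1) = ?X $ 1 - ?A $ 1" using l by (simp add: t_def)
    have "q $ 1 = ?A $ 1 + t * (?B $ 1 - ?A $ 1)" by (simp add: q_def algebra_simps)
    then have q1: "q $ 1 = ?X $ 1" using tw by simp
    have "orient ?A ?B q = 0" by (simp add: q_def orient_convex)
    then have "orient ?A ?B ?X = (?B $ 1 - ?A $ 1) * (?X $ 2 - q $ 2)"
      using q1 by (simp add: orient_def algebra_simps)
    then have "q $ 2 < ?X $ 2" using O l by (auto simp: zero_less_mult_iff)
    moreover have "?X \<in> P" using vx_V V_P x by blast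
    ultimately have "q \<notin> upper_hull P" using q1 by (auto simp: upper_hull_def not_le)
    then show ?thesis using q by blast
  qed
qed

lemma not_lower:
  assumes ab: "a < b" "b \<le> n + 2" and x: "x \<le> n + 2" "ccw a x b"
  shows "\<not> sg a b \<subseteq> lower_hull P"
proof -
  have O: "O3 a b x < 0" using O3_ccw x ab by simp
  have ne: "x \<noteq> a" "x \<noteq> b" using ccw_distinct[OF x(2)] by auto
  have ends: "vx a \<in> sg a b" "vx b \<in> sg a b" by (auto simp: sg_def)
  consider "x < a" | "b < x" | "a < x" "x < b" using ne ab by linarith
  then show ?thesis
  proof cases
    case 1
    have "O3 x a b < 0" using O orient_rot[of "vx x" "vx a" "vx b"] by simp
    then have "vx a \<notin> lower_hull P" using hull_test[of x a b] 1 ab by linarith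
    then show ?thesis using ends by blast
  next
    case 2
    then have "vx b \<notin> lower_hull P" using hull_test[of a b x] O ab x by linarith
    then show ?thesis using ends by blast
  next
    case 3
    let ?A = "vx a" and ?B = "vx b" and ?X = "vx x"
    have l: "?A $ 1 < ?X $ 1" "?X $ 1 < ?B $ 1" using vx_less_iff 3 ab x by auto
    define t where "t = (?X $ 1 - ?A $ 1) / (?B $ 1 - ?A $ 1)"
    define q where "q = (1 - t) *\<^sub>R ?A + t *\<^sub>R ?B"
    have t: "0 \<le> t" "t \<le> 1" using l by (auto simp: t_def)
    have q: "q \<in> sg a b" unfolding sg_def q_def in_segment using t by blast
    have tw: "t * (?B $ 1 - ?A $ 1) = ?X $ 1 - ?A $ 1" using l by (simp add: t_def)
    have "q $ 1 = ?A $ 1 + t * (?B $ 1 - ?A $ 1)" by (simp add: q_def algebra_simps)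
    then have q1: "q $ 1 = ?X $ 1" using tw by simp
    have "orient ?A ?B q = 0" by (simp add: q_def orient_convex)
    then have "orient ?A ?B ?X = (?B $ 1 - ?A $ 1) * (?X $ 2 - q $ 2)"
      using q1 by (simp add: orient_def algebra_simps)
    then have "?X $ 2 < q $ 2" using O l by (auto simp: mult_less_0_iff)
    moreover have "?X \<in> P" using vx_V V_P x by blast
    ultimately have "q \<notin> lower_hull P" using q1 by (auto simp: lower_hull_def not_le)
    then show ?thesis using q by blast
  qed
qed

lemma one_sided_hull:
  assumes ab: "a < b" "b \<le> n + 2"
  shows "(\<And>x. x \<le> n + 2 \<Longrightarrow> \<not> ccw b x a) \<Longrightarrow> sg a b \<subseteq> upper_hull P"
    and "(\<And>x. x \<le> n + 2 \<Longrightarrow> \<not> ccw a x b) \<Longrightarrow> sg a b \<subseteq> lower_hull P"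
proof -
  let ?A = "vx a" and ?B = "vx b"
  have l: "?A $ 1 < ?B $ 1" using vx_less_iff ab by auto
  have "vx a \<in> P" "vx b \<in> P" using vx_V V_P ab by auto
  then have sP: "sg a b \<subseteq> P" unfolding sg_def using convex_P by (simp add: closed_segment_subset)
  have o: "orient ?A ?B y = (?B $ 1 - ?A $ 1) * (y $ 2 - z $ 2)" if zy: "z \<in> sg a b" "y $ 1 = z $ 1" for y z
  proof -
    obtain u where "z = (1 - u) *\<^sub>R ?A + u *\<^sub>R ?B" using zy(1) by (auto simp: sg_def in_segment)
    then have "orient ?A ?B z = 0" by (simp add: orient_convex)
    then show ?thesis using zy(2) by (simp add: orient_def algebra_simps)
  qed
  { assume "\<And>x. x \<le> n + 2 \<Longrightarrow> \<not> ccw b x a"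
    then have "orient ?B ?A y \<ge> 0" if "y \<in> P" for y using one_sided_edge(2)[of b a y] ab that by auto
    then have "orient ?A ?B y \<le> 0" if "y \<in> P" for y using orient_swap[of ?A ?B y] that by simp
    then show "sg a b \<subseteq> upper_hull P" using o l sP by (fastforce simp: upper_hull_def mult_le_0_iff) }
  { assume "\<And>x. x \<le> n + 2 \<Longrightarrow> \<not> ccw a x b"
    then have "orient ?A ?B y \<ge> 0" if "y \<in> P" for y using one_sided_edge(2)[of a b y] ab that by auto
    then show "sg a b \<subseteq> lower_hull P" using o l sP by (fastforce simp: lower_hull_def zero_le_mult_iff) }
qed

lemma top_bottom_edges:
  assumes ab: "a < b" "b \<le> n + 2" and e: "sg a b edge_of P" and c: "c \<le> n + 2"
  shows "ccw a c b \<Longrightarrow> sg a b \<in> top_edges P \<and> sg a b \<notin> bottom_edges P"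
    and "ccw b c a \<Longrightarrow> sg a b \<in> bottom_edges P \<and> sg a b \<notin> top_edges P"
  using edge_iff[of a b] ab e c one_sided_hull[OF ab] not_upper[OF ab c] not_lower[OF ab c]
  by (auto simp: top_edges_def bottom_edges_def)

lemma blossoms_eq: "blossoms P = {\<delta>. \<delta> edge_of P}"
proof -
  have "\<delta> \<in> blossoms P" if e: "\<delta> edge_of P" for \<delta>
  proof -
    obtain a b where ab: "\<delta> = sg a b" "a < b" "b \<le> n + 2" using edge_ends[OF e] by blast
    then show ?thesis using edge_iff[of a b] e one_sided_hull[OF ab(2,3)]
      by (auto simp: blossoms_def top_edges_def bottom_edges_def)
  qed
  then show ?thesis by (auto simp: blossoms_def top_edges_def bottom_edges_def)
qed

end

locale triangulated_polygon = polygon +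
  fixes T :: "(real^2) set set"
  assumes tri: "triangulation P T"
begin

section \<open>A triangulation as a relation on labels\<close>

definition E :: "nat \<Rightarrow> nat \<Rightarrow> bool" where
  "E a b \<longleftrightarrow> a \<le> n + 2 \<and> b \<le> n + 2 \<and> a \<noteq> b \<and> sg a b \<in> T \<union> {\<delta>. \<delta> edge_of P}"

lemma T_internal: "T \<subseteq> internal_diagonals P"
  using tri by (auto simp: triangulation_def dissection_def)

lemma edge_no_crossing:
  assumes "a \<le> n + 2" "b \<le> n + 2" "a \<noteq> b" "sg a b edge_of P" "c \<le> n + 2" "d \<le> n + 2"
  shows "\<not> crosses a b c d"
  using edge_iff assms unfolding crosses_def by blast

lemma E_noncrossing:
  assumes "E a b" "E c d" shows "\<not> crosses a b c d"
proof -
  have b: "a \<le> n + 2" "b \<le> n + 2" "a \<noteq> b" "c \<le> n + 2" "d \<le> n + 2" "c \<noteq> d" using assms by (auto simp: E_def)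
  consider "sg a b edge_of P" | "sg c d edge_of P" | "sg a b \<in> T" "sg c d \<in> T" using assms by (auto simp: E_def)
  then show ?thesis
  proof cases
    case 1 then show ?thesis using edge_no_crossing b by blast
  next
    case 2 then show ?thesis using edge_no_crossing[of c d a b] b crosses_sym by blast
  next
    case 3
    then have "\<not> crossing (sg a b) (sg c d)" using tri by (auto simp: triangulation_def dissection_def)
    then show ?thesis using crossing_sg b by blast
  qed
qed

lemma E_maximal:
  assumes ab: "a \<le> n + 2" "b \<le> n + 2" "a \<noteq> b" and nc: "\<And>c d. E c d \<Longrightarrow> \<not> crosses a b c d"
  shows "E a b"
proof (cases "sg a b edge_of P")
  case False
  have "sg a b \<in> internal_diagonals P"
    using False vx_V ab vx_eq_iff unfolding internal_diagonals_def diagonals_def sg_def by blast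
  moreover have "\<not> crossing (sg a b) \<epsilon> \<and> \<not> crossing \<epsilon> (sg a b)" if e: "\<epsilon> \<in> T" for \<epsilon>
  proof -
    obtain c d where cd: "\<epsilon> = sg c d" "c < d" "d \<le> n + 2" using e T_internal internal_diagonals_eq by blast
    then have "E c d" using e by (simp add: E_def)
    then show ?thesis using nc crossing_sg[of a b c d] crossing_sg[of c d a b] crosses_sym[of a b c d] cd ab by auto
  qed
  moreover have "\<not> crossing (sg a b) (sg a b)" by (simp add: crossing_def)
  ultimately have "dissection P (insert (sg a b) T)" using tri by (auto simp: triangulation_def dissection_def)
  then have "insert (sg a b) T = T" using tri unfolding triangulation_def by blast
  then show ?thesis using ab by (auto simp: E_def)
qed (use ab in \<open>auto simp: E_def\<close>)

sublocale label_triangulation "n + 2" U E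
proof
  show "E a b \<Longrightarrow> E b a" for a b using sg_commute by (auto simp: E_def)
  show "E a b \<Longrightarrow> a \<le> n + 2 \<and> b \<le> n + 2 \<and> a \<noteq> b" for a b by (simp add: E_def)
qed (use E_noncrossing E_maximal in blast)+

end

section \<open>The spine\<close>

lemma sorted_triple_unique:
  fixes i j k :: nat
  assumes "i < j" "j < k" "i' < j'" "j' < k'" "{i, j, k} = {i', j', k'}"
  shows "i = i' \<and> j = j' \<and> k = k'"
proof -
  have "i = i' \<or> i = j' \<or> i = k'" "j = i' \<or> j = j' \<or> j = k'" "k = i' \<or> k = j' \<or> k = k'"
    using assms(5) by auto
  then show ?thesis using assms(1-4) by (elim disjE) simp_all
qed

context triangulated_polygon
begin

section \<open>Triangles and the direction of their arcs\<close>

definition triangle_of :: "nat \<Rightarrow> nat \<Rightarrow> nat \<Rightarrow> triangle" where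
  "triangle_of i j k = (vx i, vx j, vx k)"

lemma triangles_eq: "triangles P T = {triangle_of i j k | i j k. i < j \<and> j < k \<and> E i j \<and> E j k \<and> E i k}"
proof -
  have "\<exists>i j k. t = triangle_of i j k \<and> i < j \<and> j < k \<and> E i j \<and> E j k \<and> E i k" if t: "t \<in> triangles P T" for t
  proof -
    obtain a b c where abc: "t = (a, b, c)" "a \<in> V" "b \<in> V" "c \<in> V" "a $ 1 < b $ 1" "b $ 1 < c $ 1"
      "sides (a, b, c) \<subseteq> T \<union> {\<delta>. \<delta> edge_of P}"
      using t by (auto simp: triangles_def)
    obtain i j k where ijk: "i \<le> n + 2" "j \<le> n + 2" "k \<le> n + 2" "a = vx i" "b = vx j" "c = vx k"
      using abc(2-4) unfolding V_iff by (elim exE conjE)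
    have "i < j" "j < k" using vx_less_iff abc(5,6) ijk by auto
    moreover have "E i j" "E j k" "E i k" using abc(7) ijk \<open>i < j\<close> \<open>j < k\<close> by (auto simp: E_def sg_def)
    ultimately show ?thesis using abc(1) ijk(4-6) by (auto simp: triangle_of_def)
  qed
  moreover have "triangle_of i j k \<in> triangles P T" if "i < j" "j < k" "E i j" "E j k" "E i k" for i j k
    using that vx_V vx_less_iff by (auto simp: triangles_def triangle_of_def E_def sg_def)
  ultimately show ?thesis by blast
qed

lemma sides_tr: "sides (triangle_of i j k) = {sg i j, sg j k, sg i k}"
  by (simp add: triangle_of_def sg_def)

lemma corners_tr: "corners (triangle_of i j k) = {vx i, vx j, vx k}"
  by (simp add: triangle_of_def)

lemma E_not_both: "E a b \<Longrightarrow> sg a b \<in> T \<Longrightarrow> \<not> sg a b edge_of P"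
  using T_internal by (auto simp: internal_diagonals_def)

text \<open>For an internal side the direction is by definition given by the apex \<open>c\<close>.
  For a boundary edge the apex shows on which side the polygon lies, hence whether the edge is top
  or bottom, and the rule is the same.\<close>

lemma side_direction:
  assumes ab: "a < b" "E a b" and c: "c \<le> n + 2" "c \<noteq> a" "c \<noteq> b"
    and t: "corners t = {vx a, vx b, vx c}" "sg a b \<in> sides t"
  shows "sg a b \<in> incoming P T t \<longleftrightarrow> ccw b c a" "sg a b \<in> outgoing P T t \<longleftrightarrow> ccw a c b"
proof -
  have bM: "a \<le> n + 2" "b \<le> n + 2" using ab(2) by (auto simp: E_def)
  have dist: "\<not> ccw b s a \<and> \<not> ccw a s b" if "s = a \<or> s = b" for s
    using ccw_distinct[of b s a] ccw_distinct[of a s b] that by auto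
  have above: "triangle_above t (sg a b) \<longleftrightarrow> ccw b c a" and below: "triangle_below t (sg a b) \<longleftrightarrow> ccw a c b"
    unfolding triangle_above_def triangle_below_def t(1) using below_sg[OF ab(1) bM(2)] bM c dist by auto
  have one: "ccw a c b \<longleftrightarrow> \<not> ccw b c a"
    using ccw_total[of a c b] ccw_asym[of a c b] ccw_rot[of b c a] ccw_rot[of c a b] bM c ab(1) by auto
  have "sg a b \<in> incoming P T t \<longleftrightarrow> ccw b c a \<and> (sg a b \<in> T \<or> sg a b edge_of P)"
    using above t(2) one top_bottom_edges[OF ab(1) bM(2) _ c(1)] E_not_both[OF ab(2)]
    by (auto simp: incoming_def bottom_edges_def)
  moreover have "sg a b \<in> outgoing P T t \<longleftrightarrow> ccw a c b \<and> (sg a b \<in> T \<or> sg a b edge_of P)"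
    using below t(2) one top_bottom_edges[OF ab(1) bM(2) _ c(1)] E_not_both[OF ab(2)]
    by (auto simp: outgoing_def top_edges_def)
  ultimately show "sg a b \<in> incoming P T t \<longleftrightarrow> ccw b c a" "sg a b \<in> outgoing P T t \<longleftrightarrow> ccw a c b"
    using ab(2) by (auto simp: E_def)
qed

lemma incoming_outgoing:
  assumes t: "i < j" "j < k" "E i j" "E j k" "E i k"
  shows "incident P T (triangle_of i j k) = sides (triangle_of i j k)"
    and "j \<notin> U \<Longrightarrow> incoming P T (triangle_of i j k) = {sg i j, sg j k}"
    and "j \<in> U \<Longrightarrow> outgoing P T (triangle_of i j k) = {sg i j, sg j k}"
proof -
  have M: "i \<le> n + 2" "j \<le> n + 2" "k \<le> n + 2" using t by (auto simp: E_def)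
  have c: "ccw i j k \<longleftrightarrow> j \<notin> U" "ccw i k j \<longleftrightarrow> j \<in> U" using ccw_sorted[OF t(1,2) M(3)] by auto
  have r: "ccw j k i \<longleftrightarrow> j \<notin> U" "ccw k i j \<longleftrightarrow> j \<notin> U" "ccw k j i \<longleftrightarrow> j \<in> U" "ccw j i k \<longleftrightarrow> j \<in> U"
    using c ccw_rot[of i j k] ccw_rot[of j k i] ccw_rot[of i k j] ccw_rot[of k j i] by auto
  have 1: "sg i j \<in> incoming P T (triangle_of i j k) \<longleftrightarrow> j \<notin> U" "sg i j \<in> outgoing P T (triangle_of i j k) \<longleftrightarrow> j \<in> U"
    using side_direction[of i j k "triangle_of i j k"] t M r c by (auto simp: corners_tr sides_tr)
  have 2: "sg j k \<in> incoming P T (triangle_of i j k) \<longleftrightarrow> j \<notin> U" "sg j k \<in> outgoing P T (triangle_of i j k) \<longleftrightarrow> j \<in> U"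
    using side_direction[of j k i "triangle_of i j k"] t M r c by (auto simp: corners_tr sides_tr)
  have 3: "sg i k \<in> incoming P T (triangle_of i j k) \<longleftrightarrow> j \<in> U" "sg i k \<in> outgoing P T (triangle_of i j k) \<longleftrightarrow> j \<notin> U"
    using side_direction[of i k j "triangle_of i j k"] t M r c by (auto simp: corners_tr sides_tr)
  have sub: "incoming P T (triangle_of i j k) \<subseteq> {sg i j, sg j k, sg i k}" "outgoing P T (triangle_of i j k) \<subseteq> {sg i j, sg j k, sg i k}"
    by (auto simp: incoming_def outgoing_def sides_tr)
  show "incident P T (triangle_of i j k) = sides (triangle_of i j k)"
    unfolding incident_def sides_tr using 1 2 3 sub by blast
  show "j \<notin> U \<Longrightarrow> incoming P T (triangle_of i j k) = {sg i j, sg j k}" using 1 2 3 sub by blast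
  show "j \<in> U \<Longrightarrow> outgoing P T (triangle_of i j k) = {sg i j, sg j k}" using 1 2 3 sub by blast
qed

section \<open>Blossoms in counterclockwise order\<close>

definition next_vertex :: "nat \<Rightarrow> nat" where
  "next_vertex s = (SOME c. c \<le> n + 2 \<and> c \<noteq> s \<and> (\<forall>x\<le>n + 2. \<not> ccw s x c))"

lemma next_vertex:
  assumes "s \<le> n + 2"
  shows "next_vertex s \<le> n + 2" "next_vertex s \<noteq> s" "x \<le> n + 2 \<Longrightarrow> \<not> ccw s x (next_vertex s)"
proof -
  have "next_vertex s \<le> n + 2 \<and> next_vertex s \<noteq> s \<and> (\<forall>x\<le>n + 2. \<not> ccw s x (next_vertex s))"
    unfolding next_vertex_def by (rule someI_ex) (use ex_succ[OF assms] in blast)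
  then show "next_vertex s \<le> n + 2" "next_vertex s \<noteq> s" "x \<le> n + 2 \<Longrightarrow> \<not> ccw s x (next_vertex s)" by auto
qed

lemma next_vertex_unique:
  assumes "a \<le> n + 2" "b \<le> n + 2" "a \<noteq> b" "\<And>x. x \<le> n + 2 \<Longrightarrow> \<not> ccw a x b"
  shows "next_vertex a = b"
proof (rule ccontr)
  assume "next_vertex a \<noteq> b"
  then have "ccw a (next_vertex a) b \<or> ccw a b (next_vertex a)" using ccw_total[of a "next_vertex a" b] next_vertex[OF assms(1)] assms by auto
  then show False using next_vertex[OF assms(1)] assms by blast
qed

text \<open>Blossoms are indexed by the first vertex of their edge in counterclockwise order, so that those
  beyond the side \<open>u v\<close> of a counterclockwise triangle \<open>u v w\<close> are indexed by \<open>arc u v\<close>.\<close>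

definition boundary_edge :: "nat \<Rightarrow> (real^2) set" where "boundary_edge s = sg s (next_vertex s)"

text \<open>Two vertices with the same boundary edge would follow each other in both directions,
  leaving no place for a third vertex.\<close>

lemma boundary_edge_inj: "inj_on boundary_edge {..n + 2}"
proof (rule inj_onI)
  fix s s' assume s: "s \<in> {..n + 2}" "s' \<in> {..n + 2}" "boundary_edge s = boundary_edge s'"
  show "s = s'"
  proof (rule ccontr)
    assume ne: "s \<noteq> s'"
    have "{s, next_vertex s} = {s', next_vertex s'}" using s next_vertex sg_eq_iff by (auto simp: boundary_edge_def)
    then have e: "next_vertex s = s'" "next_vertex s' = s" using ne by (auto simp: doubleton_eq_iff)
    obtain x where x: "x \<le> n + 2" "x \<noteq> s" "x \<noteq> s'"
    proof -
      have "\<exists>x\<in>{0, 1, 2::nat}. x \<noteq> s \<and> x \<noteq> s'" by auto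
      then obtain x :: nat where "x \<in> {0, 1, 2}" "x \<noteq> s" "x \<noteq> s'" by blast
      then show thesis using that[of x] by auto
    qed
    then have "ccw s x s' \<or> ccw s' x s"
      using ccw_total[of s x s'] ccw_rot[of s s' x] ccw_rot[of s' x s] s ne by auto
    then show False using next_vertex(3)[of s x] next_vertex(3)[of s' x] e s x by auto
  qed
qed

lemma boundary_edge_image: "boundary_edge ` {..n + 2} = blossoms P"
proof -
  have "boundary_edge s edge_of P" if "s \<le> n + 2" for s
    using edge_iff[of s "next_vertex s"] next_vertex[OF that] that by (auto simp: boundary_edge_def)
  moreover have "\<delta> \<in> boundary_edge ` {..n + 2}" if e: "\<delta> edge_of P" for \<delta>
  proof -
    obtain a b where ab: "\<delta> = sg a b" "a < b" "b \<le> n + 2" using edge_ends[OF e] by blast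
    then consider "\<forall>x\<le>n + 2. \<not> ccw a x b" | "\<forall>x\<le>n + 2. \<not> ccw b x a" using edge_iff[of a b] e by auto
    then show ?thesis
    proof cases
      case 1
      then have "boundary_edge a = \<delta>" using next_vertex_unique[of a b] ab by (auto simp: boundary_edge_def)
      then show ?thesis using ab by auto
    next
      case 2
      then have "boundary_edge b = \<delta>" using next_vertex_unique[of b a] ab sg_commute by (auto simp: boundary_edge_def)
      then show ?thesis using ab by auto
    qed
  qed
  ultimately show ?thesis unfolding blossoms_eq by auto
qed

definition arc :: "nat \<Rightarrow> nat \<Rightarrow> nat set" where
  "arc u v = {s. s \<le> n + 2 \<and> (s = u \<or> ccw u s v)}"

text \<open>The counterclockwise reading \<open>u v w\<close> of the triangle with \<open>d\<close>
  as its first side is unique, as \<open>far_eq\<close> shows; quantifying over readings inside the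
  set avoids a choice.\<close>

definition far :: "triangle \<Rightarrow> (real^2) set \<Rightarrow> (real^2) set set" where
  "far t d = boundary_edge ` {s. \<exists>u v w. u \<le> n + 2 \<and> v \<le> n + 2 \<and> w \<le> n + 2 \<and> d = sg u v \<and>
      corners t = {vx u, vx v, vx w} \<and> ccw u v w \<and> s \<in> arc u v}"

lemma arc_sub: "arc u v \<subseteq> {..n + 2}"
  by (auto simp: arc_def)

lemma vx_set_eq:
  assumes "A \<subseteq> {..n + 2}" "B \<subseteq> {..n + 2}"
  shows "vx ` A = vx ` B \<longleftrightarrow> A = B"
  by (rule inj_on_image_eq_iff[of vx "{..n + 2}"]) (use assms vx_eq_iff in \<open>auto simp: inj_on_def\<close>)

lemma far_eq:
  assumes b: "u \<le> n + 2" "v \<le> n + 2" "w \<le> n + 2" and t: "corners t = {vx u, vx v, vx w}" and c: "ccw u v w"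
  shows "far t (sg u v) = boundary_edge ` arc u v"
proof -
  have "u' = u \<and> v' = v" if h: "u' \<le> n + 2" "v' \<le> n + 2" "w' \<le> n + 2" "sg u v = sg u' v'"
    "corners t = {vx u', vx v', vx w'}" "ccw u' v' w'" for u' v' w'
  proof -
    have 1: "{u, v} = {u', v'}" using sg_eq_iff h b by blast
    have "vx ` {u, v, w} = vx ` {u', v', w'}" using t h(5) by simp
    then have 2: "{u, v, w} = {u', v', w'}" using vx_set_eq[of "{u, v, w}" "{u', v', w'}"] b h by simp
    have "w = w'" using 1 2 ccw_distinct[OF c] ccw_distinct[OF h(6)] by auto
    then show ?thesis using 1 c h(6) ccw_asym[of u v w] ccw_rot[of v u w] by (auto simp: doubleton_eq_iff)
  qed
  then have "{s. \<exists>u' v' w'. u' \<le> n + 2 \<and> v' \<le> n + 2 \<and> w' \<le> n + 2 \<and> sg u v = sg u' v' \<and>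
      corners t = {vx u', vx v', vx w'} \<and> ccw u' v' w' \<and> s \<in> arc u' v'} = arc u v"
    using b t c by blast
  then show ?thesis unfolding far_def by simp
qed

lemma triangle_ccw:
  assumes t: "t \<in> triangles P T"
  obtains u v w where "u \<le> n + 2" "v \<le> n + 2" "w \<le> n + 2" "corners t = {vx u, vx v, vx w}" "ccw u v w"
    "sides t = {sg u v, sg v w, sg w u}" "E u v" "E v w" "E w u"
proof -
  obtain i j k where ijk: "t = triangle_of i j k" "i < j" "j < k" "E i j" "E j k" "E i k" using t triangles_eq by auto
  have M: "i \<le> n + 2" "j \<le> n + 2" "k \<le> n + 2" using ijk by (auto simp: E_def)
  show thesis
  proof (cases "ccw i j k")
    case True
    show thesis by (rule that[of i j k]) (use True M ijk E_sym sg_commute in \<open>auto simp: corners_tr sides_tr\<close>)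
  next
    case False
    then have "ccw i k j" using ccw_total[of i j k] M ijk by auto
    then show thesis by (intro that[of i k j]) (use M ijk E_sym sg_commute in \<open>auto simp: corners_tr sides_tr\<close>)
  qed
qed

lemma side_ccw:
  assumes t: "t \<in> triangles P T" and d: "d \<in> sides t"
  obtains u v w where "u \<le> n + 2" "v \<le> n + 2" "w \<le> n + 2" "corners t = {vx u, vx v, vx w}" "ccw u v w"
    "d = sg u v" "sides t = {sg u v, sg v w, sg w u}" "E u v" "E v w" "E w u"
proof -
  obtain u v w where o: "u \<le> n + 2" "v \<le> n + 2" "w \<le> n + 2" "corners t = {vx u, vx v, vx w}" "ccw u v w"
    "sides t = {sg u v, sg v w, sg w u}" "E u v" "E v w" "E w u" using triangle_ccw[OF t] by blast
  consider "d = sg u v" | "d = sg v w" | "d = sg w u" using d o(6) by blast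
  then show thesis
  proof cases
    case 1 then show thesis using that[of u v w] o by blast
  next
    case 2
    have "ccw v w u" using o(5) ccw_rot by blast
    then show thesis using that[of v w u] o 2 by blast
  next
    case 3
    have "ccw w u v" using o(5) ccw_rot by blast
    then show thesis using that[of w u v] o 3 by blast
  qed
qed

section \<open>Arcs beyond the sides of a triangle\<close>

lemma triangle_eqI:
  assumes "t \<in> triangles P T" "t' \<in> triangles P T" "corners t = corners t'"
  shows "t = t'"
proof -
  obtain i j k where t: "t = triangle_of i j k" "i < j" "j < k" "E i j" "E j k" "E i k" using assms triangles_eq by auto
  obtain i' j' k' where t': "t' = triangle_of i' j' k'" "i' < j'" "j' < k'" "E i' j'" "E j' k'" "E i' k'" using assms triangles_eq by auto
  have "vx ` {i, j, k} = vx ` {i', j', k'}" using assms(3) t(1) t'(1) by (simp add: corners_tr)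
  then have "{i, j, k} = {i', j', k'}"
    using vx_set_eq[of "{i, j, k}" "{i', j', k'}"] t t' by (auto simp: E_def)
  then have "i = i' \<and> j = j' \<and> k = k'" by (rule sorted_triple_unique[OF t(2,3) t'(2,3)])
  then show ?thesis using t t' by simp
qed

lemma mk_triangle:
  assumes "E u v" "E v w" "E w u"
  shows "\<exists>t\<in>triangles P T. corners t = {vx u, vx v, vx w} \<and> sides t = {sg u v, sg v w, sg w u}"
proof -
  have ne: "u \<noteq> v" "v \<noteq> w" "u \<noteq> w" using assms by (auto simp: E_def)
  obtain i j k where ijk: "i < j" "j < k" "{i, j, k} = {u, v, w}" using sort_three[OF ne] by blast
  have e: "E s s'" if "s \<in> {i, j, k}" "s' \<in> {i, j, k}" "s \<noteq> s'" for s s'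
    using that assms E_sym unfolding ijk(3) by blast
  have "E i j" "E j k" "E i k" using e ijk(1,2) by simp_all
  then have "triangle_of i j k \<in> triangles P T" using ijk(1,2) unfolding triangles_eq by blast
  moreover have "corners (triangle_of i j k) = vx ` {i, j, k}" by (simp add: corners_tr)
  \<comment> \<open>A description of the sides by the set of corners, independent of their order, so
    that the sorted and the given order can be compared.\<close>
  moreover have g: "{sg s s' | s s'. s \<in> {x, y, z} \<and> s' \<in> {x, y, z} \<and> s \<noteq> s'} = {sg x y, sg y z, sg x z}"
    if d: "x \<noteq> y" "y \<noteq> z" "x \<noteq> z" for x y z
  proof (intro equalityI subsetI)
    have c: "sg y x = sg x y" "sg z y = sg y z" "sg z x = sg x z" by (rule sg_commute)+
    fix e assume "e \<in> {sg s s' | s s'. s \<in> {x, y, z} \<and> s' \<in> {x, y, z} \<and> s \<noteq> s'}"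
    then obtain s s' where "e = sg s s'" "s = x \<or> s = y \<or> s = z" "s' = x \<or> s' = y \<or> s' = z" "s \<noteq> s'" by blast
    then show "e \<in> {sg x y, sg y z, sg x z}" using c by (elim disjE) simp_all
  next
    fix e assume "e \<in> {sg x y, sg y z, sg x z}"
    then show "e \<in> {sg s s' | s s'. s \<in> {x, y, z} \<and> s' \<in> {x, y, z} \<and> s \<noteq> s'}" using d by blast
  qed
  have "sides (triangle_of i j k) = {sg s s' | s s'. s \<in> {i, j, k} \<and> s' \<in> {i, j, k} \<and> s \<noteq> s'}"
    using g[of i j k] ijk(1,2) by (simp add: sides_tr)
  then have "sides (triangle_of i j k) = {sg u v, sg v w, sg w u}"
    unfolding ijk(3) g[OF ne] using sg_commute[of u w] by simp
  ultimately show ?thesis unfolding ijk(3) by (intro bexI[of _ "triangle_of i j k"]) auto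
qed

lemma arc_cases:
  assumes "u \<le> n + 2" "v \<le> n + 2" "w \<le> n + 2" "ccw u v w"
  shows "arc u v \<union> arc v w \<union> arc w u = {..n + 2}" "arc u v \<inter> arc v w = {}" "arc u v \<inter> arc w u = {}"
    "arc v w \<inter> arc w u = {}"
proof -
  have k: "0 < key u v" "key u v < key u w" using ccw_key' assms by auto
  \<comment> \<open>Counted from \<open>u\<close>, the three arcs are consecutive intervals starting
    at 0, \<open>key u v\<close> and \<open>key u w\<close>.\<close>
  have a: "s \<in> arc u v \<longleftrightarrow> key u s < key u v" "s \<in> arc v w \<longleftrightarrow> key u v \<le> key u s \<and> key u s < key u w"
    "s \<in> arc w u \<longleftrightarrow> key u w \<le> key u s" if s: "s \<le> n + 2" for s
  proof -
    have eq: "s = u \<longleftrightarrow> key u s = 0" "s = v \<longleftrightarrow> key u s = key u v" "s = w \<longleftrightarrow> key u s = key u w"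
      using key_0 key_eq assms s by auto
    have c: "ccw u s v \<longleftrightarrow> cyclic 0 (key u s) (key u v)" "ccw v s w \<longleftrightarrow> cyclic (key u v) (key u s) (key u w)"
      "ccw w s u \<longleftrightarrow> cyclic (key u w) (key u s) 0"
      using ccw_key[OF assms(1)] assms s key_self by auto
    show "s \<in> arc u v \<longleftrightarrow> key u s < key u v" "s \<in> arc v w \<longleftrightarrow> key u v \<le> key u s \<and> key u s < key u w"
      "s \<in> arc w u \<longleftrightarrow> key u w \<le> key u s"
      unfolding arc_def using s k by (auto simp: eq c cyclic_def)
  qed
  have M: "s \<le> n + 2" if "s \<in> arc x y" for s x y using that by (simp add: arc_def)
  have "s \<in> arc u v \<union> arc v w \<union> arc w u \<longleftrightarrow> s \<le> n + 2" for s
    using a[of s] M[of s] by (cases "s \<le> n + 2") auto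
  then show "arc u v \<union> arc v w \<union> arc w u = {..n + 2}" by auto
  have "\<not> (s \<in> arc u v \<and> s \<in> arc v w) \<and> \<not> (s \<in> arc u v \<and> s \<in> arc w u) \<and> \<not> (s \<in> arc v w \<and> s \<in> arc w u)" for s
    using a[of s] M[of s] k by (cases "s \<le> n + 2") auto
  then show "arc u v \<inter> arc v w = {}" "arc u v \<inter> arc w u = {}" "arc v w \<inter> arc w u = {}" by auto
qed

lemma arc_complement:
  assumes "u \<le> n + 2" "v \<le> n + 2" "u \<noteq> v"
  shows "arc v u = {..n + 2} - arc u v"
  using ccw_total[of u _ v] ccw_asym[of u _ v] ccw_rot[of v _ u] ccw_rot[of _ u v] ccw_distinct[of u _ v] assms
  unfolding arc_def by auto

lemma eb_arc_disjoint: "arc u v \<inter> arc x y = {} \<Longrightarrow> boundary_edge ` arc u v \<inter> boundary_edge ` arc x y = {}"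
  using inj_on_image_Int[OF boundary_edge_inj arc_sub arc_sub] by (metis image_empty)

lemma card_eb_arc: "card (boundary_edge ` arc u v) = card (arc u v)"
  by (rule card_image) (rule inj_on_subset[OF boundary_edge_inj arc_sub])

lemma far_ccw:
  assumes "u \<le> n + 2" "v \<le> n + 2" "w \<le> n + 2" "corners t = {vx u, vx v, vx w}" "ccw u v w"
  shows "far t (sg u v) = boundary_edge ` arc u v" "far t (sg v w) = boundary_edge ` arc v w" "far t (sg w u) = boundary_edge ` arc w u"
proof -
  have "ccw v w u" "ccw w u v" using assms(5) ccw_rot by blast+
  then show "far t (sg u v) = boundary_edge ` arc u v" "far t (sg v w) = boundary_edge ` arc v w" "far t (sg w u) = boundary_edge ` arc w u"
    using far_eq[of u v w t] far_eq[of v w u t] far_eq[of w u v t] assms by (simp_all add: insert_commute)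
qed

lemma sg_distinct:
  assumes "u \<le> n + 2" "v \<le> n + 2" "w \<le> n + 2" "ccw u v w"
  shows "sg u v \<noteq> sg v w" "sg v w \<noteq> sg w u" "sg u v \<noteq> sg w u"
  using sg_eq_iff ccw_distinct[OF assms(4)] assms(1-3) by (auto simp: doubleton_eq_iff)

sublocale spine "triangles P T" sides "blossoms P" far
proof
  show "finite (blossoms P)" unfolding boundary_edge_image[symmetric] by simp
  fix t d assume t: "t \<in> triangles P T"
  {
    fix d' assume d: "d \<in> sides t" "d' \<in> sides t" "d \<noteq> d'"
    obtain u v w where o: "u \<le> n + 2" "v \<le> n + 2" "w \<le> n + 2" "corners t = {vx u, vx v, vx w}" "ccw u v w"
      "d = sg u v" "sides t = {sg u v, sg v w, sg w u}" using side_ccw[OF t d(1)] by metis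
    show "far t d \<inter> far t d' = {}"
      using far_ccw[OF o(1-5)] eb_arc_disjoint[of u v v w] eb_arc_disjoint[of u v w u] arc_cases[OF o(1-3,5)] d o(6,7)
      by auto
  }
  obtain u v w where o: "u \<le> n + 2" "v \<le> n + 2" "w \<le> n + 2" "corners t = {vx u, vx v, vx w}" "ccw u v w"
      "sides t = {sg u v, sg v w, sg w u}" using triangle_ccw[OF t] by metis
  show "(\<Union>d\<in>sides t. far t d) = blossoms P"
    unfolding o(6) boundary_edge_image[symmetric] arc_cases(1)[OF o(1-3,5), symmetric]
    using far_ccw[OF o(1-5)] by (auto simp: image_Un)
  show "\<exists>d''\<in>sides t. d'' \<noteq> d \<and> d'' \<noteq> d'" for d'
    unfolding o(6) using sg_distinct[OF o(1-3,5)] by auto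
next
  fix t d assume t: "t \<in> triangles P T" and d: "d \<in> sides t"
  obtain u v w where o: "u \<le> n + 2" "v \<le> n + 2" "w \<le> n + 2" "corners t = {vx u, vx v, vx w}" "ccw u v w"
      "d = sg u v" "sides t = {sg u v, sg v w, sg w u}" "E u v" "E v w" "E w u" using side_ccw[OF t d] by metis
  have f: "far t d = boundary_edge ` arc u v" using far_ccw(1)[OF o(1-5)] o(6) by simp
  show "far t d \<noteq> {}" unfolding f using o(1) by (auto simp: arc_def)
  show "far t d = {d}" if "d \<in> blossoms P"
  proof -
    have "\<forall>x\<le>n + 2. \<not> ccw u x v"
      using that edge_iff[of u v] o ccw_distinct[OF o(5)] ccw_rot[of u v w] unfolding blossoms_eq by auto
    then have "next_vertex u = v" "arc u v = {u}" using next_vertex_unique[of u v] ccw_distinct[OF o(5)] o(1,2) by (auto simp: arc_def)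
    then show ?thesis unfolding f using o(6) by (simp add: boundary_edge_def)
  qed
  show "\<exists>t'\<in>triangles P T. t' \<noteq> t \<and> d \<in> sides t'" if nb: "d \<notin> blossoms P"
  proof -
    obtain x where x: "x \<le> n + 2" "ccw u x v"
      using nb edge_iff[of u v] o(1,2,6) ccw_distinct[OF o(5)] unfolding blossoms_eq by auto
    obtain c where c: "c \<le> n + 2" "ccw u c v" "E u c" "E c v" using third[OF o(8) x] by blast
    obtain t' where t': "t' \<in> triangles P T" "corners t' = {vx v, vx u, vx c}" "sides t' = {sg v u, sg u c, sg c v}"
      using mk_triangle[of v u c] o(8) c(3,4) E_sym by blast
    have "c \<noteq> w" using c(2) o(5) ccw_asym by blast
    moreover have "c \<noteq> u" "c \<noteq> v" using ccw_distinct[OF c(2)] by auto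
    ultimately have "vx c \<notin> corners t" using o(1-4) c(1) vx_eq_iff by auto
    then have "t' \<noteq> t" using t'(2) by auto
    then show ?thesis using t' o(6) sg_commute by blast
  qed
  fix t' assume t': "t' \<in> triangles P T" "t \<noteq> t'" "d \<in> sides t'"
  obtain u' v' w' where o': "u' \<le> n + 2" "v' \<le> n + 2" "w' \<le> n + 2" "corners t' = {vx u', vx v', vx w'}" "ccw u' v' w'"
      "d = sg u' v'" "E u' v'" "E v' w'" "E w' u'" using side_ccw[OF t'(1,3)] by metis
  have f': "far t' d = boundary_edge ` arc u' v'" using far_ccw(1)[OF o'(1-5)] o'(6) by simp
  have "{u, v} = {u', v'}" using sg_eq_iff o o' by blast
  \<comment> \<open>Read in the same direction, both triangles are on one side of \<open>d\<close>
    and coincide by \<open>third_unique\<close>, against the choice of \<open>t'\<close>; read in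
    opposite directions, \<open>d\<close> bounds complementary arcs.\<close>
  then consider "u' = u" "v' = v" | "u' = v" "v' = u" by (auto simp: doubleton_eq_iff)
  then show "far t' d = blossoms P - far t d"
  proof cases
    case 1
    have "ccw v w u" "ccw v w' u" using o(5) o'(5) 1 ccw_rot by blast+
    then have "w = w'" using third_unique[of v w u w'] o(9,10) o'(8,9) 1 by auto
    then have "corners t = corners t'" using o(4) o'(4) 1 by simp
    then show ?thesis using triangle_eqI t t' by blast
  next
    case 2
    have "u \<noteq> v" using ccw_distinct[OF o(5)] by blast
    then have "arc v u = {..n + 2} - arc u v" using arc_complement o by blast
    then have "boundary_edge ` arc v u = boundary_edge ` {..n + 2} - boundary_edge ` arc u v"
      using inj_on_image_set_diff[OF boundary_edge_inj, of "{..n + 2}" "arc u v"] arc_sub by auto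
    then show ?thesis unfolding f f' boundary_edge_image[symmetric] using 2 by simp
  qed
qed

section \<open>Path counts in the spine\<close>

lemma blossom_path_eq: "blossom_path P T ts ds \<longleftrightarrow> tree_path ts ds"
proof -
  have inc: "incident P T t = sides t" if "t \<in> triangles P T" for t
    using that incoming_outgoing(1) unfolding triangles_eq by auto
  have "(\<forall>i<length ts. ds ! i \<in> incident P T (ts ! i) \<and> ds ! Suc i \<in> incident P T (ts ! i)) \<longleftrightarrow>
        (\<forall>i<length ts. ds ! i \<in> sides (ts ! i) \<and> ds ! Suc i \<in> sides (ts ! i))" if sub: "set ts \<subseteq> triangles P T"
  proof -
    have "incident P T (ts ! i) = sides (ts ! i)" if "i < length ts" for i
      using inc[of "ts ! i"] subsetD[OF sub nth_mem[OF that]] by simp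
    then show ?thesis by simp
  qed
  then show ?thesis unfolding blossom_path_def tree_path_def by (cases "set ts \<subseteq> triangles P T") simp_all
qed

text \<open>By \<open>median_unique\<close> there is one node labelled \<open>j\<close>, and the two
  arcs prescribed by R(j) are \<open>i j\<close> and \<open>j k\<close> in either case. The number
  of paths is then the product of the sizes of the two arcs of blossoms.\<close>

lemma card_R_paths:
  assumes t: "i < j" "j < k" "E i j" "E j k" "E i k"
  shows "card (R_paths n P T j) =
     (if j \<in> U then (n + 2 - card (BB i j)) * (n + 2 - card (BB j k)) else (card (BB i j) + 1) * (card (BB j k) + 1))"
proof -
  have M: "i \<le> n + 2" "j \<le> n + 2" "k \<le> n + 2" "j \<in> {1..n + 1}" using t by (auto simp: E_def)
  let ?t = "triangle_of i j k"
  have tT: "?t \<in> triangles P T" using t triangles_eq by auto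
  have uniq: "t' \<in> triangles P T \<and> node_label P t' = j \<longleftrightarrow> t' = ?t" for t'
  proof
    assume h: "t' \<in> triangles P T \<and> node_label P t' = j"
    then obtain i' j' k' where t': "t' = triangle_of i' j' k'" "i' < j'" "j' < k'" "E i' j'" "E j' k'" "E i' k'"
      using triangles_eq by auto
    then have "j' = j" using h vlabel_vx[of j'] by (auto simp: triangle_of_def E_def)
    then show "t' = ?t" using median_unique[OF t, of i' k'] t' by auto
  qed (use tT M vlabel_vx in \<open>auto simp: triangle_of_def\<close>)
  have inc: "(if j \<in> down_labels n P then incoming P T ?t \<subseteq> \<pi> else outgoing P T ?t \<subseteq> \<pi>) \<longleftrightarrow> {sg i j, sg j k} \<subseteq> \<pi>" for \<pi>
    using incoming_outgoing(2,3)[OF t] D_iff[of j] M(4) by auto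
  have ex: "(\<exists>t\<in>triangles P T. node_label P t = j \<and> X t) \<longleftrightarrow> X ?t" for X
  proof
    assume "\<exists>t\<in>triangles P T. node_label P t = j \<and> X t"
    then obtain t where "t \<in> triangles P T \<and> node_label P t = j" "X t" by blast
    then show "X ?t" using uniq[of t] by simp
  next
    assume "X ?t"
    then show "\<exists>t\<in>triangles P T. node_label P t = j \<and> X t" using uniq[of ?t] tT by (intro bexI[of _ ?t]) auto
  qed
  have "R_paths n P T j = {\<pi> \<in> blossom_paths P T. {sg i j, sg j k} \<subseteq> \<pi>}"
    unfolding R_paths_def by (simp only: ex inc)
  also have "\<dots> = {set ds | ts ds. tree_path ts ds \<and> {sg i j, sg j k} \<subseteq> set ds}"
    unfolding blossom_paths_def blossom_path_eq by blast
  finally have "card (R_paths n P T j) = card (far ?t (sg i j)) * card (far ?t (sg j k))"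
    using card_paths_through[OF tT, of "sg i j" "sg j k"] sg_eq_iff[of i j j k] M t(1,2)
    by (auto simp: sides_tr doubleton_eq_iff)
  moreover have "card (far ?t (sg i j)) = (if j \<in> U then n + 2 - card (BB i j) else card (BB i j) + 1) \<and>
                 card (far ?t (sg j k)) = (if j \<in> U then n + 2 - card (BB j k) else card (BB j k) + 1)"
  proof (cases "j \<in> U")
    case True
    \<comment> \<open>For an up median the counterclockwise reading is \<open>i k j\<close>, so the
      arcs beyond the two sides are those above them.\<close>
    then have c: "ccw i k j" using ccw_sorted t M by blast
    have "far ?t (sg k j) = boundary_edge ` arc k j" "far ?t (sg j i) = boundary_edge ` arc j i"
      using far_ccw[OF M(1,3,2) _ c, of ?t] by (auto simp: corners_tr)
    then show ?thesis
      using card_arc(2)[of i j, folded arc_def] card_arc(2)[of j k, folded arc_def] t(1,2) M True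
        sg_commute[of i j] sg_commute[of j k] by (simp add: card_eb_arc)
  next
    case False
    then have c: "ccw i j k" using ccw_sorted t M by blast
    have "far ?t (sg i j) = boundary_edge ` arc i j" "far ?t (sg j k) = boundary_edge ` arc j k"
      using far_ccw[OF M(1,2,3) _ c, of ?t] by (auto simp: corners_tr)
    then show ?thesis
      using card_arc(1)[of i j, folded arc_def] card_arc(1)[of j k, folded arc_def] t(1,2) M False
      by (simp add: card_eb_arc)
  qed
  ultimately show ?thesis by simp
qed

end

section \<open>The realization\<close>

context labels
begin

section \<open>Boundedness\<close>

lemma nearest:
  assumes "0 < j" "j < M" "Z 0" "Z M"
  shows "\<exists>i k. i < j \<and> j < k \<and> k \<le> M \<and> Z i \<and> Z k \<and> (\<forall>w. i < w \<longrightarrow> w < k \<longrightarrow> w \<noteq> j \<longrightarrow> \<not> Z w)"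
proof -
  obtain i where i: "i < j \<and> Z i" "\<And>y. y < j \<and> Z y \<Longrightarrow> y \<le> i"
    using ex_has_greatest_nat[of "\<lambda>i. i < j \<and> Z i" 0 "\<lambda>x. x" j] assms by auto
  obtain k where k: "j < k \<and> Z k" "\<And>y. j < y \<and> Z y \<Longrightarrow> k \<le> y"
    using ex_has_least_nat[of "\<lambda>k. j < k \<and> Z k" M "\<lambda>x. x"] assms by auto
  have "\<not> Z w" if "i < w" "w < k" "w \<noteq> j" for w
    using i(2)[of w] k(2)[of w] that by (cases "w < j") auto
  moreover have "k \<le> M" using k(2)[of M] assms by blast
  ultimately show ?thesis using i(1) k(1) by blast
qed

text \<open>Two triangles with median \<open>j\<close> give the two bounds, since all sums over sets
  B are nonnegative. If the outer corners are the nearest up labels or the extreme vertices, the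
  larger sets in the triangle relation are full and bound \<open>y j\<close> above; with the nearest
  labels that are not up, the smaller sets are empty and bound it below.\<close>

lemma coordinate_bound:
  fixes y :: "nat \<Rightarrow> real"
  assumes y: "\<And>a b. a < b \<Longrightarrow> b \<le> M \<Longrightarrow> wt (BB a b) \<le> sum y (BB a b)" and tot: "sum y {1..<M} = wt {1..<M}"
    and j: "0 < j" "j < M"
  shows "\<bar>y j\<bar> \<le> wt {1..<M}"
proof -
  have pos: "0 \<le> sum y (BB a b)" if "a < b" "b \<le> M" for a b
    using y[OF that] by (simp add: wt_def order_trans[OF of_nat_0_le_iff])
  obtain i k where ik: "i < j" "j < k" "k \<le> M" "i \<in> U \<or> i = 0 \<or> i = M" "k \<in> U \<or> k = 0 \<or> k = M"
    "\<forall>w. i < w \<longrightarrow> w < k \<longrightarrow> w \<noteq> j \<longrightarrow> w \<notin> U"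
    using nearest[OF j, of "\<lambda>w. w \<in> U \<or> w = 0 \<or> w = M"] by blast
  obtain i' k' where ik': "i' < j" "j < k'" "k' \<le> M" "i' \<notin> U" "k' \<notin> U"
    "\<forall>w. i' < w \<longrightarrow> w < k' \<longrightarrow> w \<noteq> j \<longrightarrow> w \<in> U"
    using nearest[OF j, of "\<lambda>w. w \<notin> U"] UM[of 0] UM[of M] by blast
  have p: "0 \<le> sum y (BB i j)" "0 \<le> sum y (BB j k)" "0 \<le> sum y (BB i k)"
    "0 \<le> sum y (BB i' j)" "0 \<le> sum y (BB j k')" "0 \<le> sum y (BB i' k')"
    using pos ik ik' by auto
  have N: "0 \<le> wt {1..<M}" by (simp add: wt_def)
  show ?thesis
  proof (cases "j \<in> U")
    case False
    have "w \<in> BB i k" if "0 < w" "w < M" for w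
      using ik that False unfolding BB_def by (cases "w \<le> i"; cases "k \<le> w"; cases "w = j") auto
    then have "BB i k = {1..<M}" using BB_sub[of i k] by auto
    moreover have "BB i' j = {}" "BB j k' = {}" using ik' False by (auto simp: BB_def)
    ultimately show ?thesis
      using sum_BB_down[OF ik(1-3) False, of y] sum_BB_down[OF ik'(1-3) False, of y] p tot N
        y[of i' k'] ik' sum_BB_down[OF ik(1-3) False, of y] by auto
  next
    case True
    have "BB i j = {1..<M}" "BB j k = {1..<M}" using ik True by (auto simp: BB_def)
    moreover have "BB i' k' = {}" using ik' True by (auto simp: BB_def)
    ultimately show ?thesis
      using sum_BB_up[OF ik(1-3) True, of y] sum_BB_up[OF ik'(1-3) True, of y] p tot N by auto
  qed
qed

end

locale realized_polygon = polygon +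
  fixes lab :: "'m::finite \<Rightarrow> nat"
  assumes lab: "bij_betw lab UNIV {1..n+1}"
begin

section \<open>Coordinates and the system of constraints\<close>

definition coord :: "real^'m \<Rightarrow> nat \<Rightarrow> real" where
  "coord x j = x $ inv_into UNIV lab j"

definition ind :: "nat set \<Rightarrow> real^'m" where
  "ind J = (\<chi> m. if lab m \<in> J then 1 else 0)"

lemma lab_range: "lab m \<in> {1..n+1}"
  using lab by (auto simp: bij_betw_def)

lemma coord_lab: "coord x (lab m) = x $ m"
  using lab by (simp add: coord_def bij_betw_def)

lemma lab_surj: "j \<in> {1..n+1} \<Longrightarrow> lab (inv_into UNIV lab j) = j"
  using lab by (simp add: bij_betw_inv_into_right)

lemma coord_vec: "j \<in> {1..n+1} \<Longrightarrow> coord (\<chi> m. y (lab m)) j = y j"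
  using lab_surj by (simp add: coord_def)

lemma sum_lab:
  assumes "J \<subseteq> {1..n+1}"
  shows "(\<Sum>m | lab m \<in> J. x $ m) = sum (coord x) J"
proof -
  have "bij_betw lab {m. lab m \<in> J} J" using lab assms by (auto simp: bij_betw_def inj_on_def image_iff)
  from sum.reindex_bij_betw[OF this, of "coord x"] show ?thesis by (simp add: coord_lab)
qed

lemma ind_inner:
  assumes "J \<subseteq> {1..n+1}"
  shows "ind J \<bullet> x = sum (coord x) J"
proof -
  have "ind J \<bullet> x = (\<Sum>m\<in>UNIV. if lab m \<in> J then x $ m else 0)"
    unfolding ind_def inner_vec_def by (intro sum.cong) auto
  also have "\<dots> = (\<Sum>m | lab m \<in> J. x $ m)" by (simp add: sum.If_cases)
  finally show ?thesis using sum_lab[OF assms] by simp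
qed

lemma labels_range: "{1..<n + 2} = {1..n + 1}"
  by auto

lemma BB_range: "BB a b \<subseteq> {1..n+1}"
  using BB_sub[of a b] labels_range by simp

abbreviation DD :: "(real^2) set set" where "DD \<equiv> internal_diagonals P"
abbreviation Bv :: "(real^2) set \<Rightarrow> real^'m" where "Bv \<equiv> \<lambda>\<delta>. ind (B_labels n P \<delta>)"
abbreviation Bw :: "(real^2) set \<Rightarrow> real" where "Bw \<equiv> \<lambda>\<delta>. wt (B_labels n P \<delta>)"

text \<open>The index set consists of the internal diagonals, so that tight sets can be dissections;
  \<open>Q_coord\<close> recovers the inequalities of the boundary edges.\<close>

sublocale cs: constraint_system "ind {1..n+1}" "wt {1..n+1}" DD Bv Bw .

lemma Q_coord:
  "x \<in> cs.Q \<longleftrightarrow> sum (coord x) {1..<n + 2} = wt {1..<n + 2} \<and>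
     (\<forall>a b. a < b \<longrightarrow> b \<le> n + 2 \<longrightarrow> wt (BB a b) \<le> sum (coord x) (BB a b))"
proof -
  have 1: "ind {1..n+1} \<bullet> x = sum (coord x) {1..<n + 2}" using ind_inner[of "{1..n+1}" x] labels_range by simp
  have 2: "Bw (sg a b) \<le> Bv (sg a b) \<bullet> x \<longleftrightarrow> wt (BB a b) \<le> sum (coord x) (BB a b)" if "a < b" "b \<le> n + 2" for a b
    using B_labels_sg[OF that] ind_inner[OF BB_range] by simp
  have 3: "wt (BB a b) \<le> sum (coord x) (BB a b)"
    if h: "a < b" "b \<le> n + 2" "sg a b \<notin> DD" "sum (coord x) {1..<n + 2} = wt {1..<n + 2}" for a b
  proof -
    have "(\<forall>x\<le>n + 2. \<not> ccw a x b) \<or> (\<forall>x\<le>n + 2. \<not> ccw b x a)"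
      using h unfolding internal_diagonals_eq by blast
    then have "BB a b = {} \<or> BB a b = {1..<n + 2}" using BB_boundary[OF h(1,2)] by blast
    then show ?thesis using h(4) by (auto simp: wt_def)
  qed
  have 4: "\<exists>a b. \<delta> = sg a b \<and> a < b \<and> b \<le> n + 2" if "\<delta> \<in> DD" for \<delta>
    using that unfolding internal_diagonals_eq by blast
  have "x \<in> cs.Q \<longleftrightarrow> sum (coord x) {1..<n + 2} = wt {1..<n + 2} \<and> (\<forall>\<delta>\<in>DD. Bw \<delta> \<le> Bv \<delta> \<bullet> x)"
    by (simp only: cs.Q_def mem_Collect_eq 1 labels_range)
  then show ?thesis using 2 3 4 by metis
qed

lemma Q_eq: "cs.Q = H_eq lab {1..n+1} \<inter> (\<Inter>\<delta>\<in>diagonals P. H_ge lab (B_labels n P \<delta>))"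
proof -
  have "x \<in> H_eq lab {1..n+1} \<longleftrightarrow> sum (coord x) {1..<n + 2} = wt {1..<n + 2}" for x :: "real^'m"
    by (simp only: H_eq_def wt_def mem_Collect_eq sum_lab[OF subset_refl] labels_range)
  moreover have "x \<in> H_ge lab (B_labels n P (sg a b)) \<longleftrightarrow> wt (BB a b) \<le> sum (coord x) (BB a b)"
    if "a < b" "b \<le> n + 2" for x :: "real^'m" and a b
    using sum_lab[OF BB_range] B_labels_sg[OF that] by (simp add: H_ge_def wt_def)
  ultimately have "x \<in> cs.Q \<longleftrightarrow> x \<in> H_eq lab {1..n+1} \<inter> (\<Inter>\<delta>\<in>diagonals P. H_ge lab (B_labels n P \<delta>))" for x
  proof -
    assume 1: "\<And>x. x \<in> H_eq lab {1..n+1} \<longleftrightarrow> sum (coord x) {1..<n + 2} = wt {1..<n + 2}"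
      and 2: "\<And>a b x. a < b \<Longrightarrow> b \<le> n + 2 \<Longrightarrow>
        x \<in> H_ge lab (B_labels n P (sg a b)) \<longleftrightarrow> wt (BB a b) \<le> sum (coord x) (BB a b)"
    have "x \<in> (\<Inter>\<delta>\<in>diagonals P. H_ge lab (B_labels n P \<delta>)) \<longleftrightarrow>
        (\<forall>a b. a < b \<longrightarrow> b \<le> n + 2 \<longrightarrow> x \<in> H_ge lab (B_labels n P (sg a b)))"
      unfolding diagonals_eq by blast
    then show ?thesis unfolding Q_coord Int_iff 1 using 2 by simp
  qed
  then show ?thesis by blast
qed

section \<open>Tight sets and the points of triangulations\<close>

lemma BS_ge:
  assumes x: "x \<in> cs.Q" and "u \<le> n + 2" "w \<le> n + 2" "u \<noteq> w"
  shows "wt (BS u w) \<le> sum (coord x) (BS u w)"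
  using x assms(2-4) unfolding Q_coord by (auto simp: BS_def min_def max_def)

lemma tight_iff:
  assumes "a < b" "b \<le> n + 2"
  shows "sg a b \<in> cs.tight x \<longleftrightarrow> sg a b \<in> DD \<and> sum (coord x) (BB a b) = wt (BB a b)"
  using B_labels_sg[OF assms] ind_inner[OF BB_range] by (simp add: cs.tight_def)

lemma tight_dissection:
  assumes x: "x \<in> cs.Q"
  shows "dissection P (cs.tight x)"
  unfolding dissection_def
proof (intro conjI ballI notI)
  show "cs.tight x \<subseteq> DD" by (auto simp: cs.tight_def)
  fix \<delta> \<epsilon> assume d: "\<delta> \<in> cs.tight x" "\<epsilon> \<in> cs.tight x" and cr: "crossing \<delta> \<epsilon>"
  have D: "\<delta> \<in> DD" "\<epsilon> \<in> DD" using d by (auto simp: cs.tight_def)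
  obtain a b where ab: "\<delta> = sg a b" "a < b" "b \<le> n + 2" using D(1) unfolding internal_diagonals_eq by blast
  obtain c e where ce: "\<epsilon> = sg c e" "c < e" "e \<le> n + 2" using D(2) unfolding internal_diagonals_eq by blast
  have bd: "a \<le> n + 2" "c \<le> n + 2" "a \<noteq> b" "c \<noteq> e" using ab ce by auto
  have crosses: "crosses a b c e" using cr crossing_sg bd ab ce by blast
  obtain u u' w w' where q: "{u, u'} = {a, b}" "{w, w'} = {c, e}" "BS u w = BS a b \<inter> BS c e"
      "BS u' w' = BS a b \<union> BS c e" and ne: "BS a b - BS c e \<noteq> {}" "BS c e - BS a b \<noteq> {}"
    using BS_uncross[OF bd(1) ab(3) bd(2) ce(3) crosses] by (elim exE conjE)
  have ge: "wt (BS p r) \<le> sum (coord x) (BS p r)" if p: "p \<in> {a, b}" and r: "r \<in> {c, e}" for p r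
  proof (rule BS_ge[OF x])
    show "p \<noteq> r" using p r crosses ccw_distinct unfolding crosses_def by blast
  qed (use p r bd ab ce in auto)
  have m: "u \<in> {a, b}" "u' \<in> {a, b}" "w \<in> {c, e}" "w' \<in> {c, e}" using q by blast+
  have t: "sum (coord x) (BS a b) = wt (BS a b)" "sum (coord x) (BS c e) = wt (BS c e)"
    using d tight_iff ab ce by (auto simp: BS_sorted)
  obtain v v' where v: "v \<in> BS a b - BS c e" "v' \<in> BS c e - BS a b" using ne by blast
  have "wt (BS a b) + wt (BS c e) < wt (BS a b \<union> BS c e) + wt (BS a b \<inter> BS c e)"
    by (rule wt_supermodular[OF _ _ v]) auto
  also have "\<dots> \<le> sum (coord x) (BS a b \<union> BS c e) + sum (coord x) (BS a b \<inter> BS c e)"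
    using ge[OF m(1,3)] ge[OF m(2,4)] q by simp
  also have "\<dots> = sum (coord x) (BS a b) + sum (coord x) (BS c e)" by (rule sum.union_inter) auto
  finally show False using t by simp
qed

lemma finite_DD: "finite DD"
proof -
  have "DD \<subseteq> (\<lambda>(a, b). sg a b) ` ({..n + 2} \<times> {..n + 2})" unfolding internal_diagonals_eq by auto
  then show ?thesis by (rule finite_subset) simp
qed

lemma dissection_extend:
  assumes S: "dissection P S"
  shows "\<exists>T. triangulation P T \<and> S \<subseteq> T"
proof -
  have "finite {X. dissection P X}"
    by (rule finite_subset[of _ "Pow DD"]) (use finite_DD in \<open>auto simp: dissection_def\<close>)
  from finite_has_maximal2[OF this, of S] S
  obtain T where "dissection P T" "S \<subseteq> T" "\<forall>X\<in>{X. dissection P X}. T \<subseteq> X \<longrightarrow> T = X" by auto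
  then show ?thesis by (intro exI[of _ T]) (auto simp: triangulation_def)
qed

lemma x_point_props:
  assumes T: "triangulation P T"
  shows "x_point n P lab T \<in> cs.Q" "cs.tight (x_point n P lab T) = T"
proof -
  interpret triangulated_polygon n P T by unfold_locales (rule T)
  obtain y :: "nat \<Rightarrow> real" where y: "sum y {1..<n + 2} = wt {1..<n + 2}"
    "\<And>a b. a < b \<Longrightarrow> E a b \<Longrightarrow> sum y (BB a b) = wt (BB a b)" using ex_point by blast
  \<comment> \<open>The same products arise twice: in \<open>wt_formula\<close> from the sizes of
    the sets B, in \<open>card_R_paths\<close> from the numbers of blossoms beyond the
    sides.\<close>
  have yj: "y j = (if j \<in> down_labels n P then real (card (R_paths n P T j)) else real (n + 2) - real (card (R_paths n P T j)))"
    if j: "j \<in> {1..n+1}" for j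
  proof -
    obtain i k where t: "i < j" "j < k" "k \<le> n + 2" "E i j" "E j k" "E i k" using median_exists[of j] j by auto
    have "y j = (if j \<in> U then real (n + 2) - real (n + 2 - card (BB i j)) * real (n + 2 - card (BB j k))
                else real (card (BB i j) + 1) * real (card (BB j k) + 1))"
      by (rule wt_formula[OF t(1-3)]) (use y t in auto)
    then show ?thesis using card_R_paths[OF t(1,2,4,5,6)] D_iff[of j] j
      by (cases "j \<in> U") (simp, simp add: algebra_simps)
  qed
  let ?x = "x_point n P lab T"
  have co: "coord ?x j = y j" if "j \<in> {1..n+1}" for j
  proof -
    have "?x = (\<chi> m. y (lab m))" unfolding x_point_def using yj[OF lab_range] by (simp add: vec_eq_iff)
    then show ?thesis using coord_vec[OF that] by simp
  qed
  have s: "sum (coord ?x) J = sum y J" if "J \<subseteq> {1..n+1}" for J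
    by (rule sum.cong) (use co that in auto)
  have sB: "sum (coord ?x) (BB a b) = sum y (BB a b)" for a b by (rule s[OF BB_range])
  have ge: "wt (BB a b) \<le> sum y (BB a b) \<and> (\<not> E a b \<longrightarrow> wt (BB a b) < sum y (BB a b))" if "a < b" "b \<le> n + 2" for a b
    using sum_ge_wt[OF y(2), of a b] that by (simp add: BS_sorted)
  show "?x \<in> cs.Q" unfolding Q_coord using ge sB s[of "{1..<n + 2}"] y(1) labels_range by auto
  have "sg a b \<in> cs.tight ?x \<longleftrightarrow> sg a b \<in> T" if ab: "a < b" "b \<le> n + 2" for a b
  proof
    assume t: "sg a b \<in> cs.tight ?x"
    then have "E a b" using tight_iff[OF ab] ge[OF ab] sB by force
    moreover have "\<not> sg a b edge_of P" using t tight_iff[OF ab] by (simp add: internal_diagonals_def)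
    ultimately show "sg a b \<in> T" by (simp add: E_def)
  next
    assume t: "sg a b \<in> T"
    then have "E a b" using ab by (simp add: E_def)
    then show "sg a b \<in> cs.tight ?x" using t T_internal tight_iff[OF ab] y(2)[OF ab(1)] sB by auto
  qed
  moreover have "\<exists>a b. \<delta> = sg a b \<and> a < b \<and> b \<le> n + 2" if "\<delta> \<in> DD" for \<delta>
    using that unfolding internal_diagonals_eq by blast
  moreover have "cs.tight ?x \<subseteq> DD" by (auto simp: cs.tight_def)
  ultimately show "cs.tight ?x = T" using T_internal by blast
qed

lemma coord_vec_sum:
  "J \<subseteq> {1..n+1} \<Longrightarrow> sum (coord (\<chi> m. y (lab m))) J = sum y J"
  by (rule sum.cong) (use coord_vec in auto)

lemma dual_exists:
  assumes T: "triangulation P T" and d: "\<delta> \<in> T"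
  shows "\<exists>y. ind {1..n+1} \<bullet> y = 0 \<and> Bv \<delta> \<bullet> y = 1 \<and> (\<forall>\<epsilon>\<in>T - {\<delta>}. Bv \<epsilon> \<bullet> y = 0)"
proof -
  interpret triangulated_polygon n P T by unfold_locales (rule T)
  obtain a b x x' where ab: "\<delta> = sg a b" "a < b" "b \<le> n + 2" and x: "x \<le> n + 2" "ccw a x b" "x' \<le> n + 2" "ccw b x' a"
    using d T_internal unfolding internal_diagonals_eq by blast
  have "E a b" using ab d by (simp add: E_def)
  then obtain y :: "nat \<Rightarrow> real" where y: "sum y {1..<n + 2} = 0" "sum y (BB a b) = 1"
      "\<And>c d. c < d \<Longrightarrow> E c d \<Longrightarrow> (c, d) \<noteq> (a, b) \<Longrightarrow> sum y (BB c d) = 0"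
    using dual_vector[OF ab(2) _ x] by blast
  let ?y = "\<chi> m. y (lab m)"
  have in_B: "Bv (sg c e) \<bullet> ?y = sum y (BB c e)" if "c < e" "e \<le> n + 2" for c e
    using B_labels_sg[OF that] ind_inner[OF BB_range] coord_vec_sum[OF BB_range] by simp
  have "Bv \<epsilon> \<bullet> ?y = 0" if e: "\<epsilon> \<in> T - {\<delta>}" for \<epsilon>
  proof -
    obtain c f where cf: "\<epsilon> = sg c f" "c < f" "f \<le> n + 2"
      using e T_internal unfolding internal_diagonals_eq by blast
    have "E c f" using cf e by (simp add: E_def)
    moreover have "(c, f) \<noteq> (a, b)" using e ab(1) cf(1) by auto
    ultimately show ?thesis using y(3) in_B cf by simp
  qed
  moreover have "Bv \<delta> \<bullet> ?y = 1" using in_B ab y(2) by simp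
  moreover have "ind {1..n+1} \<bullet> ?y = 0"
    using ind_inner[of "{1..n+1}" ?y] coord_vec_sum[of "{1..n+1}" y] y(1) labels_range by simp
  ultimately show ?thesis by blast
qed

lemma determined_by_triangulation:
  assumes T: "triangulation P T" and c: "ind {1..n+1} \<bullet> y = 0" and z: "\<And>\<delta>. \<delta> \<in> T \<Longrightarrow> Bv \<delta> \<bullet> y = 0"
  shows "y = 0"
proof -
  interpret triangulated_polygon n P T by unfold_locales (rule T)
  have tot: "sum (coord y) {1..<n + 2} = 0" using c ind_inner[of "{1..n+1}" y] labels_range by simp
  have "sum (coord y) (BB a b) = 0" if ab: "a < b" "E a b" for a b
  proof (cases "sg a b \<in> T")
    case True
    then show ?thesis using z[OF True] B_labels_sg[of a b] ind_inner[OF BB_range] ab by (auto simp: E_def)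
  next
    case False
    have M: "a \<le> n + 2" "b \<le> n + 2" using ab by (auto simp: E_def)
    then have "BB a b = {} \<or> BB a b = {1..<n + 2}"
      using E_boundary[of a b] edge_iff[of a b] False ab by (auto simp: E_def)
    then show ?thesis using tot by auto
  qed
  then have "coord y j = 0" if "j \<in> {1..n+1}" for j
    using sum_zero_imp_zero[of "coord y" j] tot that by auto
  then have "y $ m = 0" for m using lab_range[of m] coord_lab[of y m] by metis
  then show ?thesis by (simp add: vec_eq_iff)
qed

lemma bounded_cs_Q: "bounded cs.Q"
proof (rule boundedI)
  fix x assume x: "x \<in> cs.Q"
  have "\<bar>x $ m\<bar> \<le> wt {1..<n + 2}" for m
  proof -
    have "\<bar>coord x (lab m)\<bar> \<le> wt {1..<n + 2}"
      by (rule coordinate_bound) (use x[unfolded Q_coord] lab_range[of m] in auto)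
    then show ?thesis by (simp add: coord_lab)
  qed
  then have "(\<Sum>m\<in>UNIV. \<bar>x $ m\<bar>) \<le> real CARD('m) * wt {1..<n + 2}"
    using sum_bounded_above[of UNIV "\<lambda>m. \<bar>x $ m\<bar>" "wt {1..<n + 2}"] by simp
  then show "norm x \<le> real CARD('m) * wt {1..<n + 2}" using norm_le_l1_cart[of x] by linarith
qed

section \<open>Faces of the realization\<close>

sublocale tp: tight_polytope "ind {1..n+1}" "wt {1..n+1}" DD Bv Bw
  "{S. dissection P S}" "{T. triangulation P T}" "x_point n P lab"
proof unfold_locales
  show "finite DD" by (rule finite_DD)
  have "ind {1..n+1} $ undefined = 1" using lab_range by (simp add: ind_def)
  then show "ind {1..n+1} \<noteq> (0 :: real^'m)" by force
  show "cs.tight x \<in> {S. dissection P S}" if "x \<in> cs.Q" for x using tight_dissection that by simp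
  show "\<exists>T\<in>{T. triangulation P T}. S \<subseteq> T" if "S \<in> {S. dissection P S}" for S
    using dissection_extend that by blast
  have tri: "dissection P T" if "T \<in> {T. triangulation P T}" for T using that by (simp add: triangulation_def)
  show "S \<in> {S. dissection P S}" if "T \<in> {T. triangulation P T}" "S \<subseteq> T" for T S
    using tri[OF that(1)] that(2) unfolding dissection_def mem_Collect_eq by (meson subset_iff)
  show "T \<subseteq> DD" if "T \<in> {T. triangulation P T}" for T using tri[OF that] by (simp add: dissection_def)
  have "dissection P {}" by (simp add: dissection_def)
  then show "{T. triangulation P T} \<noteq> {}" using dissection_extend by blast
  show "x_point n P lab T \<in> cs.Q" if "T \<in> {T. triangulation P T}" for T using x_point_props that by simp
  show "cs.tight (x_point n P lab T) = T" if "T \<in> {T. triangulation P T}" for T using x_point_props that by simp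
  show "\<exists>y. ind {1..n+1} \<bullet> y = 0 \<and> Bv d \<bullet> y = 1 \<and> (\<forall>e\<in>T - {d}. Bv e \<bullet> y = 0)"
    if "T \<in> {T. triangulation P T}" "d \<in> T" for T d using dual_exists that by simp
  show "y = 0" if "T \<in> {T. triangulation P T}" "ind {1..n+1} \<bullet> y = 0" "\<And>d. d \<in> T \<Longrightarrow> Bv d \<bullet> y = 0" for T y
    using determined_by_triangulation that by simp
  show "bounded cs.Q" by (rule bounded_cs_Q)
qed

lemma Asso_eq_Q: "Asso n P lab = cs.Q"
  unfolding Asso_def tp.Q_eq_convex_hull by (simp add: setcompr_eq_image)

lemma associahedron_Q: "associahedron n cs.Q"
  unfolding associahedron_def
proof (intro conjI exI)
  show "simple_polytope cs.Q" by (rule tp.simple_polytope_Q)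
  have "CARD('m) = n + 1" using bij_betw_same_card[OF lab] by simp
  then show "aff_dim cs.Q = int n" using tp.aff_dim_Q by simp
  \<comment> \<open>The polygon \<open>P\<close> itself serves as the reference polygon for the
    dissection poset.\<close>
  show "convex_polygon (n + 3) P" by (rule polygon)
  show "bij_betw tp.face_label {F. F face_of cs.Q \<and> F \<noteq> {}} {X. dissection P X}" by (rule tp.bij_face_label)
  show "\<forall>F G. F face_of cs.Q \<and> F \<noteq> {} \<and> G face_of cs.Q \<and> G \<noteq> {} \<longrightarrow>
      (F \<subseteq> G) = (tp.face_label G \<subseteq> tp.face_label F)"
    using tp.face_label_antimono by blast
qed

end

theorem theorem7:
  fixes n :: nat and P :: "(real^2) set" and lab :: "'m::finite \<Rightarrow> nat"
  assumes "n \<ge> 1"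
    and "convex_polygon (n + 3) P"
    and "inj_on (\<lambda>v. v $ 1) (verts P)"
    and "bij_betw lab UNIV {1..n+1}"
  shows "Asso n P lab = H_eq lab {1..n+1} \<inter> (\<Inter>\<delta>\<in>diagonals P. H_ge lab (B_labels n P \<delta>))
         \<and> associahedron n (Asso n P lab)"
proof -
  interpret realized_polygon n P lab by unfold_locales (use assms in auto)
  show ?thesis using Asso_eq_Q Q_eq associahedron_Q by simp
qed

end
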